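(* Suppose that $\Lambda$ is a row-finite $k$-graph with no sources, $\eta:\Lambda\to G$ is a functor from $\Lambda$ into a group $G$, and $B$ is the Fell bundle over $G$ with fibres $B_g=\overline{\operatorname{span}}\{s_\lambda s_\mu^*:\eta(\lambda)\eta(\mu)^{-1}=g\}\subset C^*(\Lambda)$. Suppose that $\sigma\in Z^2(G,\mathbb{T})$ is a cocycle. Suppose there is a representation $\rho=\{\rho_g\}$ of the deformed Fell bundle $B(\sigma)$ in a multiplier algebra $M(A)$, and that there is a strictly continuous action $\alpha$ of $\mathbb{T}^k$ on $M(A)$ such that $\rho_g\circ\beta_z=\alpha_z\circ\rho_g$ for all $z\in\mathbb{T}^k$ and $g\in G$, where $\beta$ is the gauge action. If $\rho_e(p_v)\neq0$ for every $v\in\Lambda^0$, then the corresponding representation $\rho$ of $C^*(B(\sigma))$ is faithful.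
   Context: All groups $G$ are discrete. A $k$-graph is a countable small category $\Lambda$ with a functor $d:\Lambda\to\mathbb{N}^k$ satisfying the factorisation property: if $d(\lambda)=m+n$, there are unique $\mu,\nu$ with $\lambda=\mu\nu$, $d(\mu)=m$, $d(\nu)=n$. Range and source (codomain and domain) are written $r,s$, so $\lambda\mu$ is defined exactly when $s(\lambda)=r(\mu)$. $\Lambda^n:=d^{-1}(n)$, $\Lambda^0$ is identified with the set of objects, $v\Lambda^n:=\{\lambda\in\Lambda^n:r(\lambda)=v\}$. Row-finite with no sources means every $v\Lambda^n$ is finite and nonempty. $C^*(\Lambda)$ is the universal $C^*$-algebra generated by a Cuntz--Krieger family $\{s_\lambda\}$: the $p_v:=s_v$ ($v\in\Lambda^0$) are mutually orthogonal projections; $s_\lambda s_\mu=s_{\lambda\mu}$ if $s(\lambda)=r(\mu)$; $s_\lambda^*s_\lambda=p_{s(\lambda)}$; $p_v=\sum_{\lambda\in v\Lambda^n}s_\lambda s_\lambda^*$. A functor $\eta:\Lambda\to G$ is a map with $\eta(\lambda\mu)=\eta(\lambda)\eta(\mu)$ for composable $\lambda,\mu$ and $\eta(v)=e$ for $v\in\Lambda^0$. A Fell bundle over $G$ is a set $B$ with a map $p:B\to G$ whose fibres $B_g=p^{-1}(g)$ are complex Banach spaces, with an associative multiplication and an involution such that: $p(bc)=p(b)p(c)$; multiplication is bilinear $B_g\times B_h\to B_{gh}$ with $\|bc\|\le\|b\|\,\|c\|$; $b\mapsto b^*$ is conjugate linear $B_g\to B_{g^{-1}}$ with $(bc)^*=c^*b^*$,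 $\|b^*b\|=\|b\|^2$ (so $B_e$ is a $C^*$-algebra); and $b^*b\ge0$ in $B_e$. The subspaces $B_g\subset C^*(\Lambda)$ of the claim form such a bundle with the operations and norm of $C^*(\Lambda)$. $Z^2(G,\mathbb{T})$ is the set of $\sigma:G\times G\to\mathbb{T}$ with $\sigma(e,g)=\sigma(g,e)=1$ and $\sigma(g,h)\sigma(gh,k)=\sigma(g,hk)\sigma(h,k)$. The deformed bundle $B(\sigma)$ is the Fell bundle with the same set, projection and Banach space fibres as $B$, and operations $b\cdot_\sigma c=\sigma(g,h)bc$, $b^{*_\sigma}=\overline{\sigma(g,g^{-1})}b^*$ for $b\in B_g$, $c\in B_h$. A representation of a Fell bundle $B$ consists of linear maps $\pi_g$ on $B_g$ with $\pi_{gh}(bc)=\pi_g(b)\pi_h(c)$, $\pi_g(b)^*=\pi_{g^{-1}}(b^* )$ and $\pi_e$ nondegenerate (for maps into $M(A)$: $\pi_e(B_e)A$ spans a dense subspace of $A$). $C^*(B)$ is the $C^*$-algebra generated by a universal representation of $B$; a representation $\rho=\{\rho_g\}$ of $B$ induces a homomorphism, also written $\rho$, of $C^*(B)$. The gauge action $\beta$ of $\mathbb{T}^k$ on $C^*(B(\sigma))$ is the continuous action determined on the (isometric) images of the fibres $B_g$ by $\beta_z(s_\lambda s_\mu^* )=z^{d(\lambda)-d(\mu)}s_\lambda s_\mu^*$; in $\rho_g\circ\beta_z$ it is viewed as a map $B_g\to B_g$. Here $A$ is a $C^*$-algebra with multiplier algebra $M(A)$; a strictly continuous action $\alpha$ on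 $M(A)$ is a homomorphism $z\mapsto\alpha_z$ into the automorphism group of $M(A)$ such that $z\mapsto\alpha_z(m)$ is continuous for the strict topology for each $m\in M(A)$. *)

theory Defs
  imports "HOL-Analysis.Analysis" "HOL-Algebra.Ring"
begin

section \<open>C*-algebras\<close>

text \<open>C*-algebras are carrier-based and not necessarily unital; the record field \<open>one\<close> inherited
  from \<^typ>\<open>'a ring\<close> is not constrained by the axioms below.\<close>

record 'a cstar = "'a ring" +
  cscale :: "complex \<Rightarrow> 'a \<Rightarrow> 'a"
  cadj :: "'a \<Rightarrow> 'a"
  cnorm :: "'a \<Rightarrow> real"

text \<open>The value 0 outside the carrier is there because \<^locale>\<open>Metric_space\<close> wants
  nonnegativity and symmetry of the distance on the whole type.\<close>

definition cdist :: "'a cstar \<Rightarrow> 'a \<Rightarrow> 'a \<Rightarrow> real" where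
  "cdist A x y = (if x \<in> carrier A \<and> y \<in> carrier A then cnorm A (x \<ominus>\<^bsub>A\<^esub> y) else 0)"

definition ctopology :: "'a cstar \<Rightarrow> 'a topology" where
  "ctopology A = Metric_space.mtopology (carrier A) (cdist A)"

locale cstar_algebra = abelian_group A for A :: "'a cstar" (structure) +
  assumes mult_closed: "\<lbrakk>x \<in> carrier A; y \<in> carrier A\<rbrakk> \<Longrightarrow> x \<otimes> y \<in> carrier A"
    and mult_assoc: "\<lbrakk>x \<in> carrier A; y \<in> carrier A; z \<in> carrier A\<rbrakk> \<Longrightarrow> (x \<otimes> y) \<otimes> z = x \<otimes> (y \<otimes> z)"
    and distrib_right: "\<lbrakk>x \<in> carrier A; y \<in> carrier A; z \<in> carrier A\<rbrakk> \<Longrightarrow> (x \<oplus> y) \<otimes> z = x \<otimes> z \<oplus> y \<otimes> z"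
    and distrib_left: "\<lbrakk>x \<in> carrier A; y \<in> carrier A; z \<in> carrier A\<rbrakk> \<Longrightarrow> z \<otimes> (x \<oplus> y) = z \<otimes> x \<oplus> z \<otimes> y"
    and scale_closed: "x \<in> carrier A \<Longrightarrow> cscale A c x \<in> carrier A"
    and scale_add: "\<lbrakk>x \<in> carrier A; y \<in> carrier A\<rbrakk> \<Longrightarrow> cscale A c (x \<oplus> y) = cscale A c x \<oplus> cscale A c y"
    and add_scale: "x \<in> carrier A \<Longrightarrow> cscale A (b + c) x = cscale A b x \<oplus> cscale A c x"
    and scale_scale: "x \<in> carrier A \<Longrightarrow> cscale A b (cscale A c x) = cscale A (b * c) x"
    and scale_one: "x \<in> carrier A \<Longrightarrow> cscale A 1 x = x"
    and scale_mult_left: "\<lbrakk>x \<in> carrier A; y \<in> carrier A\<rbrakk> \<Longrightarrow> cscale A c x \<otimes> y = cscale A c (x \<otimes> y)"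
    and scale_mult_right: "\<lbrakk>x \<in> carrier A; y \<in> carrier A\<rbrakk> \<Longrightarrow> x \<otimes> cscale A c y = cscale A c (x \<otimes> y)"
    and adj_closed: "x \<in> carrier A \<Longrightarrow> cadj A x \<in> carrier A"
    and adj_adj: "x \<in> carrier A \<Longrightarrow> cadj A (cadj A x) = x"
    and adj_add: "\<lbrakk>x \<in> carrier A; y \<in> carrier A\<rbrakk> \<Longrightarrow> cadj A (x \<oplus> y) = cadj A x \<oplus> cadj A y"
    and adj_scale: "x \<in> carrier A \<Longrightarrow> cadj A (cscale A c x) = cscale A (cnj c) (cadj A x)"
    and adj_mult: "\<lbrakk>x \<in> carrier A; y \<in> carrier A\<rbrakk> \<Longrightarrow> cadj A (x \<otimes> y) = cadj A y \<otimes> cadj A x"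
    and norm_nonneg: "x \<in> carrier A \<Longrightarrow> 0 \<le> cnorm A x"
    and norm_eq_0: "x \<in> carrier A \<Longrightarrow> cnorm A x = 0 \<longleftrightarrow> x = \<zero>"
    and norm_triangle: "\<lbrakk>x \<in> carrier A; y \<in> carrier A\<rbrakk> \<Longrightarrow> cnorm A (x \<oplus> y) \<le> cnorm A x + cnorm A y"
    and norm_scale: "x \<in> carrier A \<Longrightarrow> cnorm A (cscale A c x) = cmod c * cnorm A x"
    and norm_mult: "\<lbrakk>x \<in> carrier A; y \<in> carrier A\<rbrakk> \<Longrightarrow> cnorm A (x \<otimes> y) \<le> cnorm A x * cnorm A y"
    and norm_adj_mult: "x \<in> carrier A \<Longrightarrow> cnorm A (cadj A x \<otimes> x) = (cnorm A x)\<^sup>2"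
    and complete: "Metric_space.mcomplete (carrier A) (cdist A)"

lemma (in cstar_algebra) scale_zero:
  assumes x: "x \<in> carrier A" shows "cscale A 0 x = \<zero>"
  using norm_scale[OF x, of 0] norm_eq_0[OF scale_closed[OF x, of 0]] by simp

lemma (in cstar_algebra) scale_minus_one:
  assumes x: "x \<in> carrier A" shows "cscale A (-1) x = \<ominus> x"
proof -
  have "cscale A (-1) x \<oplus> x = cscale A (-1 + 1) x"
    using x by (simp only: add_scale scale_one)
  then have "cscale A (-1) x \<oplus> x = \<zero>"
    using scale_zero[OF x] by simp
  then show ?thesis
    using x scale_closed by (metis minus_equality)
qed

lemma (in cstar_algebra) Metric_space_cdist: "Metric_space (carrier A) (cdist A)"
proof
  have sym: "cnorm A (x \<ominus> y) = cnorm A (y \<ominus> x)" if "x \<in> carrier A" "y \<in> carrier A" for x y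
  proof -
    have "x \<ominus> y = \<ominus> (y \<ominus> x)"
      using that by (simp add: a_minus_def minus_add a_comm)
    also have "\<dots> = cscale A (-1) (y \<ominus> x)"
      using that scale_minus_one by simp
    finally show ?thesis
      using that norm_scale[of "y \<ominus> x" "-1"] by simp
  qed
  show "0 \<le> cdist A x y" for x y
    by (simp add: cdist_def norm_nonneg)
  show "cdist A x y = cdist A y x" for x y
    using sym by (simp add: cdist_def)
  show "cdist A x y = 0 \<longleftrightarrow> x = y" if "x \<in> carrier A" "y \<in> carrier A" for x y
    using that minus_equality[of x "\<ominus> y"] by (auto simp: cdist_def norm_eq_0 minus_eq r_neg)
  show "cdist A x z \<le> cdist A x y + cdist A y z"
    if x: "x \<in> carrier A" and y: "y \<in> carrier A" and z: "z \<in> carrier A" for x y z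
  proof -
    have "x \<ominus> z = (x \<ominus> y) \<oplus> (y \<ominus> z)"
      using x y z by (simp add: a_minus_def a_assoc r_neg1)
    then show ?thesis
      using x y z norm_triangle[of "x \<ominus> y" "y \<ominus> z"] by (simp add: cdist_def)
  qed
qed

definition linear_subspace :: "'a cstar \<Rightarrow> 'a set \<Rightarrow> bool" where
  "linear_subspace A S \<longleftrightarrow> S \<subseteq> carrier A \<and> \<zero>\<^bsub>A\<^esub> \<in> S \<and>
     (\<forall>x\<in>S. \<forall>y\<in>S. x \<oplus>\<^bsub>A\<^esub> y \<in> S) \<and> (\<forall>c. \<forall>x\<in>S. cscale A c x \<in> S)"

definition linear_span :: "'a cstar \<Rightarrow> 'a set \<Rightarrow> 'a set" where
  "linear_span A X = \<Inter> {S. linear_subspace A S \<and> X \<subseteq> S}"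

definition closed_span :: "'a cstar \<Rightarrow> 'a set \<Rightarrow> 'a set" where
  "closed_span A X = ctopology A closure_of linear_span A X"

definition cstar_subalgebra :: "'a cstar \<Rightarrow> 'a set \<Rightarrow> bool" where
  "cstar_subalgebra A S \<longleftrightarrow> linear_subspace A S \<and> closedin (ctopology A) S \<and>
     (\<forall>x\<in>S. \<forall>y\<in>S. x \<otimes>\<^bsub>A\<^esub> y \<in> S) \<and> (\<forall>x\<in>S. cadj A x \<in> S)"

definition cstar_generated :: "'a cstar \<Rightarrow> 'a set \<Rightarrow> 'a set" where
  "cstar_generated A X = \<Inter> {S. cstar_subalgebra A S \<and> X \<subseteq> S}"

definition star_hom :: "'a cstar \<Rightarrow> 'b cstar \<Rightarrow> ('a \<Rightarrow> 'b) \<Rightarrow> bool" where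
  "star_hom A B f \<longleftrightarrow> f \<in> carrier A \<rightarrow> carrier B \<and>
     (\<forall>x\<in>carrier A. \<forall>y\<in>carrier A. f (x \<oplus>\<^bsub>A\<^esub> y) = f x \<oplus>\<^bsub>B\<^esub> f y) \<and>
     (\<forall>c. \<forall>x\<in>carrier A. f (cscale A c x) = cscale B c (f x)) \<and>
     (\<forall>x\<in>carrier A. \<forall>y\<in>carrier A. f (x \<otimes>\<^bsub>A\<^esub> y) = f x \<otimes>\<^bsub>B\<^esub> f y) \<and>
     (\<forall>x\<in>carrier A. f (cadj A x) = cadj B (f x))"

definition star_automorphism :: "'a cstar \<Rightarrow> ('a \<Rightarrow> 'a) \<Rightarrow> bool" where
  "star_automorphism A f \<longleftrightarrow> star_hom A A f \<and> bij_betw f (carrier A) (carrier A)"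

section \<open>Multiplier algebras\<close>

text \<open>A multiplier \<open>m\<close> is the double centraliser \<open>(L, R)\<close> with \<open>L a = m a\<close> and \<open>R a = a m\<close>.\<close>

definition bounded_operator :: "'a cstar \<Rightarrow> ('a \<Rightarrow> 'a) \<Rightarrow> bool" where
  "bounded_operator A T \<longleftrightarrow> T \<in> carrier A \<rightarrow>\<^sub>E carrier A \<and>
     (\<forall>x\<in>carrier A. \<forall>y\<in>carrier A. T (x \<oplus>\<^bsub>A\<^esub> y) = T x \<oplus>\<^bsub>A\<^esub> T y) \<and>
     (\<forall>c. \<forall>x\<in>carrier A. T (cscale A c x) = cscale A c (T x)) \<and>
     (\<exists>K. \<forall>x\<in>carrier A. cnorm A (T x) \<le> K * cnorm A x)"

definition double_centralisers :: "'a cstar \<Rightarrow> (('a \<Rightarrow> 'a) \<times> ('a \<Rightarrow> 'a)) set" where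
  "double_centralisers A = {(L, R). bounded_operator A L \<and> bounded_operator A R \<and>
     (\<forall>a\<in>carrier A. \<forall>b\<in>carrier A.
        L (a \<otimes>\<^bsub>A\<^esub> b) = L a \<otimes>\<^bsub>A\<^esub> b \<and> R (a \<otimes>\<^bsub>A\<^esub> b) = a \<otimes>\<^bsub>A\<^esub> R b \<and> R a \<otimes>\<^bsub>A\<^esub> b = a \<otimes>\<^bsub>A\<^esub> L b)}"

definition multiplier_algebra :: "'a cstar \<Rightarrow> (('a \<Rightarrow> 'a) \<times> ('a \<Rightarrow> 'a)) cstar" where
  "multiplier_algebra A =
    \<lparr> carrier = double_centralisers A,
      mult = (\<lambda>m n. (\<lambda>a\<in>carrier A. fst m (fst n a), \<lambda>a\<in>carrier A. snd n (snd m a))),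
      one = (\<lambda>a\<in>carrier A. a, \<lambda>a\<in>carrier A. a),
      zero = (\<lambda>a\<in>carrier A. \<zero>\<^bsub>A\<^esub>, \<lambda>a\<in>carrier A. \<zero>\<^bsub>A\<^esub>),
      add = (\<lambda>m n. (\<lambda>a\<in>carrier A. fst m a \<oplus>\<^bsub>A\<^esub> fst n a, \<lambda>a\<in>carrier A. snd m a \<oplus>\<^bsub>A\<^esub> snd n a)),
      cscale = (\<lambda>c m. (\<lambda>a\<in>carrier A. cscale A c (fst m a), \<lambda>a\<in>carrier A. cscale A c (snd m a))),
      cadj = (\<lambda>m. (\<lambda>a\<in>carrier A. cadj A (snd m (cadj A a)), \<lambda>a\<in>carrier A. cadj A (fst m (cadj A a)))),
      cnorm = (\<lambda>m. SUP a\<in>{a \<in> carrier A. cnorm A a \<le> 1}. cnorm A (fst m a)) \<rparr>"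

text \<open>The coarsest topology making \<open>m \<mapsto> m a\<close> and \<open>m \<mapsto> a m\<close> norm-continuous for all \<open>a\<close>.\<close>

definition strict_topology :: "'a cstar \<Rightarrow> (('a \<Rightarrow> 'a) \<times> ('a \<Rightarrow> 'a)) topology" where
  "strict_topology A = topology_generated_by
     ({{m \<in> carrier (multiplier_algebra A). fst m a \<in> U} | a U. a \<in> carrier A \<and> openin (ctopology A) U} \<union>
      {{m \<in> carrier (multiplier_algebra A). snd m a \<in> U} | a U. a \<in> carrier A \<and> openin (ctopology A) U})"

section \<open>Torus actions\<close>

text \<open>The monoid of k-tuples of naturals and the k-torus consist of sequences that are trivial from
  index k on. The torus carries the product topology of \<^typ>\<open>nat \<Rightarrow> complex\<close>.\<close>

definition degrees :: "nat \<Rightarrow> (nat \<Rightarrow> nat) set" where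
  "degrees k = {n. \<forall>i\<ge>k. n i = 0}"

definition torus :: "nat \<Rightarrow> (nat \<Rightarrow> complex) set" where
  "torus k = {z. (\<forall>i<k. cmod (z i) = 1) \<and> (\<forall>i\<ge>k. z i = 1)}"

definition torus_action :: "nat \<Rightarrow> 'a cstar \<Rightarrow> ((nat \<Rightarrow> complex) \<Rightarrow> 'a \<Rightarrow> 'a) \<Rightarrow> bool" where
  "torus_action k A \<alpha> \<longleftrightarrow> (\<forall>z\<in>torus k. star_automorphism A (\<alpha> z)) \<and>
     (\<forall>z\<in>torus k. \<forall>w\<in>torus k. \<forall>x\<in>carrier A. \<alpha> (\<lambda>i. z i * w i) x = \<alpha> z (\<alpha> w x))"

definition continuous_torus_action :: "nat \<Rightarrow> 'a cstar \<Rightarrow> ((nat \<Rightarrow> complex) \<Rightarrow> 'a \<Rightarrow> 'a) \<Rightarrow> bool" where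
  "continuous_torus_action k A \<alpha> \<longleftrightarrow> torus_action k A \<alpha> \<and>
     (\<forall>x\<in>carrier A. continuous_map (top_of_set (torus k)) (ctopology A) (\<lambda>z. \<alpha> z x))"

definition strictly_continuous_torus_action ::
    "nat \<Rightarrow> 'a cstar \<Rightarrow> ((nat \<Rightarrow> complex) \<Rightarrow> ('a \<Rightarrow> 'a) \<times> ('a \<Rightarrow> 'a) \<Rightarrow> ('a \<Rightarrow> 'a) \<times> ('a \<Rightarrow> 'a)) \<Rightarrow> bool" where
  "strictly_continuous_torus_action k A \<alpha> \<longleftrightarrow> torus_action k (multiplier_algebra A) \<alpha> \<and>
     (\<forall>m\<in>carrier (multiplier_algebra A).
        continuous_map (top_of_set (torus k)) (strict_topology A) (\<lambda>z. \<alpha> z m))"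

section \<open>Higher-rank graphs and their C*-algebras\<close>

text \<open>Categories are given by their morphisms; objects are identified with identity morphisms, and
  \<open>kcomp \<Lambda> \<lambda> \<mu>\<close> is meaningful when \<open>ksrc \<Lambda> \<lambda> = krng \<Lambda> \<mu>\<close>. By the factorisation property the
  identity morphisms are exactly the morphisms of degree 0.\<close>

record 'l kgraph =
  kmor :: "'l set"
  krng :: "'l \<Rightarrow> 'l"
  ksrc :: "'l \<Rightarrow> 'l"
  kcomp :: "'l \<Rightarrow> 'l \<Rightarrow> 'l"
  kdeg :: "'l \<Rightarrow> nat \<Rightarrow> nat"

locale higher_rank_graph =
  fixes k :: nat and \<Lambda> :: "'l kgraph"
  assumes countable: "countable (kmor \<Lambda>)"
    and rng_closed: "l \<in> kmor \<Lambda> \<Longrightarrow> krng \<Lambda> l \<in> kmor \<Lambda>"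
    and src_closed: "l \<in> kmor \<Lambda> \<Longrightarrow> ksrc \<Lambda> l \<in> kmor \<Lambda>"
    and rng_rng: "l \<in> kmor \<Lambda> \<Longrightarrow> krng \<Lambda> (krng \<Lambda> l) = krng \<Lambda> l"
    and src_rng: "l \<in> kmor \<Lambda> \<Longrightarrow> ksrc \<Lambda> (krng \<Lambda> l) = krng \<Lambda> l"
    and rng_src: "l \<in> kmor \<Lambda> \<Longrightarrow> krng \<Lambda> (ksrc \<Lambda> l) = ksrc \<Lambda> l"
    and src_src: "l \<in> kmor \<Lambda> \<Longrightarrow> ksrc \<Lambda> (ksrc \<Lambda> l) = ksrc \<Lambda> l"
    and comp_closed: "\<lbrakk>l \<in> kmor \<Lambda>; m \<in> kmor \<Lambda>; ksrc \<Lambda> l = krng \<Lambda> m\<rbrakk> \<Longrightarrow> kcomp \<Lambda> l m \<in> kmor \<Lambda>"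
    and rng_comp: "\<lbrakk>l \<in> kmor \<Lambda>; m \<in> kmor \<Lambda>; ksrc \<Lambda> l = krng \<Lambda> m\<rbrakk> \<Longrightarrow> krng \<Lambda> (kcomp \<Lambda> l m) = krng \<Lambda> l"
    and src_comp: "\<lbrakk>l \<in> kmor \<Lambda>; m \<in> kmor \<Lambda>; ksrc \<Lambda> l = krng \<Lambda> m\<rbrakk> \<Longrightarrow> ksrc \<Lambda> (kcomp \<Lambda> l m) = ksrc \<Lambda> m"
    and comp_assoc: "\<lbrakk>l \<in> kmor \<Lambda>; m \<in> kmor \<Lambda>; n \<in> kmor \<Lambda>; ksrc \<Lambda> l = krng \<Lambda> m; ksrc \<Lambda> m = krng \<Lambda> n\<rbrakk>
        \<Longrightarrow> kcomp \<Lambda> (kcomp \<Lambda> l m) n = kcomp \<Lambda> l (kcomp \<Lambda> m n)"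
    and comp_id_left: "l \<in> kmor \<Lambda> \<Longrightarrow> kcomp \<Lambda> (krng \<Lambda> l) l = l"
    and comp_id_right: "l \<in> kmor \<Lambda> \<Longrightarrow> kcomp \<Lambda> l (ksrc \<Lambda> l) = l"
    and deg_closed: "l \<in> kmor \<Lambda> \<Longrightarrow> kdeg \<Lambda> l \<in> degrees k"
    and deg_id: "l \<in> kmor \<Lambda> \<Longrightarrow> kdeg \<Lambda> (krng \<Lambda> l) = (\<lambda>i. 0)"
    and deg_comp: "\<lbrakk>l \<in> kmor \<Lambda>; m \<in> kmor \<Lambda>; ksrc \<Lambda> l = krng \<Lambda> m\<rbrakk>
        \<Longrightarrow> kdeg \<Lambda> (kcomp \<Lambda> l m) = (\<lambda>i. kdeg \<Lambda> l i + kdeg \<Lambda> m i)"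
    and factorisation: "\<lbrakk>l \<in> kmor \<Lambda>; p \<in> degrees k; q \<in> degrees k; kdeg \<Lambda> l = (\<lambda>i. p i + q i)\<rbrakk>
        \<Longrightarrow> \<exists>!(\<mu>, \<nu>). \<mu> \<in> kmor \<Lambda> \<and> \<nu> \<in> kmor \<Lambda> \<and> ksrc \<Lambda> \<mu> = krng \<Lambda> \<nu> \<and>
              l = kcomp \<Lambda> \<mu> \<nu> \<and> kdeg \<Lambda> \<mu> = p \<and> kdeg \<Lambda> \<nu> = q"

definition kvertices :: "'l kgraph \<Rightarrow> 'l set" where
  "kvertices \<Lambda> = {v \<in> kmor \<Lambda>. kdeg \<Lambda> v = (\<lambda>i. 0)}"

definition kpaths_to :: "'l kgraph \<Rightarrow> 'l \<Rightarrow> (nat \<Rightarrow> nat) \<Rightarrow> 'l set" where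
  "kpaths_to \<Lambda> v n = {l \<in> kmor \<Lambda>. kdeg \<Lambda> l = n \<and> krng \<Lambda> l = v}"

lemma (in higher_rank_graph) kvertices_eq_range: "kvertices \<Lambda> = krng \<Lambda> ` kmor \<Lambda>"
proof (intro equalityI subsetI)
  fix v assume "v \<in> kvertices \<Lambda>"
  then have v: "v \<in> kmor \<Lambda>" and d: "kdeg \<Lambda> v = (\<lambda>i. 0)" by (auto simp: kvertices_def)
  have z: "(\<lambda>i. 0) \<in> degrees k" by (simp add: degrees_def)
  let ?P = "\<lambda>(\<mu>, \<nu>). \<mu> \<in> kmor \<Lambda> \<and> \<nu> \<in> kmor \<Lambda> \<and> ksrc \<Lambda> \<mu> = krng \<Lambda> \<nu> \<and>
              v = kcomp \<Lambda> \<mu> \<nu> \<and> kdeg \<Lambda> \<mu> = (\<lambda>i. 0) \<and> kdeg \<Lambda> \<nu> = (\<lambda>i. 0)"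
  have "\<exists>!x. ?P x" using factorisation[OF v z z] d by simp
  moreover have "?P (krng \<Lambda> v, v)"
    using v d by (simp add: rng_closed src_rng comp_id_left deg_id)
  moreover have "?P (v, ksrc \<Lambda> v)"
    using v d deg_id[OF src_closed[OF v]] by (simp add: src_closed rng_src comp_id_right)
  ultimately have "(krng \<Lambda> v, v) = (v, ksrc \<Lambda> v)" by blast
  then show "v \<in> krng \<Lambda> ` kmor \<Lambda>" using v by (metis Pair_inject imageI)
next
  fix v assume "v \<in> krng \<Lambda> ` kmor \<Lambda>"
  then show "v \<in> kvertices \<Lambda>" by (auto simp: kvertices_def rng_closed deg_id)
qed

definition row_finite_no_sources :: "nat \<Rightarrow> 'l kgraph \<Rightarrow> bool" where
  "row_finite_no_sources k \<Lambda> \<longleftrightarrow>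
     (\<forall>v\<in>kvertices \<Lambda>. \<forall>n\<in>degrees k. finite (kpaths_to \<Lambda> v n) \<and> kpaths_to \<Lambda> v n \<noteq> {})"

definition functor_to_group :: "'l kgraph \<Rightarrow> 'g monoid \<Rightarrow> ('l \<Rightarrow> 'g) \<Rightarrow> bool" where
  "functor_to_group \<Lambda> G \<eta> \<longleftrightarrow> \<eta> \<in> kmor \<Lambda> \<rightarrow> carrier G \<and>
     (\<forall>l\<in>kmor \<Lambda>. \<forall>m\<in>kmor \<Lambda>. ksrc \<Lambda> l = krng \<Lambda> m \<longrightarrow> \<eta> (kcomp \<Lambda> l m) = \<eta> l \<otimes>\<^bsub>G\<^esub> \<eta> m) \<and>
     (\<forall>v\<in>kvertices \<Lambda>. \<eta> v = \<one>\<^bsub>G\<^esub>)"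

definition cuntz_krieger_family :: "nat \<Rightarrow> 'l kgraph \<Rightarrow> 'a cstar \<Rightarrow> ('l \<Rightarrow> 'a) \<Rightarrow> bool" where
  "cuntz_krieger_family k \<Lambda> A s \<longleftrightarrow> s \<in> kmor \<Lambda> \<rightarrow> carrier A \<and>
     (\<forall>v\<in>kvertices \<Lambda>. s v \<otimes>\<^bsub>A\<^esub> s v = s v \<and> cadj A (s v) = s v) \<and>
     (\<forall>v\<in>kvertices \<Lambda>. \<forall>w\<in>kvertices \<Lambda>. v \<noteq> w \<longrightarrow> s v \<otimes>\<^bsub>A\<^esub> s w = \<zero>\<^bsub>A\<^esub>) \<and>
     (\<forall>l\<in>kmor \<Lambda>. \<forall>m\<in>kmor \<Lambda>. ksrc \<Lambda> l = krng \<Lambda> m \<longrightarrow> s l \<otimes>\<^bsub>A\<^esub> s m = s (kcomp \<Lambda> l m)) \<and>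
     (\<forall>l\<in>kmor \<Lambda>. cadj A (s l) \<otimes>\<^bsub>A\<^esub> s l = s (ksrc \<Lambda> l)) \<and>
     (\<forall>v\<in>kvertices \<Lambda>. \<forall>n\<in>degrees k. s v = finsum A (\<lambda>l. s l \<otimes>\<^bsub>A\<^esub> cadj A (s l)) (kpaths_to \<Lambda> v n))"

text \<open>Universal properties quantify over C*-algebras whose elements live in a fixed type. For
  generators indexed by \<^typ>\<open>'x\<close> the type below loses nothing: every element of a C*-algebra
  generated by such a family is the limit of a sequence of noncommutative *-polynomials in the
  generators, and there are at most as many such sequences as elements of this type. So every
  C*-algebra generated by a family indexed by \<^typ>\<open>'x\<close> is isomorphic to one carried by it.\<close>

type_synonym 'x test = "nat \<Rightarrow> 'x \<times> complex"

definition universal_cuntz_krieger_family :: "nat \<Rightarrow> 'l kgraph \<Rightarrow> 'c cstar \<Rightarrow> ('l \<Rightarrow> 'c) \<Rightarrow> bool" where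
  "universal_cuntz_krieger_family k \<Lambda> C s \<longleftrightarrow>
     cstar_algebra C \<and> cuntz_krieger_family k \<Lambda> C s \<and> cstar_generated C (s ` kmor \<Lambda>) = carrier C \<and>
     (\<forall>(T :: 'l test cstar) t. cstar_algebra T \<and> cuntz_krieger_family k \<Lambda> T t \<longrightarrow>
        (\<exists>\<phi>. star_hom C T \<phi> \<and> (\<forall>l\<in>kmor \<Lambda>. \<phi> (s l) = t l)))"

section \<open>Fell bundles, deformations and representations\<close>

text \<open>The bundle is the disjoint union of its fibres, so each operation also takes the base points
  of its arguments. Only the data are recorded here.\<close>

record ('g, 'b) fell_data =
  fib :: "'g \<Rightarrow> 'b set"
  fadd :: "'g \<Rightarrow> 'b \<Rightarrow> 'b \<Rightarrow> 'b"
  fscale :: "'g \<Rightarrow> complex \<Rightarrow> 'b \<Rightarrow> 'b"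
  fnorm :: "'g \<Rightarrow> 'b \<Rightarrow> real"
  fmult :: "'g \<Rightarrow> 'g \<Rightarrow> 'b \<Rightarrow> 'b \<Rightarrow> 'b"
  fadj :: "'g \<Rightarrow> 'b \<Rightarrow> 'b"

definition kgraph_bundle ::
    "'l kgraph \<Rightarrow> 'g monoid \<Rightarrow> ('l \<Rightarrow> 'g) \<Rightarrow> 'c cstar \<Rightarrow> ('l \<Rightarrow> 'c) \<Rightarrow> ('g, 'c) fell_data" where
  "kgraph_bundle \<Lambda> G \<eta> C s =
    \<lparr> fib = (\<lambda>g. closed_span C {s l \<otimes>\<^bsub>C\<^esub> cadj C (s m) | l m.
                l \<in> kmor \<Lambda> \<and> m \<in> kmor \<Lambda> \<and> \<eta> l \<otimes>\<^bsub>G\<^esub> inv\<^bsub>G\<^esub> (\<eta> m) = g}),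
      fadd = (\<lambda>g. add C),
      fscale = (\<lambda>g. cscale C),
      fnorm = (\<lambda>g. cnorm C),
      fmult = (\<lambda>g h. mult C),
      fadj = (\<lambda>g. cadj C) \<rparr>"

definition two_cocycle :: "'g monoid \<Rightarrow> ('g \<Rightarrow> 'g \<Rightarrow> complex) \<Rightarrow> bool" where
  "two_cocycle G \<sigma> \<longleftrightarrow> (\<forall>g\<in>carrier G. \<forall>h\<in>carrier G. cmod (\<sigma> g h) = 1) \<and>
     (\<forall>g\<in>carrier G. \<sigma> \<one>\<^bsub>G\<^esub> g = 1 \<and> \<sigma> g \<one>\<^bsub>G\<^esub> = 1) \<and>
     (\<forall>g\<in>carrier G. \<forall>h\<in>carrier G. \<forall>l\<in>carrier G.
        \<sigma> g h * \<sigma> (g \<otimes>\<^bsub>G\<^esub> h) l = \<sigma> g (h \<otimes>\<^bsub>G\<^esub> l) * \<sigma> h l)"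

definition deformed_bundle ::
    "'g monoid \<Rightarrow> ('g \<Rightarrow> 'g \<Rightarrow> complex) \<Rightarrow> ('g, 'b) fell_data \<Rightarrow> ('g, 'b) fell_data" where
  "deformed_bundle G \<sigma> B = B
    \<lparr> fmult := (\<lambda>g h b c. fscale B (g \<otimes>\<^bsub>G\<^esub> h) (\<sigma> g h) (fmult B g h b c)),
      fadj := (\<lambda>g b. fscale B (inv\<^bsub>G\<^esub> g) (cnj (\<sigma> g (inv\<^bsub>G\<^esub> g))) (fadj B g b)) \<rparr>"

definition bundle_maps :: "'g monoid \<Rightarrow> ('g, 'b) fell_data \<Rightarrow> 'a cstar \<Rightarrow> ('g \<Rightarrow> 'b \<Rightarrow> 'a) \<Rightarrow> bool" where
  "bundle_maps G B M \<pi> \<longleftrightarrow>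
     (\<forall>g\<in>carrier G. \<pi> g \<in> fib B g \<rightarrow> carrier M) \<and>
     (\<forall>g\<in>carrier G. \<forall>b\<in>fib B g. \<forall>c\<in>fib B g. \<pi> g (fadd B g b c) = \<pi> g b \<oplus>\<^bsub>M\<^esub> \<pi> g c) \<and>
     (\<forall>g\<in>carrier G. \<forall>w. \<forall>b\<in>fib B g. \<pi> g (fscale B g w b) = cscale M w (\<pi> g b)) \<and>
     (\<forall>g\<in>carrier G. \<forall>h\<in>carrier G. \<forall>b\<in>fib B g. \<forall>c\<in>fib B h.
        \<pi> (g \<otimes>\<^bsub>G\<^esub> h) (fmult B g h b c) = \<pi> g b \<otimes>\<^bsub>M\<^esub> \<pi> h c) \<and>
     (\<forall>g\<in>carrier G. \<forall>b\<in>fib B g. cadj M (\<pi> g b) = \<pi> (inv\<^bsub>G\<^esub> g) (fadj B g b))"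

definition bundle_rep :: "'g monoid \<Rightarrow> ('g, 'b) fell_data \<Rightarrow> 'a cstar \<Rightarrow> ('g \<Rightarrow> 'b \<Rightarrow> 'a) \<Rightarrow> bool" where
  "bundle_rep G B A \<pi> \<longleftrightarrow> bundle_maps G B A \<pi> \<and>
     closed_span A {\<pi> \<one>\<^bsub>G\<^esub> b \<otimes>\<^bsub>A\<^esub> a | b a. b \<in> fib B \<one>\<^bsub>G\<^esub> \<and> a \<in> carrier A} = carrier A"

definition bundle_multiplier_rep ::
    "'g monoid \<Rightarrow> ('g, 'b) fell_data \<Rightarrow> 'a cstar \<Rightarrow> ('g \<Rightarrow> 'b \<Rightarrow> ('a \<Rightarrow> 'a) \<times> ('a \<Rightarrow> 'a)) \<Rightarrow> bool" where
  "bundle_multiplier_rep G B A \<rho> \<longleftrightarrow> bundle_maps G B (multiplier_algebra A) \<rho> \<and>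
     closed_span A {fst (\<rho> \<one>\<^bsub>G\<^esub> b) a | b a. b \<in> fib B \<one>\<^bsub>G\<^esub> \<and> a \<in> carrier A} = carrier A"

definition integrates ::
    "'g monoid \<Rightarrow> ('g, 'b) fell_data \<Rightarrow> 'd cstar \<Rightarrow> ('g \<Rightarrow> 'b \<Rightarrow> 'd) \<Rightarrow> 'm cstar \<Rightarrow> ('g \<Rightarrow> 'b \<Rightarrow> 'm) \<Rightarrow> ('d \<Rightarrow> 'm) \<Rightarrow> bool" where
  "integrates G B D \<iota> M \<rho> \<phi> \<longleftrightarrow> star_hom D M \<phi> \<and> (\<forall>g\<in>carrier G. \<forall>b\<in>fib B g. \<phi> (\<iota> g b) = \<rho> g b)"

text \<open>For a Fell bundle, a representation in the multipliers of any C*-algebra is also a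
  nondegenerate representation in the C*-algebra generated by its range, so that again nothing is
  lost by restricting the type of the target.\<close>

definition universal_bundle_rep :: "'g monoid \<Rightarrow> ('g, 'b) fell_data \<Rightarrow> 'd cstar \<Rightarrow> ('g \<Rightarrow> 'b \<Rightarrow> 'd) \<Rightarrow> bool" where
  "universal_bundle_rep G B D \<iota> \<longleftrightarrow>
     cstar_algebra D \<and> bundle_rep G B D \<iota> \<and>
     cstar_generated D (\<Union>g\<in>carrier G. \<iota> g ` fib B g) = carrier D \<and>
     (\<forall>(T :: ('g \<times> 'b) test cstar) \<tau>. cstar_algebra T \<and> bundle_multiplier_rep G B T \<tau> \<longrightarrow>
        (\<exists>\<phi>. integrates G B D \<iota> (multiplier_algebra T) \<tau> \<phi>))"

definition gauge_character :: "nat \<Rightarrow> 'l kgraph \<Rightarrow> (nat \<Rightarrow> complex) \<Rightarrow> 'l \<Rightarrow> 'l \<Rightarrow> complex" where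
  "gauge_character k \<Lambda> z l m = (\<Prod>i<k. z i powi (int (kdeg \<Lambda> l i) - int (kdeg \<Lambda> m i)))"

definition gauge_action ::
    "nat \<Rightarrow> 'l kgraph \<Rightarrow> 'g monoid \<Rightarrow> ('l \<Rightarrow> 'g) \<Rightarrow> 'c cstar \<Rightarrow> ('l \<Rightarrow> 'c) \<Rightarrow>
     'd cstar \<Rightarrow> ('g \<Rightarrow> 'c \<Rightarrow> 'd) \<Rightarrow> ((nat \<Rightarrow> complex) \<Rightarrow> 'd \<Rightarrow> 'd) \<Rightarrow> bool" where
  "gauge_action k \<Lambda> G \<eta> C s D \<iota> \<beta> \<longleftrightarrow> continuous_torus_action k D \<beta> \<and>
     (\<forall>z\<in>torus k. \<forall>l\<in>kmor \<Lambda>. \<forall>m\<in>kmor \<Lambda>.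
        \<beta> z (\<iota> (\<eta> l \<otimes>\<^bsub>G\<^esub> inv\<^bsub>G\<^esub> (\<eta> m)) (s l \<otimes>\<^bsub>C\<^esub> cadj C (s m))) =
        cscale D (gauge_character k \<Lambda> z l m) (\<iota> (\<eta> l \<otimes>\<^bsub>G\<^esub> inv\<^bsub>G\<^esub> (\<eta> m)) (s l \<otimes>\<^bsub>C\<^esub> cadj C (s m))))"

text \<open>The map induced on the fibre over \<open>g\<close> by a map of the algebra, the fibre being identified
  with its image under the (isometric) map \<open>\<iota> g\<close>.\<close>

definition on_fibre :: "('g, 'b) fell_data \<Rightarrow> ('g \<Rightarrow> 'b \<Rightarrow> 'd) \<Rightarrow> ('d \<Rightarrow> 'd) \<Rightarrow> 'g \<Rightarrow> 'b \<Rightarrow> 'b" where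
  "on_fibre B \<iota> f g b = inv_into (fib B g) (\<iota> g) (f (\<iota> g b))"

end

theory Submission
  imports Defs "HOL-Library.Real_Mod"
begin

text \<open>The elements of the C*-algebra generated by the range of \<open>\<rho>\<close> are limits of sequences of finite
  sums of images of bundle elements; that algebra therefore has a copy in the test type of the universal
  property, which yields the integrated form \<open>\<phi>\<close>. To see that \<open>\<phi>\<close> is injective, write
  \<open>T l m\<close> for the image in \<open>D\<close> of \<open>s l (s m)\<^sup>*\<close>. For paths of one fixed degree the \<open>T l m\<close> are matrix
  units up to the unimodular values of the cocycle, and \<open>T l m\<close> is the sum of \<open>T (l a) (m a)\<close> over the
  paths \<open>a\<close> of a given degree. So every finite combination of gauge degree 0 lies in a finite-dimensional
  *-algebra on which \<open>\<phi>\<close> is bounded below, and two equivalent C*-norms agree. Hence \<open>\<phi>\<close> is isometric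
  on the finite combinations of degree 0 and, by passing to \<open>y\<^sup>* y\<close>, on those of any fixed degree.
  Averaging against a character over the \<open>N\<close>-th roots of unity extracts one homogeneous component of a
  finite combination \<open>y\<close> and, \<open>\<phi>\<close> being equivariant, does not increase \<open>\<parallel>\<phi> y\<parallel>\<close>. If \<open>y\<close> is close to
  an element of the kernel, all components of \<open>y\<close> are therefore small, hence so are its Fejer means,
  which are close to \<open>y\<close> by continuity of the gauge action.

  Positivity in a C*-algebra enters only through the orthogonality of the range projections of paths of
  equal degree; it and the contractivity of homomorphisms are derived from square roots of \<open>1 - b\<close>
  with \<open>\<parallel>b\<parallel> < 1\<close>, without spectral theory.\<close>

section \<open>C*-algebras\<close>

text \<open>A lower bound for \<open>\<phi>\<close> on each finite-dimensional piece would be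
  useless in the limit, since its constant depends on the piece; turning it into isometry removes
  the constant. The deformation does no harm because a cocycle value is a scalar of modulus one: it
  changes neither linear spans nor norms, and it cancels in \<open>b\<^sup>* b\<close>. Averages are
  finite sums, so they commute with \<open>\<phi>\<close> and no integral in a multiplier algebra
  has to be formed. The price is that the number \<open>N\<close> of roots depends on the finite
  combination at hand, whose degrees must stay distinct modulo \<open>N\<close>. Averages are
  therefore estimated on an approximant \<open>y\<close> of the kernel element, and the estimates
  must not depend on the size of its support. Fejer means achieve this: the number of their
  frequencies is fixed by the kernel element before \<open>y\<close> is chosen. Since the algebras
  have no unit, an expression such as \<open>1 - d\<close> occurs only multiplied by some
  element.\<close>

context cstar_algebra
begin

declare mult_closed [simp, intro] scale_closed [simp, intro] adj_closed [simp, intro]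
  adj_adj [simp] scale_one [simp] scale_scale [simp]

lemma minus_as_scale: "x \<in> carrier A \<Longrightarrow> \<ominus> x = cscale A (-1) x"
  by (simp add: scale_minus_one)

lemma diff_as_scale: "y \<in> carrier A \<Longrightarrow> x \<ominus> y = x \<oplus> cscale A (-1) y"
  by (simp add: a_minus_def minus_as_scale)

lemma scale_add_same: "x \<in> carrier A \<Longrightarrow> cscale A b x \<oplus> cscale A c x = cscale A (b + c) x"
  by (simp add: add_scale)

lemma scale_0_left [simp]: "x \<in> carrier A \<Longrightarrow> cscale A 0 x = \<zero>"
  by (rule scale_zero)

lemma norm_zero [simp]: "cnorm A \<zero> = 0"
  by (simp add: norm_eq_0)

lemma scale_zero_right [simp]: "cscale A c \<zero> = \<zero>"
  by (metis norm_eq_0 norm_scale norm_zero mult_zero_right scale_closed zero_closed)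

lemma add_cancel_self:
  assumes "x \<in> carrier A" "y \<in> carrier A" "x \<oplus> y = y" shows "x = \<zero>"
  using assms by (metis a_assoc a_closed r_neg r_zero a_inv_closed)

lemma mult_zero_left [simp]: "x \<in> carrier A \<Longrightarrow> \<zero> \<otimes> x = \<zero>"
  using distrib_right[of \<zero> \<zero> x] by (metis add_cancel_self l_zero mult_closed zero_closed)

lemma mult_zero_right [simp]: "x \<in> carrier A \<Longrightarrow> x \<otimes> \<zero> = \<zero>"
  using distrib_left[of \<zero> \<zero> x] by (metis add_cancel_self l_zero mult_closed zero_closed)

lemma adj_zero [simp]: "cadj A \<zero> = \<zero>"
  using adj_scale[of \<zero> 0] by simp

lemma mult_diff_left: "\<lbrakk>x \<in> carrier A; y \<in> carrier A; z \<in> carrier A\<rbrakk> \<Longrightarrow> (x \<ominus> y) \<otimes> z = x \<otimes> z \<ominus> y \<otimes> z"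
  by (simp add: diff_as_scale distrib_right scale_mult_left)

lemma mult_diff_right: "\<lbrakk>x \<in> carrier A; y \<in> carrier A; z \<in> carrier A\<rbrakk> \<Longrightarrow> z \<otimes> (x \<ominus> y) = z \<otimes> x \<ominus> z \<otimes> y"
  by (simp add: diff_as_scale distrib_left scale_mult_right)

lemma adj_diff: "\<lbrakk>x \<in> carrier A; y \<in> carrier A\<rbrakk> \<Longrightarrow> cadj A (x \<ominus> y) = cadj A x \<ominus> cadj A y"
  by (simp add: diff_as_scale adj_add adj_scale)

lemma scale_diff: "\<lbrakk>x \<in> carrier A; y \<in> carrier A\<rbrakk> \<Longrightarrow> cscale A c (x \<ominus> y) = cscale A c x \<ominus> cscale A c y"
  by (simp add: diff_as_scale scale_add mult.commute)

lemma diff_self [simp]: "x \<in> carrier A \<Longrightarrow> x \<ominus> x = \<zero>"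
  by (simp add: a_minus_def r_neg)

lemma diff_zero [simp]: "x \<in> carrier A \<Longrightarrow> x \<ominus> \<zero> = x"
  by (simp add: diff_as_scale)

lemma diff_eq_zero_iff: "\<lbrakk>x \<in> carrier A; y \<in> carrier A\<rbrakk> \<Longrightarrow> x \<ominus> y = \<zero> \<longleftrightarrow> x = y"
  using minus_equality[of x "\<ominus> y"] by (auto simp: minus_eq r_neg)

lemma add_diff_cancel: "\<lbrakk>x \<in> carrier A; y \<in> carrier A\<rbrakk> \<Longrightarrow> (x \<oplus> y) \<ominus> y = x"
  by (simp add: a_minus_def a_assoc r_neg)

lemma diff_add_cancel: "\<lbrakk>x \<in> carrier A; y \<in> carrier A\<rbrakk> \<Longrightarrow> (x \<ominus> y) \<oplus> y = x"
  by (simp add: a_minus_def a_assoc l_neg)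

lemma add_diff_cancel_left:
  "\<lbrakk>x \<in> carrier A; y \<in> carrier A\<rbrakk> \<Longrightarrow> x \<oplus> (y \<ominus> x) = y"
  by (metis a_comm diff_add_cancel minus_closed)

lemma diff_diff_telescope:
  "\<lbrakk>x \<in> carrier A; y \<in> carrier A; z \<in> carrier A\<rbrakk> \<Longrightarrow> x \<ominus> z = (x \<ominus> y) \<oplus> (y \<ominus> z)"
  by (simp add: a_minus_def a_assoc r_neg1)

lemma add_diff_add:
  "\<lbrakk>x \<in> carrier A; y \<in> carrier A; u \<in> carrier A; v \<in> carrier A\<rbrakk>
    \<Longrightarrow> (x \<oplus> y) \<ominus> (u \<oplus> v) = (x \<ominus> u) \<oplus> (y \<ominus> v)"
  by (simp add: diff_as_scale scale_add a_ac)

lemma diff_diff_swap: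
  assumes "x \<in> carrier A" "y \<in> carrier A" "u \<in> carrier A" "v \<in> carrier A"
  shows "(x \<ominus> y) \<ominus> (u \<ominus> v) = (x \<ominus> u) \<ominus> (y \<ominus> v)"
proof -
  have "(x \<ominus> y) \<ominus> (u \<ominus> v) = (x \<oplus> cscale A (-1) y) \<ominus> (u \<oplus> cscale A (-1) v)"
    using assms by (simp only: diff_as_scale)
  also have "\<dots> = (x \<ominus> u) \<oplus> (cscale A (-1) y \<ominus> cscale A (-1) v)"
    using assms by (simp add: add_diff_add)
  also have "\<dots> = (x \<ominus> u) \<oplus> cscale A (-1) (y \<ominus> v)"
    using assms by (simp only: scale_diff)
  finally show ?thesis
    using assms by (simp add: diff_as_scale[of "y \<ominus> v"])
qed

lemma norm_minus_commute:
  assumes "x \<in> carrier A" "y \<in> carrier A" shows "cnorm A (x \<ominus> y) = cnorm A (y \<ominus> x)"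
  using assms Metric_space.commute[OF Metric_space_cdist, of x y] by (simp add: cdist_def)

lemma norm_diff_triangle:
  "\<lbrakk>x \<in> carrier A; y \<in> carrier A; z \<in> carrier A\<rbrakk> \<Longrightarrow> cnorm A (x \<ominus> z) \<le> cnorm A (x \<ominus> y) + cnorm A (y \<ominus> z)"
  by (metis diff_diff_telescope minus_closed norm_triangle)

lemma norm_triangle_diff: "\<lbrakk>x \<in> carrier A; y \<in> carrier A\<rbrakk> \<Longrightarrow> cnorm A (x \<ominus> y) \<le> cnorm A x + cnorm A y"
  using norm_triangle[of x "cscale A (-1) y"] by (simp add: diff_as_scale norm_scale)

lemma norm_le_add_diff: "\<lbrakk>x \<in> carrier A; y \<in> carrier A\<rbrakk> \<Longrightarrow> cnorm A x \<le> cnorm A y + cnorm A (x \<ominus> y)"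
  using norm_triangle[of y "x \<ominus> y"] by (metis a_comm diff_add_cancel minus_closed)

text \<open>\<open>\<parallel>y\<parallel>\<^sup>2 = \<parallel>y\<^sup>* y\<parallel> \<le>
  \<parallel>y\<^sup>*\<parallel> \<parallel>y\<parallel>\<close> gives one inequality; the other is
  the same for \<open>y\<^sup>*\<close>.\<close>

lemma norm_adj [simp]:
  assumes "x \<in> carrier A" shows "cnorm A (cadj A x) = cnorm A x"
proof -
  have le: "cnorm A y \<le> cnorm A (cadj A y)" if y: "y \<in> carrier A" for y
  proof (cases "cnorm A y = 0")
    case False
    have "cnorm A y * cnorm A y \<le> cnorm A (cadj A y) * cnorm A y"
      using norm_adj_mult[OF y] norm_mult[of "cadj A y" y] y by (simp add: power2_eq_square)
    then show ?thesis
      using False norm_nonneg[OF y] by (simp add: mult_le_cancel_right)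
  qed (use y norm_nonneg[of "cadj A y"] in auto)
  show ?thesis
    using le[OF assms] le[of "cadj A x"] assms by simp
qed

lemma norm_selfadj_square:
  "\<lbrakk>x \<in> carrier A; cadj A x = x\<rbrakk> \<Longrightarrow> cnorm A (x \<otimes> x) = (cnorm A x)\<^sup>2"
  using norm_adj_mult by metis

lemma norm_proj_le_1:
  assumes "x \<in> carrier A" "cadj A x = x" "x \<otimes> x = x" shows "cnorm A x \<le> 1"
proof -
  have "cnorm A x = (cnorm A x)\<^sup>2"
    using norm_selfadj_square[of x] assms by simp
  then have "cnorm A x = 0 \<or> cnorm A x = 1"
    by (simp add: power2_eq_square)
  then show ?thesis
    by auto
qed

lemma eq_zeroI:
  assumes "x \<in> carrier A" and "\<And>e. 0 < e \<Longrightarrow> cnorm A x \<le> e" shows "x = \<zero>"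
proof -
  have "cnorm A x \<le> 0"
    using assms(2) by (rule field_le_epsilon) simp
  then show ?thesis
    using assms(1) norm_nonneg norm_eq_0 by force
qed

subsection \<open>Finite sums\<close>

lemma finsum_mult_right:
  "\<lbrakk>finite F; f \<in> F \<rightarrow> carrier A; x \<in> carrier A\<rbrakk> \<Longrightarrow> finsum A f F \<otimes> x = finsum A (\<lambda>i. f i \<otimes> x) F"
  by (induction F rule: finite_induct) (auto simp: Pi_def distrib_right)

lemma finsum_mult_left:
  "\<lbrakk>finite F; f \<in> F \<rightarrow> carrier A; x \<in> carrier A\<rbrakk> \<Longrightarrow> x \<otimes> finsum A f F = finsum A (\<lambda>i. x \<otimes> f i) F"
  by (induction F rule: finite_induct) (auto simp: Pi_def distrib_left)

lemma finsum_scale: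
  "\<lbrakk>finite F; f \<in> F \<rightarrow> carrier A\<rbrakk> \<Longrightarrow> cscale A c (finsum A f F) = finsum A (\<lambda>i. cscale A c (f i)) F"
  by (induction F rule: finite_induct) (auto simp: Pi_def scale_add)

lemma finsum_scale_sum:
  "\<lbrakk>finite F; x \<in> carrier A\<rbrakk> \<Longrightarrow> finsum A (\<lambda>i. cscale A (f i) x) F = cscale A (sum f F) x"
  by (induction F rule: finite_induct) (auto simp: Pi_def add_scale)

lemma finsum_diff:
  "\<lbrakk>finite F; f \<in> F \<rightarrow> carrier A; g \<in> F \<rightarrow> carrier A\<rbrakk>
    \<Longrightarrow> finsum A f F \<ominus> finsum A g F = finsum A (\<lambda>i. f i \<ominus> g i) F"
  by (induction F rule: finite_induct) (auto simp: Pi_iff add_diff_add)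

lemma norm_finsum:
  "\<lbrakk>finite F; f \<in> F \<rightarrow> carrier A\<rbrakk> \<Longrightarrow> cnorm A (finsum A f F) \<le> (\<Sum>i\<in>F. cnorm A (f i))"
proof (induction F rule: finite_induct)
  case (insert i F)
  then have "cnorm A (finsum A f (insert i F)) \<le> cnorm A (f i) + cnorm A (finsum A f F)"
    by (simp add: Pi_def norm_triangle)
  then show ?case
    using insert by (auto simp: Pi_def)
qed simp

lemma finsum_in_subspace:
  assumes "linear_subspace A S" "finite F" "f \<in> F \<rightarrow> S" shows "finsum A f F \<in> S"
proof -
  have S: "S \<subseteq> carrier A" "\<zero> \<in> S" "\<And>x y. x \<in> S \<Longrightarrow> y \<in> S \<Longrightarrow> x \<oplus> y \<in> S"
    using assms(1) by (auto simp: linear_subspace_def)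
  show ?thesis
    using assms(2,3)
  proof (induction F rule: finite_induct)
    case (insert i F)
    then have "f \<in> F \<rightarrow> carrier A" "f i \<in> carrier A"
      using S(1) by auto
    then show ?case
      using insert S(3) by (simp add: Pi_def)
  qed (use S in simp)
qed

lemma finsum_single:
  assumes "finite F" "i \<in> F" "f i \<in> carrier A" "\<And>j. j \<in> F \<Longrightarrow> j \<noteq> i \<Longrightarrow> f j = \<zero>"
  shows "finsum A f F = f i"
proof -
  have "finsum A f F = finsum A f (insert i (F - {i}))"
    using assms(2) by (simp add: insert_absorb)
  also have "\<dots> = f i \<oplus> finsum A f (F - {i})"
    using assms by (intro finsum_insert) auto
  also have "finsum A f (F - {i}) = \<zero>"
    using assms by (intro add.finprod_one_eqI) auto
  finally show ?thesis
    using assms by simp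
qed

lemma finsum_swap:
  assumes "finite F" "finite H" "\<And>i j. i \<in> F \<Longrightarrow> j \<in> H \<Longrightarrow> f i j \<in> carrier A"
  shows "finsum A (\<lambda>i. finsum A (f i) H) F = finsum A (\<lambda>j. finsum A (\<lambda>i. f i j) F) H"
  using assms(1,3)
proof (induction F rule: finite_induct)
  case (insert i F)
  then have "finsum A (\<lambda>i. finsum A (f i) H) (insert i F)
      = finsum A (f i) H \<oplus> finsum A (\<lambda>j. finsum A (\<lambda>i. f i j) F) H"
    by (subst finsum_insert) (auto intro!: finsum_closed)
  also have "\<dots> = finsum A (\<lambda>j. f i j \<oplus> finsum A (\<lambda>i. f i j) F) H"
    using insert by (subst finsum_addf) (auto intro!: finsum_closed)
  also have "\<dots> = finsum A (\<lambda>j. finsum A (\<lambda>i. f i j) (insert i F)) H"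
    using insert by (intro finsum_cong') (auto intro!: finsum_closed simp: Pi_def)
  finally show ?case .
qed simp

subsection \<open>Closed sets and spans\<close>

lemma in_closure_iff:
  assumes "S \<subseteq> carrier A"
  shows "x \<in> ctopology A closure_of S \<longleftrightarrow> x \<in> carrier A \<and> (\<forall>e>0. \<exists>y\<in>S. cnorm A (x \<ominus> y) < e)"
proof -
  interpret m: Metric_space "carrier A" "cdist A"
    by (rule Metric_space_cdist)
  have "m.mtopology closure_of S = {x \<in> carrier A. \<forall>e>0. \<exists>y\<in>S. cnorm A (x \<ominus> y) < e}"
    using assms unfolding m.metric_closure_of by (fastforce simp: cdist_def)
  then show ?thesis
    by (simp add: ctopology_def)
qed

lemma closedin_iff:
  "closedin (ctopology A) S \<longleftrightarrow>
     S \<subseteq> carrier A \<and> (\<forall>x\<in>carrier A. (\<forall>e>0. \<exists>y\<in>S. cnorm A (x \<ominus> y) < e) \<longrightarrow> x \<in> S)"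
proof -
  have top: "topspace (ctopology A) = carrier A"
    by (simp add: ctopology_def Metric_space.topspace_mtopology[OF Metric_space_cdist])
  show ?thesis
  proof (cases "S \<subseteq> carrier A")
    case True
    then have "closedin (ctopology A) S \<longleftrightarrow> ctopology A closure_of S \<subseteq> S"
      using top by (metis closure_of_eq closure_of_subset subset_antisym subset_refl)
    then show ?thesis
      using True by (auto simp: in_closure_iff)
  next
    case False
    then show ?thesis
      using top closedin_subset by metis
  qed
qed

lemma closure_closed: "closedin (ctopology A) (ctopology A closure_of S)"
  by (rule closedin_closure_of)

lemma subset_closure: "S \<subseteq> carrier A \<Longrightarrow> S \<subseteq> ctopology A closure_of S"
  by (force simp: in_closure_iff)

lemma closed_subset_carrier: "closedin (ctopology A) S \<Longrightarrow> S \<subseteq> carrier A"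
  by (simp add: closedin_iff)

text \<open>Used to propagate properties from generators to closed spans and generated C*-algebras:
  one-sided multiplication, adjoint and homomorphisms are all Lipschitz.\<close>

lemma closed_preimage:
  assumes B: "cstar_algebra B" and S: "closedin (ctopology B) S"
    and f: "\<And>x. x \<in> carrier A \<Longrightarrow> f x \<in> carrier B"
    and lip: "\<And>x y. x \<in> carrier A \<Longrightarrow> y \<in> carrier A \<Longrightarrow> cnorm B (f x \<ominus>\<^bsub>B\<^esub> f y) \<le> K * cnorm A (x \<ominus> y)"
  shows "closedin (ctopology A) {x \<in> carrier A. f x \<in> S}"
  unfolding closedin_iff
proof (intro conjI ballI impI CollectI)
  fix x assume x: "x \<in> carrier A" and ap: "\<forall>e>0. \<exists>y\<in>{x \<in> carrier A. f x \<in> S}. cnorm A (x \<ominus> y) < e"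
  have "\<exists>w\<in>S. cnorm B (f x \<ominus>\<^bsub>B\<^esub> w) < e" if "e > 0" for e
  proof -
    \<comment> \<open>The constant \<open>K\<close> may be zero or negative, so the quotient is
      taken by \<open>\<bar>K\<bar> + 1\<close>.\<close>
    have "e / (\<bar>K\<bar> + 1) > 0"
      using that by (simp add: field_simps add_pos_nonneg)
    then obtain y where y: "y \<in> carrier A" "f y \<in> S" "cnorm A (x \<ominus> y) < e / (\<bar>K\<bar> + 1)"
      using ap by blast
    have "cnorm B (f x \<ominus>\<^bsub>B\<^esub> f y) \<le> K * cnorm A (x \<ominus> y)"
      using lip x y by simp
    also have "\<dots> \<le> (\<bar>K\<bar> + 1) * cnorm A (x \<ominus> y)"
      using x y norm_nonneg[of "x \<ominus> y"] by (intro mult_right_mono) auto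
    also have "\<dots> < e"
      using y(3) by (simp add: pos_less_divide_eq add_pos_nonneg mult.commute)
    finally show ?thesis
      using y(2) by blast
  qed
  then show "f x \<in> S"
    using S f[OF x] cstar_algebra.closedin_iff[OF B] by blast
qed auto

text \<open>The difference of two Lipschitz maps is Lipschitz, and \<open>{\<zero>}\<close> is
  closed. In particular the self-adjoint elements and the commutant of an element form closed
  sets.\<close>

lemma closed_equaliser:
  assumes f: "\<And>x. x \<in> carrier A \<Longrightarrow> f x \<in> carrier A" and g: "\<And>x. x \<in> carrier A \<Longrightarrow> g x \<in> carrier A"
    and lf: "\<And>x y. x \<in> carrier A \<Longrightarrow> y \<in> carrier A \<Longrightarrow> cnorm A (f x \<ominus> f y) \<le> K * cnorm A (x \<ominus> y)"
    and lg: "\<And>x y. x \<in> carrier A \<Longrightarrow> y \<in> carrier A \<Longrightarrow> cnorm A (g x \<ominus> g y) \<le> L * cnorm A (x \<ominus> y)"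
  shows "closedin (ctopology A) {x \<in> carrier A. f x = g x}"
proof -
  have "closedin (ctopology A) {x \<in> carrier A. f x \<ominus> g x \<in> {\<zero>}}"
  proof (rule closed_preimage)
    show "cstar_algebra A"
      by unfold_locales
    show "closedin (ctopology A) {\<zero>}"
      unfolding closedin_iff
    proof (intro conjI ballI impI)
      fix x assume x: "x \<in> carrier A" and "\<forall>e>0. \<exists>y\<in>{\<zero>}. cnorm A (x \<ominus> y) < e"
      then have "\<And>e. 0 < e \<Longrightarrow> cnorm A x \<le> e"
        by force
      then show "x \<in> {\<zero>}"
        using eq_zeroI[OF x] by simp
    qed simp
    show "f x \<ominus> g x \<in> carrier A" if "x \<in> carrier A" for x
      using f[OF that] g[OF that] by simp
    show "cnorm A (f x \<ominus> g x \<ominus> (f y \<ominus> g y)) \<le> (K + L) * cnorm A (x \<ominus> y)"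
      if x: "x \<in> carrier A" and y: "y \<in> carrier A" for x y
    proof -
      note c = f[OF x] g[OF x] f[OF y] g[OF y]
      have "f x \<ominus> g x \<ominus> (f y \<ominus> g y) = (f x \<ominus> f y) \<ominus> (g x \<ominus> g y)"
        by (rule diff_diff_swap[OF c])
      then have "cnorm A (f x \<ominus> g x \<ominus> (f y \<ominus> g y)) \<le> cnorm A (f x \<ominus> f y) + cnorm A (g x \<ominus> g y)"
        using c norm_triangle_diff[of "f x \<ominus> f y" "g x \<ominus> g y"] by simp
      then show ?thesis
        using lf[OF x y] lg[OF x y] by (simp add: algebra_simps)
    qed
  qed
  moreover have "{x \<in> carrier A. f x \<ominus> g x \<in> {\<zero>}} = {x \<in> carrier A. f x = g x}"
    by (rule Collect_cong) (simp add: diff_eq_zero_iff f g cong: conj_cong)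
  ultimately show ?thesis
    by simp
qed

lemma closed_norm_le: "closedin (ctopology A) {x \<in> carrier A. cnorm A x \<le> r}"
  unfolding closedin_iff
proof (intro conjI ballI impI CollectI)
  fix x assume x: "x \<in> carrier A" and ap: "\<forall>e>0. \<exists>y\<in>{x \<in> carrier A. cnorm A x \<le> r}. cnorm A (x \<ominus> y) < e"
  show "cnorm A x \<le> r"
  proof (rule field_le_epsilon)
    fix e :: real assume "e > 0"
    then obtain y where y: "y \<in> carrier A" "cnorm A y \<le> r" "cnorm A (x \<ominus> y) < e"
      using ap by blast
    then show "cnorm A x \<le> r + e"
      using norm_le_add_diff[OF x y(1)] by linarith
  qed
qed auto

lemma Cauchy_converges:
  assumes "\<And>n. f n \<in> carrier A"
    and "\<And>e. e > 0 \<Longrightarrow> \<exists>N. \<forall>m\<ge>N. \<forall>n\<ge>N. cnorm A (f m \<ominus> f n) < e"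
  obtains x where "x \<in> carrier A" "(\<lambda>n. cnorm A (f n \<ominus> x)) \<longlonglongrightarrow> 0"
proof -
  interpret m: Metric_space "carrier A" "cdist A"
    by (rule Metric_space_cdist)
  have "m.MCauchy f"
    unfolding m.MCauchy_def using assms by (fastforce simp: cdist_def)
  then obtain x where x: "limitin m.mtopology f x sequentially"
    using complete m.mcomplete_def by blast
  then have "x \<in> carrier A" "(\<lambda>n. cdist A (f n) x) \<longlonglongrightarrow> 0"
    using assms(1) by (auto simp: m.limitin_metric_dist_null)
  then show ?thesis
    using that assms(1) by (simp add: cdist_def)
qed

section \<open>Linear spans and closed spans\<close>

lemma linear_subspace_carrier: "linear_subspace A (carrier A)"
  by (simp add: linear_subspace_def)

lemma linear_span_subspace: "X \<subseteq> carrier A \<Longrightarrow> linear_subspace A (linear_span A X)"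
  unfolding linear_span_def linear_subspace_def by blast

lemma subset_linear_span: "X \<subseteq> linear_span A X"
  by (auto simp: linear_span_def)

lemma linear_span_minimal: "linear_subspace A S \<Longrightarrow> X \<subseteq> S \<Longrightarrow> linear_span A X \<subseteq> S"
  by (auto simp: linear_span_def)

lemma linear_span_mono: "X \<subseteq> Y \<Longrightarrow> linear_span A X \<subseteq> linear_span A Y"
  by (auto simp: linear_span_def)

lemma linear_span_subset_carrier: "X \<subseteq> carrier A \<Longrightarrow> linear_span A X \<subseteq> carrier A"
  using linear_span_minimal linear_subspace_carrier by blast

lemma subspaceD:
  assumes "linear_subspace A S"
  shows "S \<subseteq> carrier A" "\<zero> \<in> S" "\<And>x y. x \<in> S \<Longrightarrow> y \<in> S \<Longrightarrow> x \<oplus> y \<in> S"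
    "\<And>c x. x \<in> S \<Longrightarrow> cscale A c x \<in> S" "\<And>x y. x \<in> S \<Longrightarrow> y \<in> S \<Longrightarrow> x \<ominus> y \<in> S"
proof -
  show *: "S \<subseteq> carrier A" "\<zero> \<in> S" "\<And>x y. x \<in> S \<Longrightarrow> y \<in> S \<Longrightarrow> x \<oplus> y \<in> S"
    "\<And>c x. x \<in> S \<Longrightarrow> cscale A c x \<in> S"
    using assms by (auto simp: linear_subspace_def)
  show "x \<ominus> y \<in> S" if "x \<in> S" "y \<in> S" for x y
  proof -
    have "x \<ominus> y = x \<oplus> cscale A (-1) y"
      using that *(1) by (intro diff_as_scale) auto
    then show ?thesis
      using that * by simp
  qed
qed

lemma linear_span_induct [consumes 2, case_names base zero add scale]:
  assumes "x \<in> linear_span A X" "X \<subseteq> carrier A"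
    and "\<And>x. x \<in> X \<Longrightarrow> P x" "P \<zero>"
    and "\<And>x y. x \<in> linear_span A X \<Longrightarrow> y \<in> linear_span A X \<Longrightarrow> P x \<Longrightarrow> P y \<Longrightarrow> P (x \<oplus> y)"
    and "\<And>c x. x \<in> linear_span A X \<Longrightarrow> P x \<Longrightarrow> P (cscale A c x)"
  shows "P x"
proof -
  note sp = subspaceD[OF linear_span_subspace[OF assms(2)]]
  \<comment> \<open>Intersecting \<open>P\<close> with the span makes membership available in the
    steps for sums and multiples.\<close>
  have "linear_subspace A {x \<in> linear_span A X. P x}"
    unfolding linear_subspace_def using sp assms(4-6) by auto
  then have "linear_span A X \<subseteq> {x \<in> linear_span A X. P x}"
    by (rule linear_span_minimal) (use assms(3) subset_linear_span in auto)
  then show ?thesis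
    using assms(1) by blast
qed

text \<open>Bilinearity in two inductions: \<open>x\<close> varies against a fixed generator of the
  second span, then \<open>y\<close> varies against the fixed \<open>x\<close>.\<close>

lemma linear_span_mult:
  assumes X: "X \<subseteq> carrier A" and Y: "Y \<subseteq> carrier A" and S: "linear_subspace A S"
    and XY: "\<And>x y. x \<in> X \<Longrightarrow> y \<in> Y \<Longrightarrow> x \<otimes> y \<in> S"
    and x: "x \<in> linear_span A X" and y: "y \<in> linear_span A Y"
  shows "x \<otimes> y \<in> S"
proof -
  note S' = subspaceD[OF S]
  note car = linear_span_subset_carrier[OF X] linear_span_subset_carrier[OF Y]
  have 1: "x \<otimes> b \<in> S" if b: "b \<in> Y" for b
    using x X
  proof (induction rule: linear_span_induct)
    case (add u v) then show ?case using S' car Y b by (simp add: distrib_right subset_iff)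
  next
    case (scale c u) then show ?case using S' car Y b by (simp add: scale_mult_left subset_iff)
  qed (use XY b S' Y in auto)
  show ?thesis
    using y Y
  proof (induction rule: linear_span_induct)
    case (add u v) then show ?case using S' car x by (simp add: distrib_left subset_iff)
  next
    case (scale c u) then show ?case using S' car x by (simp add: scale_mult_right subset_iff)
  qed (use 1 S' x car in auto)
qed

lemma linear_span_adj:
  assumes X: "X \<subseteq> carrier A" and S: "linear_subspace A S"
    and "\<And>x. x \<in> X \<Longrightarrow> cadj A x \<in> S" and x: "x \<in> linear_span A X"
  shows "cadj A x \<in> S"
  using x X
proof (induction rule: linear_span_induct)
  case (add u v) then show ?case
    using subspaceD[OF S] linear_span_subset_carrier[OF X] by (simp add: adj_add subset_iff)
next
  case (scale c u) then show ?case
    using subspaceD[OF S] linear_span_subset_carrier[OF X] by (simp add: adj_scale subset_iff)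
qed (use assms subspaceD[OF S] in auto)

text \<open>The coefficients are indexed by \<open>F\<close>, not by the image: different indices
  may have the same \<open>T i\<close>, as happens for pairs of paths whose \<open>T\<close>
  vanishes.\<close>

lemma in_linear_span_finite_image:
  assumes F: "finite F" and T: "T \<in> F \<rightarrow> carrier A" and x: "x \<in> linear_span A (T ` F)"
  obtains c where "x = finsum A (\<lambda>i. cscale A (c i) (T i)) F"
proof -
  have sub: "T ` F \<subseteq> carrier A"
    using T by auto
  have "\<exists>c. x = finsum A (\<lambda>i. cscale A (c i) (T i)) F"
    using x sub
  proof (induction rule: linear_span_induct)
    case (base x)
    then obtain i where i: "i \<in> F" "x = T i"
      by auto
    have "finsum A (\<lambda>j. cscale A (if j = i then 1 else 0) (T j)) F = cscale A (if i = i then 1 else 0) (T i)"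
      using F T i by (intro finsum_single) (auto simp: Pi_iff)
    then have "x = finsum A (\<lambda>j. cscale A ((\<lambda>j. if j = i then 1 else 0) j) (T j)) F"
      using i T by (auto simp: Pi_iff)
    then show ?case
      by (intro exI[of _ "\<lambda>j. if j = i then 1 else 0"])
  next
    case zero
    have "\<zero> = finsum A (\<lambda>i. cscale A ((\<lambda>_. 0) i) (T i)) F"
      using T by (intro add.finprod_one_eqI[symmetric]) (auto simp: Pi_iff)
    then show ?case
      by (intro exI[of _ "\<lambda>_. 0"])
  next
    case (add u v)
    then obtain a b where "u = finsum A (\<lambda>i. cscale A (a i) (T i)) F" "v = finsum A (\<lambda>i. cscale A (b i) (T i)) F"
      by blast
    then have "u \<oplus> v = finsum A (\<lambda>i. cscale A (a i) (T i) \<oplus> cscale A (b i) (T i)) F"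
      using T by (subst finsum_addf) (auto simp: Pi_iff)
    also have "\<dots> = finsum A (\<lambda>i. cscale A ((\<lambda>i. a i + b i) i) (T i)) F"
      using T by (intro finsum_cong') (auto simp: add_scale Pi_iff)
    finally show ?case
      by (intro exI[of _ "\<lambda>i. a i + b i"])
  next
    case (scale c u)
    then obtain a where "u = finsum A (\<lambda>i. cscale A (a i) (T i)) F"
      by blast
    then have "cscale A c u = finsum A (\<lambda>i. cscale A c (cscale A (a i) (T i))) F"
      using T F by (simp add: finsum_scale Pi_def)
    also have "\<dots> = finsum A (\<lambda>i. cscale A ((\<lambda>i. c * a i) i) (T i)) F"
      using T by (intro finsum_cong') (auto simp: Pi_iff)
    finally show ?case
      by (intro exI[of _ "\<lambda>i. c * a i"])
  qed
  then show ?thesis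
    using that by blast
qed

lemma closure_subspace:
  assumes S: "linear_subspace A S" shows "linear_subspace A (ctopology A closure_of S)"
proof -
  note S' = subspaceD[OF S]
  have "x \<oplus> y \<in> ctopology A closure_of S"
    if x: "x \<in> ctopology A closure_of S" and y: "y \<in> ctopology A closure_of S" for x y
    unfolding in_closure_iff[OF S'(1)]
  proof (intro conjI allI impI)
    have xy: "x \<in> carrier A" "y \<in> carrier A"
      using x y by (auto simp: in_closure_iff[OF S'(1)])
    then show "x \<oplus> y \<in> carrier A"
      by simp
    fix e :: real assume "e > 0"
    then have "e / 2 > 0"
      by simp
    then obtain u v where u: "u \<in> S" "cnorm A (x \<ominus> u) < e / 2" and v: "v \<in> S" "cnorm A (y \<ominus> v) < e / 2"
      using x y unfolding in_closure_iff[OF S'(1)] by blast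
    then have "cnorm A ((x \<oplus> y) \<ominus> (u \<oplus> v)) < e"
      using xy S'(1) norm_triangle[of "x \<ominus> u" "y \<ominus> v"] by (simp add: add_diff_add subset_iff)
    then show "\<exists>w\<in>S. cnorm A ((x \<oplus> y) \<ominus> w) < e"
      using S'(3) u v by blast
  qed
  moreover have "cscale A c x \<in> ctopology A closure_of S" if x: "x \<in> ctopology A closure_of S" for c x
    unfolding in_closure_iff[OF S'(1)]
  proof (intro conjI allI impI)
    have xc: "x \<in> carrier A"
      using x by (auto simp: in_closure_iff[OF S'(1)])
    then show "cscale A c x \<in> carrier A"
      by simp
    fix e :: real assume "e > 0"
    then have "e / (cmod c + 1) > 0"
      by (simp add: add_nonneg_pos)
    then obtain u where u: "u \<in> S" "cnorm A (x \<ominus> u) < e / (cmod c + 1)"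
      using x unfolding in_closure_iff[OF S'(1)] by blast
    have uc: "u \<in> carrier A"
      using u S' by blast
    have "cnorm A (cscale A c x \<ominus> cscale A c u) = cmod c * cnorm A (x \<ominus> u)"
      using xc uc by (simp add: scale_diff[symmetric] norm_scale)
    also have "\<dots> \<le> (cmod c + 1) * cnorm A (x \<ominus> u)"
      using xc uc norm_nonneg by (intro mult_right_mono) auto
    also have "\<dots> < e"
      using u(2) by (simp add: pos_less_divide_eq add_nonneg_pos mult.commute)
    finally show "\<exists>w\<in>S. cnorm A (cscale A c x \<ominus> w) < e"
      using S'(4) u by blast
  qed
  ultimately show ?thesis
    using subset_closure[OF S'(1)] S'(2) closed_subset_carrier[OF closure_closed]
    unfolding linear_subspace_def by blast
qed

lemma closed_span_subspace: "X \<subseteq> carrier A \<Longrightarrow> linear_subspace A (closed_span A X)"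
  unfolding closed_span_def by (intro closure_subspace linear_span_subspace)

lemma closed_span_closed: "closedin (ctopology A) (closed_span A X)"
  unfolding closed_span_def by (rule closure_closed)

lemma closed_span_subset_carrier: "closed_span A X \<subseteq> carrier A"
  using closed_span_closed closed_subset_carrier by blast

lemma linear_span_subset_closed_span: "X \<subseteq> carrier A \<Longrightarrow> linear_span A X \<subseteq> closed_span A X"
  unfolding closed_span_def by (intro subset_closure linear_span_subset_carrier)

lemma subset_closed_span: "X \<subseteq> carrier A \<Longrightarrow> X \<subseteq> closed_span A X"
  using linear_span_subset_closed_span subset_linear_span by blast

lemma closed_span_minimal:
  "linear_subspace A S \<Longrightarrow> closedin (ctopology A) S \<Longrightarrow> X \<subseteq> S \<Longrightarrow> closed_span A X \<subseteq> S"
  unfolding closed_span_def by (intro closure_of_minimal linear_span_minimal)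

lemma closed_span_approx:
  assumes "x \<in> closed_span A X" "X \<subseteq> carrier A" "e > 0"
  obtains y where "y \<in> linear_span A X" "cnorm A (x \<ominus> y) < e"
  using assms linear_span_subset_carrier[OF assms(2)] unfolding closed_span_def
  by (auto simp: in_closure_iff)

lemma lipschitz_mult_right:
  "\<lbrakk>x \<in> carrier A; y \<in> carrier A; z \<in> carrier A\<rbrakk>
    \<Longrightarrow> cnorm A (x \<otimes> z \<ominus> y \<otimes> z) \<le> cnorm A z * cnorm A (x \<ominus> y)"
  using norm_mult[of "x \<ominus> y" z] by (simp add: mult_diff_left mult.commute)

lemma lipschitz_mult_left:
  "\<lbrakk>x \<in> carrier A; y \<in> carrier A; z \<in> carrier A\<rbrakk>
    \<Longrightarrow> cnorm A (z \<otimes> x \<ominus> z \<otimes> y) \<le> cnorm A z * cnorm A (x \<ominus> y)"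
  using norm_mult[of z "x \<ominus> y"] by (simp add: mult_diff_right)

lemma lipschitz_adj:
  "\<lbrakk>x \<in> carrier A; y \<in> carrier A\<rbrakk> \<Longrightarrow> cnorm A (cadj A x \<ominus> cadj A y) \<le> 1 * cnorm A (x \<ominus> y)"
  by (simp add: adj_diff[symmetric])

text \<open>As for linear spans, but the sets \<open>{u. u b \<in> S}\<close> and
  \<open>{u. x u \<in> S}\<close> must also be closed, which holds because one-sided multiplication
  is Lipschitz.\<close>

lemma closed_span_mult:
  assumes X: "X \<subseteq> carrier A" and Y: "Y \<subseteq> carrier A"
    and S: "linear_subspace A S" "closedin (ctopology A) S"
    and XY: "\<And>x y. x \<in> X \<Longrightarrow> y \<in> Y \<Longrightarrow> x \<otimes> y \<in> S"
    and x: "x \<in> closed_span A X" and y: "y \<in> closed_span A Y"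
  shows "x \<otimes> y \<in> S"
proof -
  have ca: "cstar_algebra A"
    by unfold_locales
  have xc: "x \<in> carrier A"
    using x closed_span_subset_carrier by blast
  note S' = subspaceD[OF S(1)]
  have 1: "x \<otimes> b \<in> S" if b: "b \<in> Y" for b
  proof -
    have bc: "b \<in> carrier A"
      using b Y by blast
    have "linear_subspace A {u \<in> carrier A. u \<otimes> b \<in> S}"
      unfolding linear_subspace_def using S' bc by (auto simp: distrib_right scale_mult_left)
    moreover have "closedin (ctopology A) {u \<in> carrier A. u \<otimes> b \<in> S}"
      by (rule closed_preimage[OF ca S(2), where K = "cnorm A b"]) (use bc lipschitz_mult_right in auto)
    ultimately have "closed_span A X \<subseteq> {u \<in> carrier A. u \<otimes> b \<in> S}"
      by (rule closed_span_minimal) (use X XY b in auto)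
    then show ?thesis
      using x by blast
  qed
  have "linear_subspace A {u \<in> carrier A. x \<otimes> u \<in> S}"
    unfolding linear_subspace_def using S' xc by (auto simp: distrib_left scale_mult_right)
  moreover have "closedin (ctopology A) {u \<in> carrier A. x \<otimes> u \<in> S}"
    by (rule closed_preimage[OF ca S(2), where K = "cnorm A x"]) (use xc lipschitz_mult_left in auto)
  ultimately have "closed_span A Y \<subseteq> {u \<in> carrier A. x \<otimes> u \<in> S}"
    by (rule closed_span_minimal) (use Y 1 in auto)
  then show ?thesis
    using y by blast
qed

lemma closed_span_adj:
  assumes X: "X \<subseteq> carrier A" and S: "linear_subspace A S" "closedin (ctopology A) S"
    and "\<And>x. x \<in> X \<Longrightarrow> cadj A x \<in> S" and x: "x \<in> closed_span A X"
  shows "cadj A x \<in> S"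
proof -
  have "cstar_algebra A"
    by unfold_locales
  note S' = subspaceD[OF S(1)]
  have "linear_subspace A {u \<in> carrier A. cadj A u \<in> S}"
    unfolding linear_subspace_def using S' by (auto simp: adj_add adj_scale)
  moreover have "closedin (ctopology A) {u \<in> carrier A. cadj A u \<in> S}"
    by (rule closed_preimage[OF \<open>cstar_algebra A\<close> S(2), where K = 1]) (use lipschitz_adj in auto)
  ultimately have "closed_span A X \<subseteq> {u \<in> carrier A. cadj A u \<in> S}"
    by (rule closed_span_minimal) (use X assms in auto)
  then show ?thesis
    using x by blast
qed

end

subsection \<open>Square roots, and positivity without spectral theory\<close>

context cstar_algebra
begin

text \<open>Both \<open>y + i w\<close> and \<open>y - i w\<close> have squared norm \<open>\<parallel>y\<^sup>* y + w\<^sup>* w\<parallel>\<close>, and \<open>y\<close> is their mean.\<close>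

lemma norm_le_norm_sum_squares:
  assumes y: "y \<in> carrier A" and w: "w \<in> carrier A" and yw: "cadj A y \<otimes> w = cadj A w \<otimes> y"
  shows "(cnorm A y)\<^sup>2 \<le> cnorm A (cadj A y \<otimes> y \<oplus> cadj A w \<otimes> w)"
proof -
  define u where "u c = y \<oplus> cscale A c w" for c
  have uc: "u c \<in> carrier A" for c
    using y w by (simp add: u_def)
  have u: "cnorm A (u c) = sqrt (cnorm A (cadj A y \<otimes> y \<oplus> cadj A w \<otimes> w))"
    if c: "c * cnj c = 1" "cnj c = - c" for c
  proof -
    let ?z = "cadj A w \<otimes> y"
    \<comment> \<open>The hypothesis makes the two cross terms multiples of the same element; they
      cancel because \<open>cnj c = - c\<close>.\<close>
    have "cadj A (u c) \<otimes> u c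
        = (cadj A y \<otimes> y \<oplus> cscale A c ?z) \<oplus> (cscale A (- c) ?z \<oplus> cadj A w \<otimes> w)"
      using y w c by (simp add: u_def adj_add adj_scale distrib_left distrib_right scale_mult_left
          scale_mult_right scale_add yw mult.commute a_ac)
    also have "\<dots> = cadj A y \<otimes> y \<oplus> ((cscale A c ?z \<oplus> cscale A (- c) ?z) \<oplus> cadj A w \<otimes> w)"
      using y w by (simp add: a_assoc)
    also have "cscale A c ?z \<oplus> cscale A (- c) ?z = \<zero>"
      using y w by (simp add: scale_add_same)
    finally have "(cnorm A (u c))\<^sup>2 = cnorm A (cadj A y \<otimes> y \<oplus> cadj A w \<otimes> w)"
      using norm_adj_mult[OF uc[of c]] y w by simp
    then show ?thesis
      using norm_nonneg[OF uc[of c]] by (metis real_sqrt_unique)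
  qed
  have "u \<i> \<oplus> u (- \<i>) = cscale A 2 y \<oplus> (cscale A \<i> w \<oplus> cscale A (- \<i>) w)"
    using y w scale_add_same[OF y, of 1 1, symmetric] by (simp add: u_def a_ac)
  also have "\<dots> = cscale A 2 y"
    using y w by (simp add: scale_add_same)
  finally have "cscale A 2 y = u \<i> \<oplus> u (- \<i>)" ..
  then have "2 * cnorm A y \<le> cnorm A (u \<i>) + cnorm A (u (- \<i>))"
    using norm_scale[OF y, of 2] norm_triangle[OF uc uc, of \<i> "- \<i>"] by simp
  then have "cnorm A y \<le> sqrt (cnorm A (cadj A y \<otimes> y \<oplus> cadj A w \<otimes> w))"
    by (simp add: u)
  then show ?thesis
    using norm_nonneg[OF y] y w real_le_rsqrt sqrt_ge_absD by (metis abs_of_nonneg)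
qed

text \<open>With a formal unit, \<open>(1 - d)\<^sup>2 = 1 - b\<close>; the element \<open>d\<close> is the fixed point of
  \<open>x \<mapsto> (b + x\<^sup>2) / 2\<close>, a contraction of the ball of radius \<open>\<parallel>b\<parallel>\<close>.\<close>

lemma selfadj_sqrt:
  assumes b: "b \<in> carrier A" "cadj A b = b" "cnorm A b < 1"
  obtains d where "d \<in> carrier A" "cadj A d = d" "cscale A 2 d = b \<oplus> d \<otimes> d"
    "\<And>y. y \<in> carrier A \<Longrightarrow> y \<otimes> b = b \<otimes> y \<Longrightarrow> y \<otimes> d = d \<otimes> y"
proof -
  define r where "r = cnorm A b"
  have r: "0 \<le> r" "r < 1"
    using b norm_nonneg by (auto simp: r_def)
  define Y where "Y = {y \<in> carrier A. y \<otimes> b = b \<otimes> y}"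
  \<comment> \<open>Commutation with everything that commutes with \<open>b\<close> is built into
    the set on which the contraction acts, so the fixed point inherits it.\<close>
  define S where "S = {x \<in> carrier A. cadj A x = x} \<inter> {x \<in> carrier A. cnorm A x \<le> r} \<inter>
      (\<Inter>y\<in>Y. {x \<in> carrier A. y \<otimes> x = x \<otimes> y})"
  \<comment> \<open>This keeps the family indexed by \<open>Y\<close> nonempty; an empty
    intersection would be the whole type and not a closed set of the space.\<close>
  have bY: "b \<in> Y"
    using b by (simp add: Y_def)
  have "closedin (ctopology A) {x \<in> carrier A. cadj A x = x}"
    by (rule closed_equaliser[where K = 1 and L = 1]) (use lipschitz_adj in auto)
  moreover have "closedin (ctopology A) {x \<in> carrier A. y \<otimes> x = x \<otimes> y}" if "y \<in> Y" for y
    by (rule closed_equaliser[where K = "cnorm A y" and L = "cnorm A y"])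
      (use that lipschitz_mult_left lipschitz_mult_right in \<open>auto simp: Y_def\<close>)
  ultimately have clo: "closedin (ctopology A) S"
    unfolding S_def using bY closed_norm_le by (intro closedin_Int closedin_INT) auto
  have Sc: "S \<subseteq> carrier A"
    by (auto simp: S_def)
  interpret m: Metric_space "carrier A" "cdist A"
    by (rule Metric_space_cdist)
  interpret Submetric "carrier A" "cdist A" S
    using Sc by unfold_locales
  have comp: "sub.mcomplete"
    using clo complete by (intro closedin_mcomplete_imp_mcomplete) (auto simp: ctopology_def)
  define f where "f x = cscale A (1/2) (b \<oplus> x \<otimes> x)" for x
  have "\<zero> \<in> S"
    using r by (auto simp: S_def Y_def)
  have fS: "f x \<in> S" if x: "x \<in> S" for x
  proof -
    have x': "x \<in> carrier A" "cadj A x = x" "cnorm A x \<le> r" "\<And>y. y \<in> Y \<Longrightarrow> y \<otimes> x = x \<otimes> y"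
      using x by (auto simp: S_def)
    have "cadj A (f x) = f x"
      using x' b by (simp add: f_def adj_scale adj_add adj_mult)
    moreover have "cnorm A (f x) \<le> r"
    proof -
      have "cnorm A (x \<otimes> x) \<le> r * r"
        using x' norm_mult[of x x] norm_nonneg[of x] mult_mono[of "cnorm A x" r "cnorm A x" r] r by simp
      also have "\<dots> \<le> r"
        using r by (simp add: mult_left_le)
      finally show ?thesis
        using x' b norm_triangle[of b "x \<otimes> x"] by (simp add: f_def norm_scale r_def)
    qed
    moreover have "y \<otimes> f x = f x \<otimes> y" if y: "y \<in> Y" for y
    proof -
      have yc: "y \<in> carrier A" "y \<otimes> b = b \<otimes> y" and yx: "y \<otimes> x = x \<otimes> y"
        using y x'(4) by (auto simp: Y_def)
      have "y \<otimes> (x \<otimes> x) = (x \<otimes> x) \<otimes> y"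
        using x'(1) yc yx by (metis mult_assoc)
      then show ?thesis
        using x' b yc by (simp add: f_def scale_mult_left scale_mult_right distrib_left distrib_right)
    qed
    ultimately show ?thesis
      using x' b by (auto simp: S_def f_def)
  qed
  \<comment> \<open>\<open>x x - y y = x (x - y) + (x - y) y\<close>; each term has norm at most
    \<open>r \<parallel>x - y\<parallel>\<close>, and the factor \<open>1/2\<close> in
    \<open>f\<close> leaves the rate \<open>r\<close>.\<close>
  have contr: "cdist A (f x) (f y) \<le> r * cdist A x y" if "x \<in> S" "y \<in> S" for x y
  proof -
    have xy: "x \<in> carrier A" "y \<in> carrier A" "cnorm A x \<le> r" "cnorm A y \<le> r"
      using that by (auto simp: S_def)
    have "f x \<ominus> f y = cscale A (1/2) (x \<otimes> x \<ominus> y \<otimes> y)"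
      using xy b by (simp add: f_def scale_diff[symmetric] add_diff_add)
    moreover have "cnorm A (x \<otimes> x \<ominus> y \<otimes> y) \<le> cnorm A (x \<otimes> x \<ominus> x \<otimes> y) + cnorm A (x \<otimes> y \<ominus> y \<otimes> y)"
      using xy by (intro norm_diff_triangle) auto
    moreover have "cnorm A (x \<otimes> x \<ominus> x \<otimes> y) \<le> r * cnorm A (x \<ominus> y)"
      using xy lipschitz_mult_left[of x y x] norm_nonneg[of "x \<ominus> y"]
        mult_right_mono[of "cnorm A x" r "cnorm A (x \<ominus> y)"] by simp
    moreover have "cnorm A (x \<otimes> y \<ominus> y \<otimes> y) \<le> r * cnorm A (x \<ominus> y)"
      using xy lipschitz_mult_right[of x y y] norm_nonneg[of "x \<ominus> y"]
        mult_right_mono[of "cnorm A y" r "cnorm A (x \<ominus> y)"] by simp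
    ultimately show ?thesis
      using xy b Sc fS that by (simp add: cdist_def norm_scale subset_iff)
  qed
  obtain d where d: "d \<in> S" "f d = d"
  proof (rule sub.Banach_fixedpoint_thm[OF comp _ _ r(2) contr])
    show "S \<noteq> {}"
      using \<open>\<zero> \<in> S\<close> by blast
  qed (use fS in auto)
  show ?thesis
  proof (rule that)
    have dc: "d \<in> carrier A"
      using d Sc by blast
    then have "cscale A 2 (f d) = b \<oplus> d \<otimes> d"
      using b by (simp add: f_def)
    then show "cscale A 2 d = b \<oplus> d \<otimes> d"
      using d by simp
  qed (use d in \<open>auto simp: S_def Y_def\<close>)
qed

text \<open>This is \<open>(1 - d)\<^sup>2 = 1 - 2 d + d\<^sup>2 = 1 - b\<close>, multiplied by
  \<open>y\<close> and \<open>x\<close> from the two sides so that no unit occurs.\<close>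

lemma sqrt_square:
  assumes d: "d \<in> carrier A" "cscale A 2 d = b \<oplus> d \<otimes> d" and b: "b \<in> carrier A"
    and x: "x \<in> carrier A" and y: "y \<in> carrier A"
  shows "(y \<ominus> y \<otimes> d) \<otimes> (x \<ominus> d \<otimes> x) = y \<otimes> x \<ominus> y \<otimes> (b \<otimes> x)"
proof -
  let ?dx = "y \<otimes> (d \<otimes> x)" and ?ddx = "y \<otimes> (d \<otimes> (d \<otimes> x))" and ?bx = "y \<otimes> (b \<otimes> x)"
  have "cscale A 2 ?dx = y \<otimes> (cscale A 2 d \<otimes> x)"
    by (simp only: scale_mult_left scale_mult_right d(1) x y mult_closed)
  also have "\<dots> = ?bx \<oplus> ?ddx"
    using d b x y by (simp only: d(2)) (simp add: distrib_left distrib_right mult_assoc)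
  finally have two: "cscale A 2 ?dx = ?bx \<oplus> ?ddx" .
  have "(y \<ominus> y \<otimes> d) \<otimes> (x \<ominus> d \<otimes> x) = (y \<otimes> x \<ominus> ?dx) \<ominus> (?dx \<ominus> ?ddx)"
    using d x y by (simp add: mult_diff_left mult_diff_right mult_assoc diff_diff_swap)
  also have "\<dots> = (y \<otimes> x \<oplus> cscale A (-1) ?dx) \<oplus> (cscale A (-1) ?dx \<oplus> ?ddx)"
    using d x y by (simp add: diff_as_scale scale_add)
  also have "\<dots> = y \<otimes> x \<oplus> ((cscale A (-1) ?dx \<oplus> cscale A (-1) ?dx) \<oplus> ?ddx)"
    using d x y by (simp add: a_assoc)
  also have "cscale A (-1) ?dx \<oplus> cscale A (-1) ?dx = cscale A (-1) (cscale A 2 ?dx)"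
    using d x y by (simp add: scale_add_same)
  also have "\<dots> \<oplus> ?ddx = cscale A (-1) ?bx"
    unfolding two using d b x y by (simp add: scale_add a_assoc scale_add_same[of ?ddx "-1" 1, simplified])
  finally show ?thesis
    using d b x y by (simp add: diff_as_scale)
qed

lemma norm_scaled_lt_1:
  assumes "x \<in> carrier A" "cnorm A x \<le> 1" "0 < r" "r < 1"
  shows "cnorm A (cscale A (complex_of_real r) x) < 1"
proof -
  have "r * cnorm A x \<le> r * 1"
    using assms by (intro mult_left_mono) auto
  moreover have "cnorm A (cscale A (complex_of_real r) x) = r * cnorm A x"
    using assms norm_scale[OF assms(1), of r] by simp
  ultimately show ?thesis
    using assms by linarith
qed

text \<open>For \<open>r < 1\<close> the elements \<open>1 - r (q \<minusplus> h)\<close> have square roots. Multiplied by \<open>h\<close> these become commuting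
  self-adjoint elements of \<open>A\<close> with squares \<open>(1 - r) h\<^sup>2 \<plusminus> r h\<^sup>3\<close>, which sum to \<open>2 (1 - r) h\<^sup>2\<close>.\<close>

lemma zero_if_norm_unit_plus_minus_le_1:
  assumes h: "h \<in> carrier A" "cadj A h = h" and q: "q \<in> carrier A" "cadj A q = q"
    and qh: "q \<otimes> h = h" "h \<otimes> q = h" and n: "cnorm A (q \<ominus> h) \<le> 1" "cnorm A (q \<oplus> h) \<le> 1"
  shows "h = \<zero>"
proof -
  define H2 where "H2 = h \<otimes> h"
  define H3 where "H3 = h \<otimes> H2"
  have Hc [simp]: "H2 \<in> carrier A" "H3 \<in> carrier A"
    using h by (auto simp: H2_def H3_def)
  have bound: "cnorm A H3 \<le> 3 * ((1 - r) / r) * cnorm A H2" if r: "0 < r" "r < 1" for r :: real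
  proof -
    let ?r = "complex_of_real r"
    \<comment> \<open>On \<open>h\<close> the element \<open>q\<close> acts as a unit, so
      \<open>h (1 - bp) = (1 - r) h + r h\<^sup>2\<close>, and for \<open>bm\<close> the sign of
      \<open>r h\<^sup>2\<close> is reversed. The factor \<open>r\<close> makes the norms strictly
      smaller than one.\<close>
    define bp where "bp = cscale A ?r (q \<ominus> h)"
    define bm where "bm = cscale A ?r (q \<oplus> h)"
    have bp: "bp \<in> carrier A" "cadj A bp = bp" "cnorm A bp < 1" "h \<otimes> bp = bp \<otimes> h"
      and bm: "bm \<in> carrier A" "cadj A bm = bm" "cnorm A bm < 1" "h \<otimes> bm = bm \<otimes> h"
      using h q qh n r norm_scaled_lt_1[of "q \<ominus> h" r] norm_scaled_lt_1[of "q \<oplus> h" r]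
      by (auto simp: bp_def bm_def adj_scale adj_diff adj_add scale_mult_left scale_mult_right
          mult_diff_left mult_diff_right distrib_left distrib_right)
    obtain dp where dp: "dp \<in> carrier A" "cadj A dp = dp" "cscale A 2 dp = bp \<oplus> dp \<otimes> dp"
      and dpc: "\<And>y. y \<in> carrier A \<Longrightarrow> y \<otimes> bp = bp \<otimes> y \<Longrightarrow> y \<otimes> dp = dp \<otimes> y"
      using selfadj_sqrt[OF bp(1-3)] by blast
    obtain dm where dm: "dm \<in> carrier A" "cadj A dm = dm" "cscale A 2 dm = bm \<oplus> dm \<otimes> dm"
      and dmc: "\<And>y. y \<in> carrier A \<Longrightarrow> y \<otimes> bm = bm \<otimes> y \<Longrightarrow> y \<otimes> dm = dm \<otimes> y"
      using selfadj_sqrt[OF bm(1-3)] by blast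
    have hdp: "h \<otimes> dp = dp \<otimes> h" and hdm: "h \<otimes> dm = dm \<otimes> h"
      using dpc dmc h bp bm by auto
    \<comment> \<open>Both \<open>q\<close> and \<open>h\<close> commute with \<open>bp\<close>,
      hence with \<open>dp\<close>; so \<open>bm\<close> commutes with \<open>dp\<close>, and then
      so does \<open>dm\<close>. The inequality for sums of squares needs \<open>ap\<close> and
      \<open>am\<close> to commute.\<close>
    have "q \<otimes> bp = bp \<otimes> q"
      using h q qh by (simp add: bp_def scale_mult_left scale_mult_right mult_diff_left mult_diff_right)
    then have "dp \<otimes> bm = bm \<otimes> dp"
      using dpc[OF q(1)] hdp h q dp(1)
      by (simp add: bm_def scale_mult_left scale_mult_right distrib_left distrib_right)
    then have dpm: "dp \<otimes> dm = dm \<otimes> dp"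
      using dmc dp by blast
    define ap where "ap = h \<ominus> h \<otimes> dp"
    define am where "am = h \<ominus> h \<otimes> dm"
    have ac [simp]: "ap \<in> carrier A" "am \<in> carrier A"
      using h dp dm by (auto simp: ap_def am_def)
    have sa: "cadj A ap = ap" "cadj A am = am"
      using h dp dm hdp hdm by (auto simp: ap_def am_def adj_diff adj_mult)
    have "dm \<otimes> ap = ap \<otimes> dm"
    proof -
      have "dm \<otimes> (h \<otimes> dp) = (h \<otimes> dp) \<otimes> dm"
        using h dp dm hdm dpm by (metis mult_assoc)
      then show ?thesis
        using h dp dm hdm by (simp add: ap_def mult_diff_left mult_diff_right)
    qed
    moreover have "h \<otimes> ap = ap \<otimes> h"
    proof -
      have "h \<otimes> (h \<otimes> dp) = (h \<otimes> dp) \<otimes> h"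
        using h dp hdp by (metis mult_assoc)
      then show ?thesis
        using h dp by (simp add: ap_def mult_diff_left mult_diff_right)
    qed
    ultimately have "ap \<otimes> (h \<otimes> dm) = (h \<otimes> dm) \<otimes> ap"
      using h dm ac(1) by (metis mult_assoc)
    then have comm: "ap \<otimes> am = am \<otimes> ap"
      using h dm \<open>h \<otimes> ap = ap \<otimes> h\<close> by (simp add: am_def mult_diff_left mult_diff_right)
    have app: "ap \<otimes> ap = H2 \<ominus> h \<otimes> (bp \<otimes> h)"
      using sqrt_square[OF dp(1,3) bp(1) h(1) h(1)] hdp by (simp add: ap_def H2_def)
    also have "\<dots> = cscale A (1 - ?r) H2 \<oplus> cscale A ?r H3"
      using h q qh scale_add_same[of H2 1 "- ?r"]
      by (simp add: bp_def H2_def H3_def scale_mult_left scale_mult_right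
          distrib_left distrib_right diff_as_scale scale_add a_assoc[symmetric])
    finally have ap2: "ap \<otimes> ap = cscale A (1 - ?r) H2 \<oplus> cscale A ?r H3" .
    have "am \<otimes> am = H2 \<ominus> h \<otimes> (bm \<otimes> h)"
      using sqrt_square[OF dm(1,3) bm(1) h(1) h(1)] hdm by (simp add: am_def H2_def)
    also have "\<dots> = cscale A (1 - ?r) H2 \<oplus> cscale A (- ?r) H3"
      using h q qh scale_add_same[of H2 1 "- ?r"]
      by (simp add: bm_def H2_def H3_def scale_mult_left scale_mult_right
          distrib_left distrib_right diff_as_scale scale_add a_assoc[symmetric])
    finally have am2: "am \<otimes> am = cscale A (1 - ?r) H2 \<oplus> cscale A (- ?r) H3" .
    have "ap \<otimes> ap \<oplus> am \<otimes> am = (cscale A (1 - ?r) H2 \<oplus> cscale A (1 - ?r) H2) \<oplus> (cscale A ?r H3 \<oplus> cscale A (- ?r) H3)"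
      unfolding ap2 am2 by (simp add: a_ac)
    also have "\<dots> = cscale A (of_real (2 * (1 - r))) H2"
      by (simp add: scale_add_same)
    finally have sum: "ap \<otimes> ap \<oplus> am \<otimes> am = cscale A (of_real (2 * (1 - r))) H2" .
    have "(cnorm A ap)\<^sup>2 \<le> cnorm A (ap \<otimes> ap \<oplus> am \<otimes> am)"
      using norm_le_norm_sum_squares[of ap am] comm sa by simp
    also have "\<dots> = 2 * (1 - r) * cnorm A H2"
      unfolding sum using r norm_scale[OF Hc(1), of "of_real (2 * (1 - r))"] by (simp only: norm_of_real) simp
    finally have *: "cnorm A (ap \<otimes> ap) \<le> 2 * (1 - r) * cnorm A H2"
      using norm_selfadj_square[OF ac(1) sa(1)] by simp
    \<comment> \<open>The bound on the square of \<open>ap\<close> costs \<open>2 (1 - r)\<close>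
      and the removal of \<open>(1 - r) h\<^sup>2\<close> another \<open>1 - r\<close>: together the
      factor 3.\<close>
    have "cscale A ?r H3 = ap \<otimes> ap \<ominus> cscale A (1 - ?r) H2"
      unfolding ap2 by (simp add: a_comm[of "cscale A (1 - ?r) H2"] add_diff_cancel)
    then have "r * cnorm A H3 \<le> cnorm A (ap \<otimes> ap) + cmod (1 - ?r) * cnorm A H2"
      using norm_triangle_diff[of "ap \<otimes> ap" "cscale A (1 - ?r) H2"] norm_scale[OF Hc(2), of ?r] r
      by (simp add: norm_scale)
    moreover have "cmod (1 - ?r) = 1 - r"
      using r norm_of_real[of "1 - r", where 'a = complex] by simp
    ultimately have "r * cnorm A H3 \<le> 3 * (1 - r) * cnorm A H2"
      using * by (simp add: algebra_simps)
    then show ?thesis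
      using r by (simp add: field_simps)
  qed
  \<comment> \<open>With \<open>r = 1 - 1/(n + 2)\<close> the quotient \<open>(1 - r) / r\<close> is
    \<open>1/(n + 1)\<close>; the shift by two keeps \<open>r\<close> positive at
    \<open>n = 0\<close>.\<close>
  have "(\<lambda>n. 3 * ((1 - (1 - 1 / (real n + 2))) / (1 - 1 / (real n + 2))) * cnorm A H2) \<longlonglongrightarrow> 0"
  proof -
    have eq: "3 * ((1 - (1 - 1 / (real n + 2))) / (1 - 1 / (real n + 2))) * cnorm A H2 = 3 * cnorm A H2 * inverse (real (Suc n))" for n
      by (simp add: field_simps)
    show ?thesis
      unfolding eq using tendsto_mult_right_zero[OF LIMSEQ_inverse_real_of_nat] by blast
  qed
  then have "cnorm A H3 \<le> 0"
    by (rule LIMSEQ_le_const) (intro exI[of _ 0] allI impI bound, auto simp: field_simps)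
  then have "H3 = \<zero>"
    using norm_nonneg[OF Hc(2)] norm_eq_0[OF Hc(2)] by simp
  \<comment> \<open>\<open>h\<^sup>3 = 0\<close> gives \<open>h\<^sup>4 = 0\<close>, and the
    C*-identity for self-adjoint elements descends from there to \<open>h\<^sup>2\<close> and to
    \<open>h\<close>.\<close>
  then have "H2 \<otimes> H2 = \<zero>"
    using h by (simp add: H2_def H3_def mult_assoc)
  then have "cnorm A H2 = 0"
    using norm_selfadj_square[OF Hc(1)] h by (simp add: H2_def adj_mult)
  then show ?thesis
    using norm_selfadj_square[OF h] norm_eq_0[OF h(1)] by (simp add: H2_def)
qed

text \<open>For \<open>y = (1 - p) x\<close> one has \<open>p y = 0\<close>, so
  \<open>y\<^sup>* y = x\<^sup>* y\<close> and \<open>\<parallel>y\<parallel>\<^sup>2 \<le>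
  \<parallel>x\<parallel> \<parallel>y\<parallel>\<close>.\<close>

lemma norm_proj_complement:
  assumes p: "p \<in> carrier A" "cadj A p = p" "p \<otimes> p = p" and x: "x \<in> carrier A"
  shows "cnorm A (x \<ominus> p \<otimes> x) \<le> cnorm A x"
proof -
  let ?y = "x \<ominus> p \<otimes> x"
  have yc: "?y \<in> carrier A"
    using p x by simp
  have "p \<otimes> ?y = \<zero>"
    using p x mult_assoc[of p p x] by (simp add: mult_diff_right)
  then have "cadj A (p \<otimes> x) \<otimes> ?y = \<zero>"
    using p x yc by (simp add: adj_mult mult_assoc)
  then have "cadj A ?y \<otimes> ?y = cadj A x \<otimes> ?y"
    using p x yc by (simp add: adj_diff mult_diff_left)
  then have "(cnorm A ?y)\<^sup>2 \<le> cnorm A x * cnorm A ?y"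
    using norm_adj_mult[OF yc] norm_mult[of "cadj A x" ?y] x yc by simp
  then show ?thesis
    using norm_nonneg[OF yc] norm_nonneg[OF x] by (cases "cnorm A ?y = 0") (auto simp: power2_eq_square)
qed

text \<open>Compressing the sum to \<open>q i\<close> shows that the elements
  \<open>q i (q l) (q i)\<close> with \<open>l \<noteq> i\<close> add up to zero. An order on the
  algebra would kill each of them at once. Instead, a small multiple \<open>h\<close> of one of them
  satisfies both \<open>\<parallel>q i - h\<parallel> \<le> 1\<close> and
  \<open>\<parallel>q i + h\<parallel> \<le> 1\<close>, which forces
  \<open>h = \<zero>\<close>.\<close>

lemma projections_orthogonal:
  assumes F: "finite F" and q: "\<And>i. i \<in> F \<Longrightarrow> q i \<in> carrier A" "\<And>i. i \<in> F \<Longrightarrow> cadj A (q i) = q i"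
      "\<And>i. i \<in> F \<Longrightarrow> q i \<otimes> q i = q i"
    and p: "\<And>i. i \<in> F \<Longrightarrow> finsum A q F \<otimes> q i = q i"
    and i: "i \<in> F" and j: "j \<in> F" "i \<noteq> j"
  shows "q j \<otimes> q i = \<zero>"
proof -
  define h where "h l = q i \<otimes> (q l \<otimes> q i)" for l
  have hc: "h l \<in> carrier A" if "l \<in> F" for l
    using that q i by (simp add: h_def)
  have norm_diff: "cnorm A (q i \<ominus> h l) \<le> 1" if l: "l \<in> F" for l
  proof -
    have "cnorm A (q i \<otimes> (q i \<ominus> q l \<otimes> q i)) \<le> cnorm A (q i) * cnorm A (q i \<ominus> q l \<otimes> q i)"
      using l q i by (intro norm_mult) auto
    also have "\<dots> \<le> 1 * 1"
      using norm_proj_complement[of "q l" "q i"] norm_proj_le_1[of "q i"] q i l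
      by (intro mult_mono norm_nonneg) auto
    also have "q i \<otimes> (q i \<ominus> q l \<otimes> q i) = q i \<ominus> h l"
      using l q i by (simp add: mult_diff_right h_def)
    finally show ?thesis
      by simp
  qed
  define J where "J = F - {i} - {j}"
  have J: "finite J" "J \<subseteq> F" "i \<notin> J" "j \<notin> J"
    using F by (auto simp: J_def)
  have FJ: "F = insert i (insert j J)"
    using i j by (auto simp: J_def)
  have hJ: "h \<in> J \<rightarrow> carrier A"
    using hc J by auto
  have "q i = q i \<otimes> (finsum A q F \<otimes> q i)"
    using p q i by simp
  also have "\<dots> = finsum A h F"
    using F q i by (simp add: finsum_mult_right finsum_mult_left h_def[abs_def] Pi_iff)
  also have "\<dots> = h i \<oplus> (h j \<oplus> finsum A h J)"
    using J hc i j hJ by (simp add: FJ)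
  also have "h i = q i"
    using q i by (simp add: h_def)
  finally have "q i \<oplus> \<zero> = q i \<oplus> (h j \<oplus> finsum A h J)"
    using q i by simp
  then have zero: "h j \<oplus> finsum A h J = \<zero>"
    using q i j hc hJ by (simp add: finsum_closed)
  \<comment> \<open>\<open>q i + h j / c\<close> is the average of \<open>c\<close> elements of norm
    at most one: \<open>q i\<close> itself and the \<open>q i - h l\<close> with \<open>l\<close> in
    \<open>J\<close>.\<close>
  define c where "c = real (card J) + 1"
  have c: "c \<ge> 1" "c > 0"
    by (auto simp: c_def)
  text \<open>The sum of the remaining \<open>h l\<close> is \<open>- h j\<close>, and each satisfies \<open>\<parallel>q i - h l\<parallel> \<le> 1\<close>.\<close>
  have "cnorm A (cscale A (of_nat (card J)) (q i) \<oplus> h j) \<le> real (card J)"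
  proof -
    have "h j = cscale A (-1) (finsum A h J)"
      using zero j hc hJ by (metis minus_equality scale_minus_one finsum_closed)
    then have "cscale A (of_nat (card J)) (q i) \<oplus> h j = finsum A (\<lambda>l. cscale A 1 (q i)) J \<oplus> finsum A (\<lambda>l. cscale A (-1) (h l)) J"
      using J q i hJ by (simp only: finsum_scale_sum finsum_scale) simp
    also have "\<dots> = finsum A (\<lambda>l. q i \<ominus> h l) J"
    proof -
      have "finsum A (\<lambda>l. cscale A 1 (q i)) J \<oplus> finsum A (\<lambda>l. cscale A (-1) (h l)) J
          = finsum A (\<lambda>l. cscale A 1 (q i) \<oplus> cscale A (-1) (h l)) J"
        using q i hJ by (subst finsum_addf) (auto simp: Pi_iff)
      also have "\<dots> = finsum A (\<lambda>l. q i \<ominus> h l) J"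
        using q i hJ by (intro finsum_cong') (auto simp: Pi_iff diff_as_scale)
      finally show ?thesis .
    qed
    also have "cnorm A \<dots> \<le> (\<Sum>l\<in>J. cnorm A (q i \<ominus> h l))"
      using J q i hJ by (intro norm_finsum) (auto simp: Pi_iff)
    also have "\<dots> \<le> (\<Sum>l\<in>J. 1)"
      using norm_diff J by (intro sum_mono) auto
    finally show ?thesis
      by simp
  qed
  then have plus: "cnorm A (cscale A (of_real c) (q i) \<oplus> h j) \<le> c"
  proof -
    assume a: "cnorm A (cscale A (of_nat (card J)) (q i) \<oplus> h j) \<le> real (card J)"
    have "cscale A (of_real c) (q i) \<oplus> h j = q i \<oplus> (cscale A (of_nat (card J)) (q i) \<oplus> h j)"
      using q i j hc scale_add_same[of "q i" 1 "of_nat (card J)"] by (simp add: c_def a_assoc[symmetric] add.commute)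
    then have "cnorm A (cscale A (of_real c) (q i) \<oplus> h j) \<le> cnorm A (q i) + cnorm A (cscale A (of_nat (card J)) (q i) \<oplus> h j)"
      using q i j hc by (simp add: norm_triangle)
    then show ?thesis
      using a norm_proj_le_1[of "q i"] q i by (simp add: c_def)
  qed
  let ?h = "cscale A (of_real (1 / c)) (h j)"
  have "?h = \<zero>"
  proof (rule zero_if_norm_unit_plus_minus_le_1[where q = "q i"])
    show "?h \<in> carrier A" "cadj A ?h = ?h" "q i \<in> carrier A" "cadj A (q i) = q i"
      "q i \<otimes> ?h = ?h" "?h \<otimes> q i = ?h"
      using q i j by (auto simp: h_def adj_scale adj_mult mult_assoc scale_mult_left scale_mult_right)
        (simp_all add: mult_assoc[symmetric])
    have "q i \<oplus> ?h = cscale A (of_real (1 / c)) (cscale A (of_real c) (q i) \<oplus> h j)"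
      using c q i j hc by (simp add: scale_add)
    then have "cnorm A (q i \<oplus> ?h) = 1 / c * cnorm A (cscale A (of_real c) (q i) \<oplus> h j)"
      using c q i j hc norm_scale[of "cscale A (of_real c) (q i) \<oplus> h j" "of_real (1 / c)"]
      by (simp only: norm_of_real) simp
    then show "cnorm A (q i \<oplus> ?h) \<le> 1"
      using c plus by simp
    \<comment> \<open>A convex combination of \<open>q i\<close> and \<open>q i - h j\<close>, as
      \<open>c \<ge> 1\<close>.\<close>
    have "q i \<ominus> ?h = cscale A (of_real (1 - 1 / c)) (q i) \<oplus> cscale A (of_real (1 / c)) (q i \<ominus> h j)"
    proof -
      have "cscale A (of_real (1 - 1 / c)) (q i) \<oplus> cscale A (of_real (1 / c)) (q i \<ominus> h j)
          = (cscale A (of_real (1 - 1 / c)) (q i) \<oplus> cscale A (of_real (1 / c)) (q i)) \<oplus> cscale A (-1) ?h"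
        using q i j hc by (simp add: diff_as_scale scale_add a_assoc)
      also have "cscale A (of_real (1 - 1 / c)) (q i) \<oplus> cscale A (of_real (1 / c)) (q i) = q i"
        using q i by (simp add: scale_add_same)
      finally show ?thesis
        using q i j hc by (simp add: diff_as_scale)
    qed
    then have "cnorm A (q i \<ominus> ?h) \<le> cnorm A (cscale A (of_real (1 - 1 / c)) (q i)) + cnorm A (cscale A (of_real (1 / c)) (q i \<ominus> h j))"
      using q i j hc by (simp add: norm_triangle)
    also have "\<dots> = (1 - 1 / c) * cnorm A (q i) + 1 / c * cnorm A (q i \<ominus> h j)"
      using c q i j hc by (simp only: norm_scale norm_of_real minus_closed) simp
    also have "\<dots> \<le> (1 - 1 / c) * 1 + 1 / c * 1"
      using c norm_diff j norm_proj_le_1[of "q i"] q i by (intro add_mono mult_left_mono) auto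
    finally show "cnorm A (q i \<ominus> ?h) \<le> 1"
      by simp
  qed
  then have "h j = \<zero>"
    using c hc[OF j(1)] norm_scale[OF hc[OF j(1)], of "of_real (1 / c)"] norm_eq_0 by auto
  moreover have "cadj A (q j \<otimes> q i) \<otimes> (q j \<otimes> q i) = h j"
    using q i j mult_assoc[of "q j" "q j" "q i"] by (simp add: h_def adj_mult mult_assoc)
  ultimately show ?thesis
    using norm_adj_mult[of "q j \<otimes> q i"] norm_eq_0[of "q j \<otimes> q i"] q i j by simp
qed

end

subsection \<open>Homomorphisms\<close>

lemma star_homD:
  assumes "star_hom A B f"
  shows "x \<in> carrier A \<Longrightarrow> f x \<in> carrier B"
    "\<lbrakk>x \<in> carrier A; y \<in> carrier A\<rbrakk> \<Longrightarrow> f (x \<oplus>\<^bsub>A\<^esub> y) = f x \<oplus>\<^bsub>B\<^esub> f y"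
    "x \<in> carrier A \<Longrightarrow> f (cscale A c x) = cscale B c (f x)"
    "\<lbrakk>x \<in> carrier A; y \<in> carrier A\<rbrakk> \<Longrightarrow> f (x \<otimes>\<^bsub>A\<^esub> y) = f x \<otimes>\<^bsub>B\<^esub> f y"
    "x \<in> carrier A \<Longrightarrow> f (cadj A x) = cadj B (f x)"
  using assms by (auto simp: star_hom_def)

locale cstar_hom = A: cstar_algebra A + B: cstar_algebra B
  for A :: "'a cstar" and B :: "'b cstar" and f :: "'a \<Rightarrow> 'b" +
  assumes hom: "star_hom A B f"
begin

lemmas hom_closed [simp, intro] = star_homD(1)[OF hom]
lemmas hom_add = star_homD(2)[OF hom]
lemmas hom_scale = star_homD(3)[OF hom]
lemmas hom_mult = star_homD(4)[OF hom]
lemmas hom_adj = star_homD(5)[OF hom]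

lemma hom_zero [simp]: "f \<zero>\<^bsub>A\<^esub> = \<zero>\<^bsub>B\<^esub>"
  using hom_scale[of "\<zero>\<^bsub>A\<^esub>" 0] by simp

lemma hom_diff: "\<lbrakk>x \<in> carrier A; y \<in> carrier A\<rbrakk> \<Longrightarrow> f (x \<ominus>\<^bsub>A\<^esub> y) = f x \<ominus>\<^bsub>B\<^esub> f y"
  by (simp add: A.diff_as_scale B.diff_as_scale hom_add hom_scale)

lemma hom_finsum:
  "\<lbrakk>finite F; h \<in> F \<rightarrow> carrier A\<rbrakk> \<Longrightarrow> f (finsum A h F) = finsum B (\<lambda>i. f (h i)) F"
  by (induction F rule: finite_induct) (auto simp: Pi_iff hom_add)

text \<open>For self-adjoint \<open>a\<close> with \<open>\<parallel>a\<parallel> < 1\<close> the element \<open>a + i sqrt (1 - a\<^sup>2)\<close> is a unitary with real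
  part \<open>a\<close>, and so is its image; the unit is only formal here.\<close>

lemma selfadj_norm_le_1:
  assumes a: "a \<in> carrier A" "cadj A a = a" "cnorm A a < 1"
  shows "cnorm B (f a) \<le> 1"
proof -
  define b where "b = a \<otimes>\<^bsub>A\<^esub> a"
  have b: "b \<in> carrier A" "cadj A b = b"
    using a by (auto simp: b_def A.adj_mult)
  have "cnorm A b < 1"
    using A.norm_selfadj_square[OF a(1,2)] A.norm_nonneg[OF a(1)] a(3)
    by (simp add: b_def power_less_one_iff)
  then obtain d where d: "d \<in> carrier A" "cadj A d = d" "cscale A 2 d = b \<oplus>\<^bsub>A\<^esub> d \<otimes>\<^bsub>A\<^esub> d"
    and dc: "\<And>y. y \<in> carrier A \<Longrightarrow> y \<otimes>\<^bsub>A\<^esub> b = b \<otimes>\<^bsub>A\<^esub> y \<Longrightarrow> y \<otimes>\<^bsub>A\<^esub> d = d \<otimes>\<^bsub>A\<^esub> y"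
    using A.selfadj_sqrt[OF b] by blast
  have ad: "a \<otimes>\<^bsub>A\<^esub> d = d \<otimes>\<^bsub>A\<^esub> a"
    using dc[OF a(1)] a by (simp add: b_def A.mult_assoc)
  define a' d' where "a' = f a" and "d' = f d"
  have c: "a' \<in> carrier B" "d' \<in> carrier B"
    using a d by (auto simp: a'_def d'_def)
  have sa: "cadj B a' = a'" "cadj B d' = d'"
    using a d by (simp_all add: a'_def d'_def hom_adj[symmetric])
  have d'2: "cscale B 2 d' = a' \<otimes>\<^bsub>B\<^esub> a' \<oplus>\<^bsub>B\<^esub> d' \<otimes>\<^bsub>B\<^esub> d'"
  proof -
    have "cscale B 2 d' = f (b \<oplus>\<^bsub>A\<^esub> d \<otimes>\<^bsub>A\<^esub> d)"
      using hom_scale[OF d(1), of 2] d(3) by (simp add: d'_def)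
    then show ?thesis
      using a d by (simp add: b_def hom_add hom_mult a'_def d'_def)
  qed
  have ad': "a' \<otimes>\<^bsub>B\<^esub> d' = d' \<otimes>\<^bsub>B\<^esub> a'"
    using arg_cong[OF ad, of f] a d by (simp add: hom_mult a'_def d'_def)
  \<comment> \<open>The real and imaginary parts of the unitary, each multiplied by
    \<open>a'\<close> to stay inside \<open>B\<close>: \<open>y\<^sup>* y + w\<^sup>* w = a'\<^sup>4
    + (a'\<^sup>2 - a'\<^sup>4)\<close>.\<close>
  define y w where "y = a' \<otimes>\<^bsub>B\<^esub> a'" and "w = a' \<ominus>\<^bsub>B\<^esub> d' \<otimes>\<^bsub>B\<^esub> a'"
  have yw: "y \<in> carrier B" "w \<in> carrier B"
    using c by (auto simp: y_def w_def)
  have adj_w: "cadj B w = a' \<ominus>\<^bsub>B\<^esub> a' \<otimes>\<^bsub>B\<^esub> d'"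
    using c sa by (simp add: w_def B.adj_diff B.adj_mult)
  have "cadj B y \<otimes>\<^bsub>B\<^esub> w = cadj B w \<otimes>\<^bsub>B\<^esub> y"
  proof -
    have "a' \<otimes>\<^bsub>B\<^esub> (d' \<otimes>\<^bsub>B\<^esub> a') = d' \<otimes>\<^bsub>B\<^esub> (a' \<otimes>\<^bsub>B\<^esub> a')"
      using c ad' B.mult_assoc[of a' d' a'] B.mult_assoc[of d' a' a'] by simp
    then show ?thesis
      using c sa by (simp add: adj_w)
        (simp add: y_def w_def B.adj_mult B.mult_diff_left B.mult_diff_right B.mult_assoc)
  qed
  then have "(cnorm B y)\<^sup>2 \<le> cnorm B (cadj B y \<otimes>\<^bsub>B\<^esub> y \<oplus>\<^bsub>B\<^esub> cadj B w \<otimes>\<^bsub>B\<^esub> w)"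
    using yw by (intro B.norm_le_norm_sum_squares)
  also have "cadj B y \<otimes>\<^bsub>B\<^esub> y \<oplus>\<^bsub>B\<^esub> cadj B w \<otimes>\<^bsub>B\<^esub> w = a' \<otimes>\<^bsub>B\<^esub> a'"
  proof -
    have "cadj B w \<otimes>\<^bsub>B\<^esub> w = a' \<otimes>\<^bsub>B\<^esub> a' \<ominus>\<^bsub>B\<^esub> a' \<otimes>\<^bsub>B\<^esub> ((a' \<otimes>\<^bsub>B\<^esub> a') \<otimes>\<^bsub>B\<^esub> a')"
      unfolding adj_w using c by (simp add: w_def B.sqrt_square[OF c(2) d'2])
    moreover have "cadj B y \<otimes>\<^bsub>B\<^esub> y = a' \<otimes>\<^bsub>B\<^esub> ((a' \<otimes>\<^bsub>B\<^esub> a') \<otimes>\<^bsub>B\<^esub> a')"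
      using c sa by (simp add: y_def B.adj_mult B.mult_assoc)
    ultimately show ?thesis
      using c by (simp add: B.add_diff_cancel_left)
  qed
  finally have "((cnorm B a')\<^sup>2)\<^sup>2 \<le> (cnorm B a')\<^sup>2"
    using B.norm_selfadj_square[OF c(1) sa(1)] by (simp add: y_def)
  moreover have "N \<le> 1" if "N\<^sup>2 \<le> N" for N :: real
    using that power2_le_iff_abs_le[of 1 N] self_le_power[of N 2] by (cases "N \<le> 1") (auto simp: power2_eq_square)
  ultimately have "(cnorm B a')\<^sup>2 \<le> 1"
    by blast
  then show ?thesis
    using B.norm_nonneg[OF c(1)] by (simp add: a'_def power_le_one_iff)
qed

lemma selfadj_contractive:
  assumes a: "a \<in> carrier A" "cadj A a = a"
  shows "cnorm B (f a) \<le> cnorm A a"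
proof (rule field_le_epsilon)
  fix e :: real assume e: "e > 0"
  \<comment> \<open>Dividing by more than \<open>\<parallel>a\<parallel>\<close> gives the strict
    inequality required and covers \<open>a = \<zero>\<close>.\<close>
  define t where "t = cnorm A a + e"
  have t: "t > 0"
    using e A.norm_nonneg[OF a(1)] by (simp add: t_def)
  define a' where "a' = cscale A (complex_of_real (1 / t)) a"
  have "cmod (complex_of_real (1 / t)) = 1 / t"
    using t by (simp only: norm_of_real) simp
  then have n: "cnorm A a' = cnorm A a / t" "cnorm B (f a') = cnorm B (f a) / t"
    using a by (auto simp: a'_def A.norm_scale B.norm_scale hom_scale)
  have "cnorm A a / t < 1"
    using t e by (simp add: t_def)
  then have "cnorm B (f a') \<le> 1"
    using a n by (intro selfadj_norm_le_1) (auto simp: a'_def A.adj_scale)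
  then show "cnorm B (f a) \<le> cnorm A a + e"
    using n t by (simp add: t_def)
qed

text \<open>The C*-identity in both algebras reduces the claim to the self-adjoint element
  \<open>x\<^sup>* x\<close>.\<close>

lemma contractive: "x \<in> carrier A \<Longrightarrow> cnorm B (f x) \<le> cnorm A x"
proof -
  assume x: "x \<in> carrier A"
  have "cnorm B (f (cadj A x \<otimes>\<^bsub>A\<^esub> x)) \<le> cnorm A (cadj A x \<otimes>\<^bsub>A\<^esub> x)"
    using x by (intro selfadj_contractive) (auto simp: A.adj_mult)
  then have "(cnorm B (f x))\<^sup>2 \<le> (cnorm A x)\<^sup>2"
    using x by (simp add: hom_mult hom_adj B.norm_adj_mult A.norm_adj_mult)
  then show ?thesis
    using x A.norm_nonneg power2_le_imp_le by blast
qed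

lemma lipschitz:
  "\<lbrakk>x \<in> carrier A; y \<in> carrier A\<rbrakk> \<Longrightarrow> cnorm B (f x \<ominus>\<^bsub>B\<^esub> f y) \<le> 1 * cnorm A (x \<ominus>\<^bsub>A\<^esub> y)"
  using contractive[of "x \<ominus>\<^bsub>A\<^esub> y"] by (simp add: hom_diff)

text \<open>The \<open>2\<^sup>n\<close>-th powers of \<open>y\<^sup>* y\<close> turn equivalence of the two C*-norms into equality.\<close>

lemma isometric_if_bounded_below:
  assumes V: "V \<subseteq> carrier A" "\<And>x y. x \<in> V \<Longrightarrow> y \<in> V \<Longrightarrow> x \<otimes>\<^bsub>A\<^esub> y \<in> V" "\<And>x. x \<in> V \<Longrightarrow> cadj A x \<in> V"
    and K: "\<And>x. x \<in> V \<Longrightarrow> cnorm A x \<le> K * cnorm B (f x)" and y: "y \<in> V"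
  shows "cnorm A y \<le> cnorm B (f y)"
proof -
  define h where "h = cadj A y \<otimes>\<^bsub>A\<^esub> y"
  have h: "h \<in> V" "cadj A h = h"
    using V y by (auto simp: h_def A.adj_mult subset_iff)
  define p where "p = rec_nat h (\<lambda>_ x. x \<otimes>\<^bsub>A\<^esub> x)"
  have pS: "p 0 = h" "p (Suc n) = p n \<otimes>\<^bsub>A\<^esub> p n" for n
    by (simp_all add: p_def)
  have p: "p n \<in> V \<and> cadj A (p n) = p n \<and> cnorm A (p n) = cnorm A h ^ (2 ^ n) \<and>
      cnorm B (f (p n)) = cnorm B (f h) ^ (2 ^ n)" for n
  proof (induction n)
    case (Suc n)
    then have c: "p n \<in> carrier A" "cadj A (p n) = p n"
      using V by auto
    have "cadj B (f (p n)) = f (p n)"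
      using c hom_adj by metis
    then have "cnorm B (f (p (Suc n))) = (cnorm B (f (p n)))\<^sup>2"
      using c B.norm_selfadj_square[of "f (p n)"] by (simp add: pS hom_mult)
    moreover have "cnorm A (p (Suc n)) = (cnorm A (p n))\<^sup>2"
      using c A.norm_selfadj_square[of "p n"] by (simp add: pS)
    ultimately show ?case
      using Suc V c by (simp add: pS A.adj_mult power_mult[symmetric] mult.commute)
  qed (use h in \<open>simp add: pS\<close>)
  have hc: "h \<in> carrier A"
    using h V by blast
  have le: "cnorm A h ^ (2 ^ n) \<le> K * cnorm B (f h) ^ (2 ^ n)" for n
    using K[of "p n"] p[of n] by simp
  have "cnorm A h \<le> cnorm B (f h)"
  proof (rule ccontr)
    assume "\<not> ?thesis"
    then have lt: "cnorm B (f h) < cnorm A h"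
      by simp
    show False
    proof (cases "cnorm B (f h) = 0")
      case True
      then show False
        using le[of 0] lt by simp
    next
      case False
      then have pos: "cnorm B (f h) > 0"
        using B.norm_nonneg[of "f h"] hc by simp
      define q where "q = cnorm A h / cnorm B (f h)"
      have q: "q > 1"
        using lt pos by (simp add: q_def)
      then obtain n where n: "K < q ^ n"
        using real_arch_pow by blast
      \<comment> \<open>Since \<open>n \<le> 2 ^ n\<close>, the unbounded growth of the powers of
        \<open>q > 1\<close> contradicts the bound \<open>K\<close> along the exponents
        \<open>2 ^ n\<close>.\<close>
      have "q ^ n \<le> q ^ (2 ^ n)"
        using q by (intro power_increasing) (auto intro: less_imp_le)
      also have "\<dots> \<le> K"
        using le[of n] pos by (simp add: q_def power_divide pos_divide_le_eq)
      finally show False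
        using n by simp
    qed
  qed
  then have "(cnorm A y)\<^sup>2 \<le> (cnorm B (f y))\<^sup>2"
    using y V by (simp add: h_def A.norm_adj_mult hom_mult hom_adj B.norm_adj_mult subset_iff)
  then show ?thesis
    using y V B.norm_nonneg[of "f y"] power2_le_imp_le by blast
qed

end

subsection \<open>Convergent sequences\<close>

context cstar_algebra
begin

text \<open>Membership of the terms and of the limit is part of the notion, so the limit laws carry
  no such conditions on the sequences.\<close>

definition clim :: "(nat \<Rightarrow> 'a) \<Rightarrow> 'a \<Rightarrow> bool" where
  "clim f x \<longleftrightarrow> (\<forall>n. f n \<in> carrier A) \<and> x \<in> carrier A \<and> (\<lambda>n. cnorm A (f n \<ominus> x)) \<longlonglongrightarrow> 0"

lemma climD: "clim f x \<Longrightarrow> f n \<in> carrier A" "clim f x \<Longrightarrow> x \<in> carrier A"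
  "clim f x \<Longrightarrow> (\<lambda>n. cnorm A (f n \<ominus> x)) \<longlonglongrightarrow> 0"
  by (auto simp: clim_def)

lemma clim_unique:
  assumes "clim f x" "clim f y" shows "x = y"
proof -
  note c = climD[OF assms(1)] climD[OF assms(2)]
  have "(\<lambda>n. cnorm A (f n \<ominus> x) + cnorm A (f n \<ominus> y)) \<longlonglongrightarrow> 0 + 0"
    using c by (intro tendsto_add)
  moreover have "cnorm A (x \<ominus> y) \<le> cnorm A (f n \<ominus> x) + cnorm A (f n \<ominus> y)" for n
    using norm_diff_triangle[of x "f n" y] norm_minus_commute[of x "f n"] c by simp
  ultimately have "cnorm A (x \<ominus> y) \<le> 0"
    by (intro LIMSEQ_le_const) auto
  then show ?thesis
    using c norm_nonneg[of "x \<ominus> y"] norm_eq_0[of "x \<ominus> y"] by (simp add: diff_eq_zero_iff)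
qed

lemma clim_add:
  assumes "clim f x" "clim g y" shows "clim (\<lambda>n. f n \<oplus> g n) (x \<oplus> y)"
proof -
  note c = climD[OF assms(1)] climD[OF assms(2)]
  have s: "(\<lambda>n. cnorm A (f n \<ominus> x) + cnorm A (g n \<ominus> y)) \<longlonglongrightarrow> 0"
    using tendsto_add[OF c(3) c(6)] by simp
  have "(\<lambda>n. cnorm A ((f n \<oplus> g n) \<ominus> (x \<oplus> y))) \<longlonglongrightarrow> 0"
  proof (rule tendsto_sandwich[OF _ _ tendsto_const s])
    show "\<forall>\<^sub>F n in sequentially. 0 \<le> cnorm A ((f n \<oplus> g n) \<ominus> (x \<oplus> y))"
      using c by (intro always_eventually allI norm_nonneg) auto
    show "\<forall>\<^sub>F n in sequentially. cnorm A ((f n \<oplus> g n) \<ominus> (x \<oplus> y)) \<le> cnorm A (f n \<ominus> x) + cnorm A (g n \<ominus> y)"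
      using c by (intro always_eventually allI) (simp add: add_diff_add norm_triangle)
  qed
  then show ?thesis
    using c by (simp add: clim_def)
qed

lemma clim_lipschitz:
  assumes B: "cstar_algebra B" and f: "clim f x" and g: "\<And>x. x \<in> carrier A \<Longrightarrow> g x \<in> carrier B"
    and lip: "\<And>x y. x \<in> carrier A \<Longrightarrow> y \<in> carrier A \<Longrightarrow> cnorm B (g x \<ominus>\<^bsub>B\<^esub> g y) \<le> K * cnorm A (x \<ominus> y)"
  shows "cstar_algebra.clim B (\<lambda>n. g (f n)) (g x)"
proof -
  interpret B: cstar_algebra B
    by fact
  note c = climD[OF f]
  have s: "(\<lambda>n. K * cnorm A (f n \<ominus> x)) \<longlonglongrightarrow> 0"
    using tendsto_mult_right_zero[OF c(3)] .
  have "(\<lambda>n. cnorm B (g (f n) \<ominus>\<^bsub>B\<^esub> g x)) \<longlonglongrightarrow> 0"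
  proof (rule tendsto_sandwich[OF _ _ tendsto_const s])
    show "\<forall>\<^sub>F n in sequentially. 0 \<le> cnorm B (g (f n) \<ominus>\<^bsub>B\<^esub> g x)"
      using c g by (intro always_eventually allI B.norm_nonneg) auto
    show "\<forall>\<^sub>F n in sequentially. cnorm B (g (f n) \<ominus>\<^bsub>B\<^esub> g x) \<le> K * cnorm A (f n \<ominus> x)"
      using c lip by (intro always_eventually allI) auto
  qed
  then show ?thesis
    using c g by (simp add: B.clim_def)
qed

lemma clim_scale: "clim f x \<Longrightarrow> clim (\<lambda>n. cscale A c (f n)) (cscale A c x)"
  by (rule clim_lipschitz[where K = "cmod c"])
    (auto simp: scale_diff[symmetric] norm_scale intro: cstar_algebra_axioms)

lemma clim_mult_left: "clim f x \<Longrightarrow> a \<in> carrier A \<Longrightarrow> clim (\<lambda>n. a \<otimes> f n) (a \<otimes> x)"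
  by (rule clim_lipschitz[where K = "cnorm A a"]) (auto intro: cstar_algebra_axioms lipschitz_mult_left)

lemma clim_mult_right: "clim f x \<Longrightarrow> a \<in> carrier A \<Longrightarrow> clim (\<lambda>n. f n \<otimes> a) (x \<otimes> a)"
  by (rule clim_lipschitz[where K = "cnorm A a"]) (auto intro: cstar_algebra_axioms lipschitz_mult_right)

lemma clim_norm_diff_le:
  assumes f: "clim f x" and y: "y \<in> carrier A" and le: "\<And>n. n \<ge> N \<Longrightarrow> cnorm A (y \<ominus> f n) \<le> K"
  shows "cnorm A (y \<ominus> x) \<le> K"
proof -
  note c = climD[OF f]
  have "(\<lambda>n. K + cnorm A (f n \<ominus> x)) \<longlonglongrightarrow> K + 0"
    by (intro tendsto_intros c)
  moreover have "cnorm A (y \<ominus> x) \<le> K + cnorm A (f n \<ominus> x)" if "n \<ge> N" for n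
    using norm_diff_triangle[of y "f n" x] c y le[OF that] by simp
  ultimately show ?thesis
    by (intro LIMSEQ_le_const) auto
qed

lemma clim_norm_le:
  assumes f: "clim f x" and le: "\<And>n. n \<ge> N \<Longrightarrow> cnorm A (f n) \<le> K" shows "cnorm A x \<le> K"
proof -
  note c = climD[OF f]
  have "cnorm A (\<zero> \<ominus> x) \<le> K"
    using f by (rule clim_norm_diff_le[where N = N]) (use c le norm_minus_commute[of \<zero>] in auto)
  then show ?thesis
    using c(2) norm_minus_commute[of \<zero> x] by simp
qed

lemma in_closure_clim:
  assumes "S \<subseteq> carrier A" "x \<in> ctopology A closure_of S"
  obtains f where "\<And>n. f n \<in> S" "clim f x"
proof -
  have x: "x \<in> carrier A" "\<And>e. e > 0 \<Longrightarrow> \<exists>y\<in>S. cnorm A (x \<ominus> y) < e"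
    using assms by (auto simp: in_closure_iff)
  have "\<exists>y\<in>S. cnorm A (x \<ominus> y) < inverse (real (Suc n))" for n
    by (intro x(2)) simp
  then obtain f where f: "\<And>n. f n \<in> S" "\<And>n. cnorm A (x \<ominus> f n) < inverse (real (Suc n))"
    by metis
  have fc: "f n \<in> carrier A" for n
    using f assms by blast
  have "(\<lambda>n. cnorm A (f n \<ominus> x)) \<longlonglongrightarrow> 0"
  proof (rule tendsto_sandwich[OF _ _ tendsto_const LIMSEQ_inverse_real_of_nat])
    show "\<forall>\<^sub>F n in sequentially. 0 \<le> cnorm A (f n \<ominus> x)"
      using fc x by (intro always_eventually allI norm_nonneg) auto
    show "\<forall>\<^sub>F n in sequentially. cnorm A (f n \<ominus> x) \<le> inverse (real (Suc n))"
      using f(2) fc x by (intro always_eventually allI) (simp add: norm_minus_commute[of _ x] less_imp_le)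
  qed
  then have "clim f x"
    using fc x by (simp add: clim_def)
  then show ?thesis
    using that f by blast
qed

end

subsection \<open>Constructing C*-algebras\<close>

text \<open>Completeness is asked in terms of the norm instead of the metric. The distance must be
  known to be a metric before the axioms are at hand, so its symmetry is supplied by
  \<open>neg\<close>.\<close>

lemma cstar_algebraI:
  fixes A :: "'a cstar" (structure)
  assumes "abelian_group A"
    and "\<And>x y. \<lbrakk>x \<in> carrier A; y \<in> carrier A\<rbrakk> \<Longrightarrow> x \<otimes> y \<in> carrier A"
    and "\<And>x y z. \<lbrakk>x \<in> carrier A; y \<in> carrier A; z \<in> carrier A\<rbrakk> \<Longrightarrow> (x \<otimes> y) \<otimes> z = x \<otimes> (y \<otimes> z)"
    and "\<And>x y z. \<lbrakk>x \<in> carrier A; y \<in> carrier A; z \<in> carrier A\<rbrakk> \<Longrightarrow> (x \<oplus> y) \<otimes> z = x \<otimes> z \<oplus> y \<otimes> z"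
    and "\<And>x y z. \<lbrakk>x \<in> carrier A; y \<in> carrier A; z \<in> carrier A\<rbrakk> \<Longrightarrow> z \<otimes> (x \<oplus> y) = z \<otimes> x \<oplus> z \<otimes> y"
    and "\<And>x c. x \<in> carrier A \<Longrightarrow> cscale A c x \<in> carrier A"
    and "\<And>x y c. \<lbrakk>x \<in> carrier A; y \<in> carrier A\<rbrakk> \<Longrightarrow> cscale A c (x \<oplus> y) = cscale A c x \<oplus> cscale A c y"
    and "\<And>x b c. x \<in> carrier A \<Longrightarrow> cscale A (b + c) x = cscale A b x \<oplus> cscale A c x"
    and "\<And>x b c. x \<in> carrier A \<Longrightarrow> cscale A b (cscale A c x) = cscale A (b * c) x"
    and "\<And>x. x \<in> carrier A \<Longrightarrow> cscale A 1 x = x"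
    and "\<And>x y c. \<lbrakk>x \<in> carrier A; y \<in> carrier A\<rbrakk> \<Longrightarrow> cscale A c x \<otimes> y = cscale A c (x \<otimes> y)"
    and "\<And>x y c. \<lbrakk>x \<in> carrier A; y \<in> carrier A\<rbrakk> \<Longrightarrow> x \<otimes> cscale A c y = cscale A c (x \<otimes> y)"
    and "\<And>x. x \<in> carrier A \<Longrightarrow> cadj A x \<in> carrier A"
    and "\<And>x. x \<in> carrier A \<Longrightarrow> cadj A (cadj A x) = x"
    and "\<And>x y. \<lbrakk>x \<in> carrier A; y \<in> carrier A\<rbrakk> \<Longrightarrow> cadj A (x \<oplus> y) = cadj A x \<oplus> cadj A y"
    and "\<And>x c. x \<in> carrier A \<Longrightarrow> cadj A (cscale A c x) = cscale A (cnj c) (cadj A x)"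
    and "\<And>x y. \<lbrakk>x \<in> carrier A; y \<in> carrier A\<rbrakk> \<Longrightarrow> cadj A (x \<otimes> y) = cadj A y \<otimes> cadj A x"
    and nonneg: "\<And>x. x \<in> carrier A \<Longrightarrow> 0 \<le> cnorm A x"
    and eq0: "\<And>x. x \<in> carrier A \<Longrightarrow> cnorm A x = 0 \<longleftrightarrow> x = \<zero>"
    and triangle: "\<And>x y. \<lbrakk>x \<in> carrier A; y \<in> carrier A\<rbrakk> \<Longrightarrow> cnorm A (x \<oplus> y) \<le> cnorm A x + cnorm A y"
    and "\<And>x c. x \<in> carrier A \<Longrightarrow> cnorm A (cscale A c x) = cmod c * cnorm A x"
    and "\<And>x y. \<lbrakk>x \<in> carrier A; y \<in> carrier A\<rbrakk> \<Longrightarrow> cnorm A (x \<otimes> y) \<le> cnorm A x * cnorm A y"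
    and "\<And>x. x \<in> carrier A \<Longrightarrow> cnorm A (cadj A x \<otimes> x) = (cnorm A x)\<^sup>2"
    and neg: "\<And>x. x \<in> carrier A \<Longrightarrow> cnorm A (\<ominus> x) = cnorm A x"
    and Cauchy: "\<And>f. (\<And>n. f n \<in> carrier A) \<Longrightarrow>
        (\<And>e. e > 0 \<Longrightarrow> \<exists>N. \<forall>m\<ge>N. \<forall>n\<ge>N. cnorm A (f m \<ominus> f n) < e) \<Longrightarrow>
        \<exists>x\<in>carrier A. (\<lambda>n. cnorm A (f n \<ominus> x)) \<longlonglongrightarrow> 0"
  shows "cstar_algebra A"
proof -
  interpret abelian_group A
    by fact
  interpret m: Metric_space "carrier A" "cdist A"
  proof
    show "0 \<le> cdist A x y" for x y
      by (simp add: cdist_def nonneg)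
    have "cnorm A (x \<ominus> y) = cnorm A (y \<ominus> x)" if "x \<in> carrier A" "y \<in> carrier A" for x y
      using that neg[of "y \<ominus> x"] by (simp add: a_minus_def minus_add a_comm)
    then show "cdist A x y = cdist A y x" for x y
      by (simp add: cdist_def)
    show "cdist A x y = 0 \<longleftrightarrow> x = y" if "x \<in> carrier A" "y \<in> carrier A" for x y
      using that minus_equality[of x "\<ominus> y"] by (auto simp: cdist_def eq0 minus_eq r_neg)
    show "cdist A x z \<le> cdist A x y + cdist A y z"
      if x: "x \<in> carrier A" and y: "y \<in> carrier A" and z: "z \<in> carrier A" for x y z
    proof -
      have "x \<ominus> z = (x \<ominus> y) \<oplus> (y \<ominus> z)"
        using x y z by (simp add: a_minus_def a_assoc r_neg1)
      then show ?thesis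
        using x y z triangle[of "x \<ominus> y" "y \<ominus> z"] by (simp add: cdist_def)
    qed
  qed
  have complete: "m.mcomplete"
    unfolding m.mcomplete_def
  proof (intro allI impI)
    fix f assume "m.MCauchy f"
    note * = \<open>m.MCauchy f\<close>[unfolded m.MCauchy_def]
    have f: "f n \<in> carrier A" for n
      using *[THEN conjunct1] by blast
    have C: "\<exists>N. \<forall>m\<ge>N. \<forall>n\<ge>N. cnorm A (f m \<ominus> f n) < e" if "e > 0" for e
      using *[THEN conjunct2, rule_format, OF that] f by (simp add: cdist_def)
    obtain x where "x \<in> carrier A" "(\<lambda>n. cnorm A (f n \<ominus> x)) \<longlonglongrightarrow> 0"
      using Cauchy[OF f C] by blast
    then show "\<exists>x. limitin m.mtopology f x sequentially"
      using f by (intro exI[of _ x]) (simp add: m.limitin_metric_dist_null cdist_def)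
  qed
  show ?thesis
    by (intro cstar_algebra.intro cstar_algebra_axioms.intro) (fact assms complete)+
qed

text \<open>Transport of structure along an injective \<open>f\<close>. It serves for a subalgebra
  itself, with \<open>f\<close> the identity, and for a copy of a subalgebra in the test
  type.\<close>

definition cstar_image :: "'a cstar \<Rightarrow> 'a set \<Rightarrow> ('a \<Rightarrow> 'b) \<Rightarrow> 'b cstar" where
  "cstar_image M S f =
    \<lparr> carrier = f ` S,
      mult = (\<lambda>x y. f (inv_into S f x \<otimes>\<^bsub>M\<^esub> inv_into S f y)),
      one = f \<one>\<^bsub>M\<^esub>,
      zero = f \<zero>\<^bsub>M\<^esub>,
      add = (\<lambda>x y. f (inv_into S f x \<oplus>\<^bsub>M\<^esub> inv_into S f y)),
      cscale = (\<lambda>c x. f (cscale M c (inv_into S f x))),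
      cadj = (\<lambda>x. f (cadj M (inv_into S f x))),
      cnorm = (\<lambda>x. cnorm M (inv_into S f x)) \<rparr>"

lemma cstar_image_simps:
  assumes "inj_on f S"
  shows "carrier (cstar_image M S f) = f ` S"
    "\<zero>\<^bsub>cstar_image M S f\<^esub> = f \<zero>\<^bsub>M\<^esub>"
    "\<lbrakk>x \<in> S; y \<in> S\<rbrakk> \<Longrightarrow> f x \<otimes>\<^bsub>cstar_image M S f\<^esub> f y = f (x \<otimes>\<^bsub>M\<^esub> y)"
    "\<lbrakk>x \<in> S; y \<in> S\<rbrakk> \<Longrightarrow> f x \<oplus>\<^bsub>cstar_image M S f\<^esub> f y = f (x \<oplus>\<^bsub>M\<^esub> y)"
    "x \<in> S \<Longrightarrow> cscale (cstar_image M S f) c (f x) = f (cscale M c x)"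
    "x \<in> S \<Longrightarrow> cadj (cstar_image M S f) (f x) = f (cadj M x)"
    "x \<in> S \<Longrightarrow> cnorm (cstar_image M S f) (f x) = cnorm M x"
  using assms by (auto simp: cstar_image_def)

context cstar_algebra
begin

lemma subalgebraD:
  assumes "cstar_subalgebra A S"
  shows "linear_subspace A S" "closedin (ctopology A) S" "\<And>x y. x \<in> S \<Longrightarrow> y \<in> S \<Longrightarrow> x \<otimes> y \<in> S"
    "\<And>x. x \<in> S \<Longrightarrow> cadj A x \<in> S"
  using assms by (auto simp: cstar_subalgebra_def)

text \<open>Completeness is the one axiom that is not transported at once: a Cauchy sequence
  converges in \<open>A\<close>, and its limit stays in the closed set \<open>S\<close>.\<close>

lemma cstar_algebra_image:
  assumes S: "cstar_subalgebra A S" and inj: "inj_on f S"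
  shows "cstar_algebra (cstar_image A S f)"
proof -
  let ?N = "cstar_image A S f"
  note simps = cstar_image_simps[OF inj, where M = A]
  note S' = subspaceD[OF subalgebraD(1)[OF S]] and S'' = subalgebraD[OF S]
  have Sc [simp]: "x \<in> carrier A" if "x \<in> S" for x
    using that S' by blast
  note [simp] = S'(2-5) S''(3,4)
  have ag: "abelian_group ?N"
  proof (rule abelian_groupI)
    show "\<exists>y\<in>carrier ?N. y \<oplus>\<^bsub>?N\<^esub> x = \<zero>\<^bsub>?N\<^esub>" if x: "x \<in> carrier ?N" for x
    proof -
      obtain u where u: "u \<in> S" "x = f u"
        using x by (auto simp: simps)
      then have "f (cscale A (-1) u) \<oplus>\<^bsub>?N\<^esub> x = f \<zero>"
        using scale_add_same[of u "-1" 1] by (simp add: simps)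
      then show ?thesis
        using u by (auto simp: simps)
    qed
  qed (auto simp: simps a_ac)
  then interpret N: abelian_group ?N .
  have minus: "\<ominus>\<^bsub>?N\<^esub> f u = f (cscale A (-1) u)" if u: "u \<in> S" for u
    using u scale_add_same[of u "-1" 1] by (intro N.minus_equality) (auto simp: simps)
  have diff: "f u \<ominus>\<^bsub>?N\<^esub> f v = f (u \<ominus> v)" if "u \<in> S" "v \<in> S" for u v
    using that minus by (simp add: N.minus_eq simps diff_as_scale)
  show ?thesis
  proof (rule cstar_algebraI[OF ag])
    show "\<exists>x\<in>carrier ?N. (\<lambda>n. cnorm ?N (h n \<ominus>\<^bsub>?N\<^esub> x)) \<longlonglongrightarrow> 0"
      if h: "\<And>n. h n \<in> carrier ?N" and C: "\<And>e. e > 0 \<Longrightarrow> \<exists>N. \<forall>m\<ge>N. \<forall>n\<ge>N. cnorm ?N (h m \<ominus>\<^bsub>?N\<^esub> h n) < e" for h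
    proof -
      have "\<exists>u. u \<in> S \<and> h n = f u" for n
        using h[of n] by (auto simp: simps)
      then obtain u where u: "\<And>n. u n \<in> S" "\<And>n. h n = f (u n)"
        by metis
      have "\<exists>N. \<forall>m\<ge>N. \<forall>n\<ge>N. cnorm A (u m \<ominus> u n) < e" if "e > 0" for e
        using C[OF that] u by (simp add: diff simps)
      then obtain x where x: "x \<in> carrier A" "(\<lambda>n. cnorm A (u n \<ominus> x)) \<longlonglongrightarrow> 0"
        using Cauchy_converges[of u] u Sc by blast
      have "x \<in> S"
      proof -
        have "\<exists>y\<in>S. cnorm A (x \<ominus> y) < e" if e: "e > 0" for e
        proof -
          obtain n where "cnorm A (u n \<ominus> x) < e"
            using order_tendstoD(2)[OF x(2) e] eventually_happens by force
          then show ?thesis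
            using u x norm_minus_commute[of x "u n"] by (intro bexI[of _ "u n"]) auto
        qed
        then show ?thesis
          using x S''(2) by (simp add: closedin_iff)
      qed
      then show ?thesis
        using x u by (intro bexI[of _ "f x"]) (simp_all add: diff simps)
    qed
    show "cnorm ?N x = 0 \<longleftrightarrow> x = \<zero>\<^bsub>?N\<^esub>" if x: "x \<in> carrier ?N" for x
    proof -
      obtain u where u: "u \<in> S" "x = f u"
        using x by (auto simp: simps)
      then show ?thesis
        by (simp add: simps norm_eq_0 inj_on_eq_iff[OF inj])
    qed
    show "cnorm ?N (\<ominus>\<^bsub>?N\<^esub> x) = cnorm ?N x" if x: "x \<in> carrier ?N" for x
      using x by (auto simp: simps minus norm_scale)
  qed (auto simp: simps mult_assoc distrib_left distrib_right scale_add add_scale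
      scale_mult_left scale_mult_right adj_add adj_scale adj_mult norm_nonneg norm_triangle norm_scale
      norm_mult norm_adj_mult)
qed

end

subsection \<open>Multiplier algebras\<close>

context cstar_algebra
begin

section \<open>Operator norms and double centralisers\<close>

definition opnorm :: "('a \<Rightarrow> 'a) \<Rightarrow> real" where
  "opnorm T = (SUP a\<in>{a \<in> carrier A. cnorm A a \<le> 1}. cnorm A (T a))"

lemma bounded_operatorI:
  assumes "\<And>x. x \<in> carrier A \<Longrightarrow> T x \<in> carrier A"
    and "\<And>x y. \<lbrakk>x \<in> carrier A; y \<in> carrier A\<rbrakk> \<Longrightarrow> T (x \<oplus> y) = T x \<oplus> T y"
    and "\<And>c x. x \<in> carrier A \<Longrightarrow> T (cscale A c x) = cscale A c (T x)"
    and "\<And>x. x \<in> carrier A \<Longrightarrow> cnorm A (T x) \<le> K * cnorm A x"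
  shows "bounded_operator A (\<lambda>x\<in>carrier A. T x)"
proof -
  have "\<exists>K. \<forall>x\<in>carrier A. cnorm A (T x) \<le> K * cnorm A x"
    using assms(4) by blast
  then show ?thesis
    using assms(1-3) by (simp add: bounded_operator_def)
qed

lemma bounded_operatorD:
  assumes "bounded_operator A T"
  shows "x \<in> carrier A \<Longrightarrow> T x \<in> carrier A"
    "\<lbrakk>x \<in> carrier A; y \<in> carrier A\<rbrakk> \<Longrightarrow> T (x \<oplus> y) = T x \<oplus> T y"
    "x \<in> carrier A \<Longrightarrow> T (cscale A c x) = cscale A c (T x)"
    "T \<in> extensional (carrier A)"
  using assms by (auto simp: bounded_operator_def PiE_def Pi_iff)

text \<open>Boundedness of \<open>T\<close> makes the supremum a genuine one; scaling
  \<open>x\<close> to norm one then gives the estimate.\<close>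

lemma opnorm_bound:
  assumes T: "bounded_operator A T" and x: "x \<in> carrier A"
  shows "cnorm A (T x) \<le> opnorm T * cnorm A x"
proof -
  note T' = bounded_operatorD[OF T]
  obtain K where K: "\<And>x. x \<in> carrier A \<Longrightarrow> cnorm A (T x) \<le> K * cnorm A x"
    using T unfolding bounded_operator_def by blast
  have bdd: "bdd_above ((\<lambda>a. cnorm A (T a)) ` {a \<in> carrier A. cnorm A a \<le> 1})"
  proof (rule bdd_aboveI2)
    fix a assume "a \<in> {a \<in> carrier A. cnorm A a \<le> 1}"
    then have a: "a \<in> carrier A" "cnorm A a \<le> 1"
      by auto
    have "K * cnorm A a \<le> \<bar>K\<bar> * 1"
      using a norm_nonneg[OF a(1)] by (intro mult_mono) auto
    then show "cnorm A (T a) \<le> \<bar>K\<bar>"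
      using K[OF a(1)] by simp
  qed
  show ?thesis
  proof (cases "cnorm A x = 0")
    case True
    then show ?thesis
      using K[OF x] by simp
  next
    case False
    let ?c = "complex_of_real (1 / cnorm A x)"
    have pos: "cnorm A x > 0"
      using False norm_nonneg[OF x] by simp
    have c: "cmod ?c = 1 / cnorm A x"
      using pos by (simp only: norm_of_real) simp
    have "cnorm A (T (cscale A ?c x)) \<le> opnorm T"
      unfolding opnorm_def using x pos c by (intro cSUP_upper[OF _ bdd]) (simp add: norm_scale)
    then have "cnorm A (T x) / cnorm A x \<le> opnorm T"
      using x c T'(1)[OF x] by (simp add: T'(3) norm_scale)
    then show ?thesis
      using pos by (simp add: pos_divide_le_eq)
  qed
qed

lemma opnorm_le:
  assumes "\<And>x. x \<in> carrier A \<Longrightarrow> cnorm A (T x) \<le> K * cnorm A x" "K \<ge> 0"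
  shows "opnorm T \<le> K"
  unfolding opnorm_def
proof (rule cSUP_least)
  show "{a \<in> carrier A. cnorm A a \<le> 1} \<noteq> {}"
    by (auto intro: exI[of _ \<zero>])
  fix a assume a: "a \<in> {a \<in> carrier A. cnorm A a \<le> 1}"
  then have "K * cnorm A a \<le> K * 1"
    using assms(2) by (intro mult_left_mono) auto
  then show "cnorm A (T a) \<le> K"
    using assms(1)[of a] a by simp
qed

lemma opnorm_nonneg:
  assumes T: "bounded_operator A T" shows "0 \<le> opnorm T"
proof -
  have "bdd_above ((\<lambda>a. cnorm A (T a)) ` {a \<in> carrier A. cnorm A a \<le> 1})"
  proof (rule bdd_aboveI2)
    fix a assume a: "a \<in> {a \<in> carrier A. cnorm A a \<le> 1}"
    then have "opnorm T * cnorm A a \<le> \<bar>opnorm T\<bar> * 1"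
      using norm_nonneg[of a] by (intro mult_mono) auto
    then show "cnorm A (T a) \<le> \<bar>opnorm T\<bar>"
      using opnorm_bound[OF T, of a] a by simp
  qed
  then have "cnorm A (T \<zero>) \<le> opnorm T"
    unfolding opnorm_def by (intro cSUP_upper) auto
  then show ?thesis
    using norm_nonneg[OF bounded_operatorD(1)[OF T zero_closed]] by simp
qed

abbreviation "MA \<equiv> multiplier_algebra A"

lemma MA_simps:
  "carrier MA = double_centralisers A"
  "a \<in> carrier A \<Longrightarrow> fst (m \<otimes>\<^bsub>MA\<^esub> n) a = fst m (fst n a)"
  "a \<in> carrier A \<Longrightarrow> snd (m \<otimes>\<^bsub>MA\<^esub> n) a = snd n (snd m a)"
  "a \<in> carrier A \<Longrightarrow> fst \<zero>\<^bsub>MA\<^esub> a = \<zero>"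
  "a \<in> carrier A \<Longrightarrow> snd \<zero>\<^bsub>MA\<^esub> a = \<zero>"
  "a \<in> carrier A \<Longrightarrow> fst (m \<oplus>\<^bsub>MA\<^esub> n) a = fst m a \<oplus> fst n a"
  "a \<in> carrier A \<Longrightarrow> snd (m \<oplus>\<^bsub>MA\<^esub> n) a = snd m a \<oplus> snd n a"
  "a \<in> carrier A \<Longrightarrow> fst (cscale MA c m) a = cscale A c (fst m a)"
  "a \<in> carrier A \<Longrightarrow> snd (cscale MA c m) a = cscale A c (snd m a)"
  "a \<in> carrier A \<Longrightarrow> fst (cadj MA m) a = cadj A (snd m (cadj A a))"
  "a \<in> carrier A \<Longrightarrow> snd (cadj MA m) a = cadj A (fst m (cadj A a))"
  "cnorm MA m = opnorm (fst m)"
  by (simp_all add: multiplier_algebra_def opnorm_def)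

lemma centraliserD:
  assumes "m \<in> double_centralisers A"
  shows "bounded_operator A (fst m)" "bounded_operator A (snd m)"
    "\<lbrakk>a \<in> carrier A; b \<in> carrier A\<rbrakk> \<Longrightarrow> fst m (a \<otimes> b) = fst m a \<otimes> b"
    "\<lbrakk>a \<in> carrier A; b \<in> carrier A\<rbrakk> \<Longrightarrow> snd m (a \<otimes> b) = a \<otimes> snd m b"
    "\<lbrakk>a \<in> carrier A; b \<in> carrier A\<rbrakk> \<Longrightarrow> snd m a \<otimes> b = a \<otimes> fst m b"
  using assms by (auto simp: double_centralisers_def split_beta)

lemma centraliser_ops:
  assumes "m \<in> double_centralisers A"
  shows "a \<in> carrier A \<Longrightarrow> fst m a \<in> carrier A" "a \<in> carrier A \<Longrightarrow> snd m a \<in> carrier A"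
    "\<lbrakk>x \<in> carrier A; y \<in> carrier A\<rbrakk> \<Longrightarrow> fst m (x \<oplus> y) = fst m x \<oplus> fst m y"
    "\<lbrakk>x \<in> carrier A; y \<in> carrier A\<rbrakk> \<Longrightarrow> snd m (x \<oplus> y) = snd m x \<oplus> snd m y"
    "x \<in> carrier A \<Longrightarrow> fst m (cscale A c x) = cscale A c (fst m x)"
    "x \<in> carrier A \<Longrightarrow> snd m (cscale A c x) = cscale A c (snd m x)"
  using bounded_operatorD[OF centraliserD(1)[OF assms]] bounded_operatorD[OF centraliserD(2)[OF assms]]
  by auto

text \<open>Multipliers are pairs of functions extensional on the carrier, so the identities of the
  multiplier algebra can be checked at each element.\<close>

lemma centraliser_eqI:
  assumes "m \<in> double_centralisers A" "n \<in> double_centralisers A"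
    and "\<And>a. a \<in> carrier A \<Longrightarrow> fst m a = fst n a" "\<And>a. a \<in> carrier A \<Longrightarrow> snd m a = snd n a"
  shows "m = n"
proof (rule prod_eqI)
  show "fst m = fst n"
    using assms bounded_operatorD(4)[OF centraliserD(1)] by (intro extensionalityI[of _ "carrier A"]) auto
  show "snd m = snd n"
    using assms bounded_operatorD(4)[OF centraliserD(2)] by (intro extensionalityI[of _ "carrier A"]) auto
qed

text \<open>\<open>\<parallel>R a\<parallel>\<^sup>2 = \<parallel>(R a) (R a)\<^sup>*\<parallel> = \<parallel>a L ((R a)\<^sup>*)\<parallel>\<close>.\<close>

lemma centraliser_snd_bound:
  assumes m: "m \<in> double_centralisers A" and a: "a \<in> carrier A"
  shows "cnorm A (snd m a) \<le> opnorm (fst m) * cnorm A a"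
proof -
  let ?y = "snd m a"
  have y: "?y \<in> carrier A"
    using centraliser_ops[OF m] a by auto
  have "(cnorm A ?y)\<^sup>2 = cnorm A (?y \<otimes> cadj A ?y)"
    using norm_adj_mult[of "cadj A ?y"] y by simp
  also have "\<dots> = cnorm A (a \<otimes> fst m (cadj A ?y))"
    using centraliserD(5)[OF m, of a "cadj A ?y"] a y by simp
  also have "\<dots> \<le> cnorm A a * cnorm A (fst m (cadj A ?y))"
    using a y centraliser_ops[OF m] by (intro norm_mult) auto
  also have "\<dots> \<le> cnorm A a * (opnorm (fst m) * cnorm A ?y)"
    using opnorm_bound[OF centraliserD(1)[OF m], of "cadj A ?y"] y a norm_nonneg
    by (intro mult_left_mono) auto
  finally have "cnorm A ?y * cnorm A ?y \<le> (opnorm (fst m) * cnorm A a) * cnorm A ?y"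
    by (simp add: power2_eq_square ac_simps)
  then show ?thesis
    using norm_nonneg[OF y] opnorm_nonneg[OF centraliserD(1)[OF m]] norm_nonneg[OF a]
    by (cases "cnorm A ?y = 0") (auto simp: mult_le_cancel_right)
qed

lemma centraliserI:
  assumes L: "\<And>x. x \<in> carrier A \<Longrightarrow> L x \<in> carrier A"
    "\<And>x y. \<lbrakk>x \<in> carrier A; y \<in> carrier A\<rbrakk> \<Longrightarrow> L (x \<oplus> y) = L x \<oplus> L y"
    "\<And>c x. x \<in> carrier A \<Longrightarrow> L (cscale A c x) = cscale A c (L x)"
    "\<And>x. x \<in> carrier A \<Longrightarrow> cnorm A (L x) \<le> K * cnorm A x"
  and R: "\<And>x. x \<in> carrier A \<Longrightarrow> R x \<in> carrier A"
    "\<And>x y. \<lbrakk>x \<in> carrier A; y \<in> carrier A\<rbrakk> \<Longrightarrow> R (x \<oplus> y) = R x \<oplus> R y"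
    "\<And>c x. x \<in> carrier A \<Longrightarrow> R (cscale A c x) = cscale A c (R x)"
    "\<And>x. x \<in> carrier A \<Longrightarrow> cnorm A (R x) \<le> K' * cnorm A x"
  and "\<And>a b. \<lbrakk>a \<in> carrier A; b \<in> carrier A\<rbrakk> \<Longrightarrow> L (a \<otimes> b) = L a \<otimes> b"
    "\<And>a b. \<lbrakk>a \<in> carrier A; b \<in> carrier A\<rbrakk> \<Longrightarrow> R (a \<otimes> b) = a \<otimes> R b"
    "\<And>a b. \<lbrakk>a \<in> carrier A; b \<in> carrier A\<rbrakk> \<Longrightarrow> R a \<otimes> b = a \<otimes> L b"
  shows "(\<lambda>a\<in>carrier A. L a, \<lambda>a\<in>carrier A. R a) \<in> double_centralisers A"
proof -
  have "bounded_operator A (\<lambda>a\<in>carrier A. L a)"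
    by (rule bounded_operatorI[where K = K, OF L])
  moreover have "bounded_operator A (\<lambda>a\<in>carrier A. R a)"
    by (rule bounded_operatorI[where K = K', OF R])
  ultimately show ?thesis
    using assms(9-11) by (simp add: double_centralisers_def)
qed

lemma centraliser_zero: "\<zero>\<^bsub>MA\<^esub> \<in> double_centralisers A"
  unfolding multiplier_algebra_def by simp (rule centraliserI[where K = 0 and K' = 0], auto)

lemma centraliser_add:
  assumes m: "m \<in> double_centralisers A" and n: "n \<in> double_centralisers A"
  shows "m \<oplus>\<^bsub>MA\<^esub> n \<in> double_centralisers A"
    and "opnorm (fst (m \<oplus>\<^bsub>MA\<^esub> n)) \<le> opnorm (fst m) + opnorm (fst n)"
proof -
  note ops [simp] = centraliser_ops[OF m] centraliser_ops[OF n]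
  have le: "cnorm A (fst m x \<oplus> fst n x) \<le> (opnorm (fst m) + opnorm (fst n)) * cnorm A x" if x: "x \<in> carrier A" for x
    using norm_triangle[of "fst m x" "fst n x"] opnorm_bound[OF centraliserD(1)[OF m] x]
      opnorm_bound[OF centraliserD(1)[OF n] x] x by (simp add: distrib_right) (simp add: algebra_simps)
  have le': "cnorm A (snd m x \<oplus> snd n x) \<le> (opnorm (fst m) + opnorm (fst n)) * cnorm A x" if x: "x \<in> carrier A" for x
    using norm_triangle[of "snd m x" "snd n x"] centraliser_snd_bound[OF m x]
      centraliser_snd_bound[OF n x] x by (simp add: distrib_right) (simp add: algebra_simps)
  show "m \<oplus>\<^bsub>MA\<^esub> n \<in> double_centralisers A"
    unfolding multiplier_algebra_def
    by simp (rule centraliserI[OF _ _ _ le _ _ _ le'],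
      auto simp: scale_add centraliserD[OF m] centraliserD[OF n] distrib_left distrib_right a_ac)
  show "opnorm (fst (m \<oplus>\<^bsub>MA\<^esub> n)) \<le> opnorm (fst m) + opnorm (fst n)"
    using le opnorm_nonneg[OF centraliserD(1)[OF m]] opnorm_nonneg[OF centraliserD(1)[OF n]]
    by (intro opnorm_le) (auto simp: MA_simps)
qed

lemma centraliser_scale_bound:
  assumes m: "m \<in> double_centralisers A" and x: "x \<in> carrier A"
  shows "cnorm A (cscale A c (fst m x)) \<le> (cmod c * opnorm (fst m)) * cnorm A x"
    and "cnorm A (cscale A c (snd m x)) \<le> (cmod c * opnorm (fst m)) * cnorm A x"
  using mult_left_mono[OF opnorm_bound[OF centraliserD(1)[OF m] x], of "cmod c"]
    mult_left_mono[OF centraliser_snd_bound[OF m x], of "cmod c"] x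
  by (simp_all add: norm_scale centraliser_ops[OF m] mult.assoc)

lemma centraliser_scale:
  assumes m: "m \<in> double_centralisers A" shows "cscale MA c m \<in> double_centralisers A"
  unfolding multiplier_algebra_def
  by simp (rule centraliserI[OF _ _ _ centraliser_scale_bound(1)[OF m] _ _ _ centraliser_scale_bound(2)[OF m]],
    auto simp: centraliser_ops[OF m] scale_add centraliserD[OF m] scale_mult_left scale_mult_right mult.commute)

text \<open>The upper bound for \<open>1 / c\<close>, applied to the scaled multiplier, is the lower
  bound for \<open>c\<close>.\<close>

lemma centraliser_norm_scale:
  assumes m: "m \<in> double_centralisers A"
  shows "opnorm (fst (cscale MA c m)) = cmod c * opnorm (fst m)"
proof -
  have ub: "opnorm (fst (cscale MA c m)) \<le> cmod c * opnorm (fst m)" if m: "m \<in> double_centralisers A" for c m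
    using centraliser_scale_bound(1)[OF m] opnorm_nonneg[OF centraliserD(1)[OF m]]
    by (intro opnorm_le) (auto simp: MA_simps)
  show "opnorm (fst (cscale MA c m)) = cmod c * opnorm (fst m)"
  proof (cases "c = 0")
    case True
    then show ?thesis
      using ub[OF m, of c] opnorm_nonneg[OF centraliserD(1)[OF centraliser_scale[OF m, of c]]] by simp
  next
    case False
    have "cscale MA (1 / c) (cscale MA c m) = m"
      using False m
      by (intro centraliser_eqI centraliser_scale) (simp_all add: MA_simps centraliser_ops[OF m])
    then have "opnorm (fst m) \<le> cmod (1 / c) * opnorm (fst (cscale MA c m))"
      using ub[OF centraliser_scale[OF m], of "1 / c" c] by simp
    then have "cmod c * opnorm (fst m) \<le> opnorm (fst (cscale MA c m))"
      using False by (simp add: norm_divide field_simps)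
    then show ?thesis
      using ub[OF m, of c] by simp
  qed
qed

lemma centraliser_adj:
  assumes m: "m \<in> double_centralisers A"
  shows "cadj MA m \<in> double_centralisers A" and "opnorm (fst (cadj MA m)) \<le> opnorm (fst m)"
proof -
  note ops [simp] = centraliser_ops[OF m]
  have le: "cnorm A (cadj A (snd m (cadj A x))) \<le> opnorm (fst m) * cnorm A x" if x: "x \<in> carrier A" for x
    using centraliser_snd_bound[OF m, of "cadj A x"] x by simp
  have le': "cnorm A (cadj A (fst m (cadj A x))) \<le> opnorm (fst m) * cnorm A x" if x: "x \<in> carrier A" for x
    using opnorm_bound[OF centraliserD(1)[OF m], of "cadj A x"] x by simp
  have mid: "cadj A (fst m (cadj A a)) \<otimes> b = a \<otimes> cadj A (snd m (cadj A b))"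
    if a: "a \<in> carrier A" and b: "b \<in> carrier A" for a b
    using arg_cong[OF centraliserD(5)[OF m, of "cadj A b" "cadj A a"], of "cadj A"] a b by (simp add: adj_mult)
  show "cadj MA m \<in> double_centralisers A"
    unfolding multiplier_algebra_def
    by simp (rule centraliserI[OF _ _ _ le _ _ _ le'],
      auto simp: adj_add adj_scale adj_mult centraliserD[OF m] mid)
  show "opnorm (fst (cadj MA m)) \<le> opnorm (fst m)"
    using le opnorm_nonneg[OF centraliserD(1)[OF m]] by (intro opnorm_le) (auto simp: MA_simps)
qed

lemma centraliser_mult:
  assumes m: "m \<in> double_centralisers A" and n: "n \<in> double_centralisers A"
  shows "m \<otimes>\<^bsub>MA\<^esub> n \<in> double_centralisers A"
    and "opnorm (fst (m \<otimes>\<^bsub>MA\<^esub> n)) \<le> opnorm (fst m) * opnorm (fst n)"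
proof -
  note ops [simp] = centraliser_ops[OF m] centraliser_ops[OF n]
  note nn = opnorm_nonneg[OF centraliserD(1)[OF m]] opnorm_nonneg[OF centraliserD(1)[OF n]]
  have le: "cnorm A (fst m (fst n x)) \<le> (opnorm (fst m) * opnorm (fst n)) * cnorm A x" if x: "x \<in> carrier A" for x
    using opnorm_bound[OF centraliserD(1)[OF m], of "fst n x"] x
      mult_left_mono[OF opnorm_bound[OF centraliserD(1)[OF n] x] nn(1)] by (simp add: mult.assoc)
  have le': "cnorm A (snd n (snd m x)) \<le> (opnorm (fst n) * opnorm (fst m)) * cnorm A x" if x: "x \<in> carrier A" for x
    using centraliser_snd_bound[OF n, of "snd m x"] x
      mult_left_mono[OF centraliser_snd_bound[OF m x] nn(2)] by (simp add: mult.assoc)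
  show "m \<otimes>\<^bsub>MA\<^esub> n \<in> double_centralisers A"
    unfolding multiplier_algebra_def
    by simp (rule centraliserI[OF _ _ _ le _ _ _ le'], auto simp: centraliserD[OF m] centraliserD[OF n])
  show "opnorm (fst (m \<otimes>\<^bsub>MA\<^esub> n)) \<le> opnorm (fst m) * opnorm (fst n)"
    using le nn by (intro opnorm_le) (auto simp: MA_simps)
qed

text \<open>With \<open>y = m x\<close>, the exchange of left and right action turns
  \<open>y\<^sup>* y\<close> into the adjoint of \<open>(m\<^sup>* m) x\<close> times
  \<open>x\<close>; hence \<open>\<parallel>m x\<parallel>\<^sup>2 \<le> \<parallel>m\<^sup>*
  m\<parallel> \<parallel>x\<parallel>\<^sup>2\<close>.\<close>

lemma centraliser_norm_adj_mult:
  assumes m: "m \<in> double_centralisers A"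
  shows "opnorm (fst (cadj MA m \<otimes>\<^bsub>MA\<^esub> m)) = (opnorm (fst m))\<^sup>2"
proof (rule antisym)
  note nn = opnorm_nonneg[OF centraliserD(1)[OF m]]
  note adj = centraliser_adj[OF m] and prod = centraliser_mult[OF centraliser_adj(1)[OF m] m]
  have "opnorm (fst (cadj MA m)) * opnorm (fst m) \<le> opnorm (fst m) * opnorm (fst m)"
    using adj nn by (intro mult_right_mono)
  then show "opnorm (fst (cadj MA m \<otimes>\<^bsub>MA\<^esub> m)) \<le> (opnorm (fst m))\<^sup>2"
    using prod(2) by (simp add: power2_eq_square)
  let ?N = "opnorm (fst (cadj MA m \<otimes>\<^bsub>MA\<^esub> m))"
  have nN: "0 \<le> ?N"
    using opnorm_nonneg[OF centraliserD(1)[OF prod(1)]] .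
  have "cnorm A (fst m x) \<le> sqrt ?N * cnorm A x" if x: "x \<in> carrier A" for x
  proof -
    let ?y = "fst m x"
    have y: "?y \<in> carrier A"
      using x by (rule centraliser_ops(1)[OF m])
    have "(cnorm A ?y)\<^sup>2 = cnorm A (snd m (cadj A ?y) \<otimes> x)"
      using norm_adj_mult[OF y] centraliserD(5)[OF m, of "cadj A ?y" x] x y by simp
    also have "\<dots> \<le> cnorm A (snd m (cadj A ?y)) * cnorm A x"
      by (rule norm_mult) (simp_all add: x y centraliser_ops[OF m])
    also have "cnorm A (snd m (cadj A ?y)) = cnorm A (fst (cadj MA m \<otimes>\<^bsub>MA\<^esub> m) x)"
      using x y centraliser_ops(2)[OF m, of "cadj A ?y"] by (simp add: MA_simps(2,10))
    also have "\<dots> * cnorm A x \<le> (?N * cnorm A x) * cnorm A x"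
      by (intro mult_right_mono opnorm_bound[OF centraliserD(1)[OF prod(1)] x] norm_nonneg[OF x])
    also have "\<dots> = (sqrt ?N * cnorm A x)\<^sup>2"
      using nN by (simp add: power_mult_distrib power2_eq_square[of "cnorm A x"])
    finally have "(cnorm A ?y)\<^sup>2 \<le> (sqrt ?N * cnorm A x)\<^sup>2" .
    then show ?thesis
      by (rule power2_le_imp_le) (simp add: nN norm_nonneg[OF x])
  qed
  then have "opnorm (fst m) \<le> sqrt ?N"
    using nN by (intro opnorm_le) auto
  then show "(opnorm (fst m))\<^sup>2 \<le> ?N"
    using power_mono[of "opnorm (fst m)" "sqrt ?N" 2] nN nn by simp
qed

section \<open>The multiplier algebra as a C*-algebra\<close>

lemma MA_abelian_group: "abelian_group MA"
proof (rule abelian_groupI)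
  show "\<exists>y\<in>carrier MA. y \<oplus>\<^bsub>MA\<^esub> x = \<zero>\<^bsub>MA\<^esub>" if x: "x \<in> carrier MA" for x
  proof (rule bexI)
    have xd: "x \<in> double_centralisers A"
      using x by (simp add: MA_simps)
    show "cscale MA (-1) x \<in> carrier MA"
      using centraliser_scale[OF xd] by (simp add: MA_simps)
    show "cscale MA (-1) x \<oplus>\<^bsub>MA\<^esub> x = \<zero>\<^bsub>MA\<^esub>"
      using xd scale_add_same[of _ "-1" 1]
      by (intro centraliser_eqI centraliser_add centraliser_scale centraliser_zero)
        (simp_all add: MA_simps centraliser_ops[OF xd])
  qed
  show "x \<oplus>\<^bsub>MA\<^esub> y \<in> carrier MA" if "x \<in> carrier MA" "y \<in> carrier MA" for x y
    using that centraliser_add(1) by (simp add: MA_simps(1))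
  show "\<zero>\<^bsub>MA\<^esub> \<in> carrier MA"
    using centraliser_zero by (simp add: MA_simps(1))
  show "(x \<oplus>\<^bsub>MA\<^esub> y) \<oplus>\<^bsub>MA\<^esub> z = x \<oplus>\<^bsub>MA\<^esub> (y \<oplus>\<^bsub>MA\<^esub> z)"
    if "x \<in> carrier MA" "y \<in> carrier MA" "z \<in> carrier MA" for x y z
    using that unfolding MA_simps(1)
    by (intro centraliser_eqI centraliser_add(1)) (simp_all add: MA_simps centraliser_ops a_assoc)
  show "x \<oplus>\<^bsub>MA\<^esub> y = y \<oplus>\<^bsub>MA\<^esub> x" if "x \<in> carrier MA" "y \<in> carrier MA" for x y
    using that unfolding MA_simps(1)
    by (intro centraliser_eqI centraliser_add(1)) (simp_all add: MA_simps centraliser_ops a_comm)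
  show "\<zero>\<^bsub>MA\<^esub> \<oplus>\<^bsub>MA\<^esub> x = x" if "x \<in> carrier MA" for x
    using that unfolding MA_simps(1)
    by (intro centraliser_eqI centraliser_add(1) centraliser_zero) (simp_all add: MA_simps centraliser_ops)
qed

lemma MA_minus:
  assumes "m \<in> carrier MA"
  shows "\<ominus>\<^bsub>MA\<^esub> m = cscale MA (-1) m"
proof -
  interpret M: abelian_group MA
    by (rule MA_abelian_group)
  have m: "m \<in> double_centralisers A"
    using assms by (simp add: MA_simps)
  have "cscale MA (-1) m \<oplus>\<^bsub>MA\<^esub> m = \<zero>\<^bsub>MA\<^esub>"
    using m scale_add_same[of _ "-1" 1]
    by (intro centraliser_eqI centraliser_add centraliser_scale centraliser_zero)
      (simp_all add: MA_simps centraliser_ops[OF m])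
  then show ?thesis
    using assms centraliser_scale[OF m] by (intro M.minus_equality) (auto simp: MA_simps)
qed

lemma MA_diff:
  assumes "m \<in> carrier MA" "n \<in> carrier MA" "a \<in> carrier A"
  shows "fst (m \<ominus>\<^bsub>MA\<^esub> n) a = fst m a \<ominus> fst n a" "snd (m \<ominus>\<^bsub>MA\<^esub> n) a = snd m a \<ominus> snd n a"
  using assms centraliser_ops[of n] by (simp_all add: a_minus_def[of MA] MA_minus MA_simps diff_as_scale)

text \<open>The limit is taken pointwise for the left and the right action, since both are Cauchy at
  each element. The algebraic relations pass to the limit, and a bounded tail makes it bounded.
  Letting only the second index of the Cauchy condition tend to infinity gives convergence in
  norm.\<close>

lemma MA_Cauchy_converges:
  assumes f: "\<And>n. f n \<in> carrier MA"
    and C: "\<And>e. e > 0 \<Longrightarrow> \<exists>N. \<forall>m\<ge>N. \<forall>n\<ge>N. cnorm MA (f m \<ominus>\<^bsub>MA\<^esub> f n) < e"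
  shows "\<exists>x\<in>carrier MA. (\<lambda>n. cnorm MA (f n \<ominus>\<^bsub>MA\<^esub> x)) \<longlonglongrightarrow> 0"
proof -
  interpret M: abelian_group MA
    by (rule MA_abelian_group)
  have fd: "f n \<in> double_centralisers A" for n
    using f by (simp add: MA_simps(1))
  note ops [simp] = centraliser_ops[OF fd]
  have dd: "f m \<ominus>\<^bsub>MA\<^esub> f n \<in> double_centralisers A" for m n
    using M.minus_closed[OF f f] by (simp add: MA_simps(1))
  have bd: "cnorm A (fst (f m) a \<ominus> fst (f n) a) \<le> cnorm MA (f m \<ominus>\<^bsub>MA\<^esub> f n) * cnorm A a"
    "cnorm A (snd (f m) a \<ominus> snd (f n) a) \<le> cnorm MA (f m \<ominus>\<^bsub>MA\<^esub> f n) * cnorm A a"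
    if a: "a \<in> carrier A" for m n a
    using opnorm_bound[OF centraliserD(1)[OF dd[of m n]] a] centraliser_snd_bound[OF dd[of m n] a] a
    by (simp_all add: MA_diff[OF f f a] MA_simps(12))
  have conv: "\<exists>l. clim h l"
    if a: "a \<in> carrier A" and h: "\<And>n. h n \<in> carrier A"
      and le: "\<And>m n. cnorm A (h m \<ominus> h n) \<le> cnorm MA (f m \<ominus>\<^bsub>MA\<^esub> f n) * cnorm A a" for h a
  proof -
    have "\<exists>N. \<forall>m\<ge>N. \<forall>n\<ge>N. cnorm A (h m \<ominus> h n) < e" if "e > 0" for e
    proof -
      \<comment> \<open>Adding 1 keeps the divisor positive when \<open>a\<close> is zero.\<close>
      have pos: "cnorm A a + 1 > 0"
        using norm_nonneg[OF a] by simp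
      then obtain N where N: "\<forall>m\<ge>N. \<forall>n\<ge>N. cnorm MA (f m \<ominus>\<^bsub>MA\<^esub> f n) < e / (cnorm A a + 1)"
        using C[of "e / (cnorm A a + 1)"] \<open>e > 0\<close> by auto
      have "cnorm A (h m \<ominus> h n) < e" if "m \<ge> N" "n \<ge> N" for m n
      proof -
        have "cnorm A (h m \<ominus> h n) \<le> e / (cnorm A a + 1) * cnorm A a"
          using le[of m n] N that mult_right_mono[OF less_imp_le norm_nonneg[OF a]] order_trans by blast
        also have "\<dots> < e"
          using \<open>e > 0\<close> pos by (simp add: field_simps)
        finally show ?thesis .
      qed
      then show ?thesis
        by blast
    qed
    then show ?thesis
      using Cauchy_converges[of h] h unfolding clim_def by metis
  qed
  have "\<forall>a\<in>carrier A. \<exists>l. clim (\<lambda>n. fst (f n) a) l"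
    using conv[OF _ _ bd(1)] by simp
  then obtain L where L: "\<And>a. a \<in> carrier A \<Longrightarrow> clim (\<lambda>n. fst (f n) a) (L a)"
    by metis
  have "\<forall>a\<in>carrier A. \<exists>l. clim (\<lambda>n. snd (f n) a) l"
    using conv[OF _ _ bd(2)] by simp
  then obtain R where R: "\<And>a. a \<in> carrier A \<Longrightarrow> clim (\<lambda>n. snd (f n) a) (R a)"
    by metis
  \<comment> \<open>Cauchy sequences are bounded: from \<open>N\<close> on the norms are at most
    that of \<open>f N\<close> plus 1.\<close>
  obtain N where N: "\<And>n. n \<ge> N \<Longrightarrow> cnorm MA (f n \<ominus>\<^bsub>MA\<^esub> f N) < 1"
    using C[of 1] by auto
  define K where "K = opnorm (fst (f N)) + 1"
  have K: "cnorm A (fst (f n) a) \<le> K * cnorm A a" "cnorm A (snd (f n) a) \<le> K * cnorm A a"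
    if n: "n \<ge> N" and a: "a \<in> carrier A" for n a
  proof -
    have "opnorm (fst (f n)) \<le> K"
    proof -
      have "f n = f N \<oplus>\<^bsub>MA\<^esub> (f n \<ominus>\<^bsub>MA\<^esub> f N)"
        using f[of n] f[of N] M.a_lcomm[of "f N" "f n" "\<ominus>\<^bsub>MA\<^esub> f N"] by (simp add: M.minus_eq M.r_neg)
      then have "opnorm (fst (f n)) \<le> opnorm (fst (f N)) + opnorm (fst (f n \<ominus>\<^bsub>MA\<^esub> f N))"
        using centraliser_add(2)[OF fd dd, of N n N] by simp
      then show ?thesis
        using N[OF n] by (simp add: K_def MA_simps(12))
    qed
    then have "opnorm (fst (f n)) * cnorm A a \<le> K * cnorm A a"
      using norm_nonneg[OF a] by (rule mult_right_mono)
    then show "cnorm A (fst (f n) a) \<le> K * cnorm A a" "cnorm A (snd (f n) a) \<le> K * cnorm A a"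
      using opnorm_bound[OF centraliserD(1)[OF fd] a, of n] centraliser_snd_bound[OF fd a, of n] by linarith+
  qed
  define x where "x = (\<lambda>a\<in>carrier A. L a, \<lambda>a\<in>carrier A. R a)"
  have xd: "x \<in> double_centralisers A"
    unfolding x_def
  proof (rule centraliserI[where K = K and K' = K])
    fix a b c assume a: "a \<in> carrier A"
    show "L a \<in> carrier A" "R a \<in> carrier A"
      using climD(2)[OF L[OF a]] climD(2)[OF R[OF a]] .
    show "cnorm A (L a) \<le> K * cnorm A a" "cnorm A (R a) \<le> K * cnorm A a"
      using clim_norm_le[OF L[OF a], of N] clim_norm_le[OF R[OF a], of N] K a by simp_all
    show "L (cscale A c a) = cscale A c (L a)"
      using clim_scale[OF L[OF a], of c] L[of "cscale A c a"] a by (simp add: clim_unique)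
    show "R (cscale A c a) = cscale A c (R a)"
      using clim_scale[OF R[OF a], of c] R[of "cscale A c a"] a by (simp add: clim_unique)
    assume b: "b \<in> carrier A"
    show "L (a \<oplus> b) = L a \<oplus> L b"
      using clim_add[OF L[OF a] L[OF b]] L[of "a \<oplus> b"] a b by (simp add: clim_unique)
    show "R (a \<oplus> b) = R a \<oplus> R b"
      using clim_add[OF R[OF a] R[OF b]] R[of "a \<oplus> b"] a b by (simp add: clim_unique)
    show "L (a \<otimes> b) = L a \<otimes> b"
      using clim_mult_right[OF L[OF a] b] L[of "a \<otimes> b"] a b by (simp add: clim_unique centraliserD[OF fd])
    show "R (a \<otimes> b) = a \<otimes> R b"
      using clim_mult_left[OF R[OF b] a] R[of "a \<otimes> b"] a b by (simp add: clim_unique centraliserD[OF fd])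
    show "R a \<otimes> b = a \<otimes> L b"
      using clim_mult_left[OF L[OF b] a] clim_mult_right[OF R[OF a] b] a b
      by (simp add: clim_unique centraliserD[OF fd])
  qed
  have xc: "x \<in> carrier MA"
    using xd by (simp add: MA_simps(1))
  have "(\<lambda>n. cnorm MA (f n \<ominus>\<^bsub>MA\<^esub> x)) \<longlonglongrightarrow> 0"
  proof (rule LIMSEQ_I)
    fix e :: real assume "e > 0"
    then obtain N where N: "\<forall>m\<ge>N. \<forall>n\<ge>N. cnorm MA (f m \<ominus>\<^bsub>MA\<^esub> f n) < e / 2"
      using C[of "e / 2"] by auto
    have "norm (cnorm MA (f n \<ominus>\<^bsub>MA\<^esub> x) - 0) < e" if n: "n \<ge> N" for n
    proof -
      have "f n \<ominus>\<^bsub>MA\<^esub> x \<in> double_centralisers A"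
        using M.minus_closed[OF f xc] by (simp add: MA_simps(1))
      then have nn: "0 \<le> cnorm MA (f n \<ominus>\<^bsub>MA\<^esub> x)"
        using opnorm_nonneg[OF centraliserD(1)] by (simp add: MA_simps(12))
      have "cnorm MA (f n \<ominus>\<^bsub>MA\<^esub> x) \<le> e / 2"
        unfolding MA_simps(12)
      proof (rule opnorm_le)
        fix a assume a: "a \<in> carrier A"
        have "cnorm A (fst (f n) a \<ominus> L a) \<le> e / 2 * cnorm A a"
        proof (rule clim_norm_diff_le[OF L[OF a], where N = N])
          fix k assume "k \<ge> N"
          then have "cnorm MA (f n \<ominus>\<^bsub>MA\<^esub> f k) \<le> e / 2"
            using N n by (simp add: less_imp_le)
          then show "cnorm A (fst (f n) a \<ominus> fst (f k) a) \<le> e / 2 * cnorm A a"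
            using bd(1)[OF a, of n k] mult_right_mono[OF _ norm_nonneg[OF a]] order_trans by blast
        qed (simp add: a)
        then show "cnorm A (fst (f n \<ominus>\<^bsub>MA\<^esub> x) a) \<le> e / 2 * cnorm A a"
          using a by (simp add: MA_diff[OF f xc a]) (simp add: x_def)
      qed (use \<open>e > 0\<close> in simp)
      then show ?thesis
        using nn \<open>e > 0\<close> by simp
    qed
    then show "\<exists>N. \<forall>n\<ge>N. norm (cnorm MA (f n \<ominus>\<^bsub>MA\<^esub> x) - 0) < e"
      by blast
  qed
  then show ?thesis
    using xc by blast
qed

theorem cstar_algebra_multiplier: "cstar_algebra MA"
proof (rule cstar_algebraI[OF MA_abelian_group])
  interpret M: abelian_group MA
    by (rule MA_abelian_group)
  note closed = centraliser_mult(1) centraliser_add(1) centraliser_scale centraliser_adj(1) centraliser_zero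
  note eqs = MA_simps centraliser_ops distrib_left distrib_right scale_add add_scale adj_add adj_scale a_assoc mult_assoc
  fix x y z b c
  show "cscale MA c x \<in> carrier MA" if "x \<in> carrier MA"
    using that centraliser_scale by (simp add: MA_simps(1))
  show "cadj MA x \<in> carrier MA" if "x \<in> carrier MA"
    using that centraliser_adj by (simp add: MA_simps(1))
  show "x \<otimes>\<^bsub>MA\<^esub> y \<in> carrier MA" if "x \<in> carrier MA" "y \<in> carrier MA"
    using that centraliser_mult by (simp add: MA_simps(1))
  show "(x \<otimes>\<^bsub>MA\<^esub> y) \<otimes>\<^bsub>MA\<^esub> z = x \<otimes>\<^bsub>MA\<^esub> (y \<otimes>\<^bsub>MA\<^esub> z)" "(x \<oplus>\<^bsub>MA\<^esub> y) \<otimes>\<^bsub>MA\<^esub> z = x \<otimes>\<^bsub>MA\<^esub> z \<oplus>\<^bsub>MA\<^esub> y \<otimes>\<^bsub>MA\<^esub> z"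
    "z \<otimes>\<^bsub>MA\<^esub> (x \<oplus>\<^bsub>MA\<^esub> y) = z \<otimes>\<^bsub>MA\<^esub> x \<oplus>\<^bsub>MA\<^esub> z \<otimes>\<^bsub>MA\<^esub> y"
    if "x \<in> carrier MA" "y \<in> carrier MA" "z \<in> carrier MA"
    using that unfolding MA_simps(1) by - (intro centraliser_eqI closed; simp_all add: eqs)+
  show "cscale MA c (x \<oplus>\<^bsub>MA\<^esub> y) = cscale MA c x \<oplus>\<^bsub>MA\<^esub> cscale MA c y"
    "cscale MA c x \<otimes>\<^bsub>MA\<^esub> y = cscale MA c (x \<otimes>\<^bsub>MA\<^esub> y)" "x \<otimes>\<^bsub>MA\<^esub> cscale MA c y = cscale MA c (x \<otimes>\<^bsub>MA\<^esub> y)"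
    "cadj MA (x \<oplus>\<^bsub>MA\<^esub> y) = cadj MA x \<oplus>\<^bsub>MA\<^esub> cadj MA y" "cadj MA (x \<otimes>\<^bsub>MA\<^esub> y) = cadj MA y \<otimes>\<^bsub>MA\<^esub> cadj MA x"
    if "x \<in> carrier MA" "y \<in> carrier MA"
    using that unfolding MA_simps(1) by - (intro centraliser_eqI closed; simp_all add: eqs)+
  show "cscale MA (b + c) x = cscale MA b x \<oplus>\<^bsub>MA\<^esub> cscale MA c x" "cscale MA b (cscale MA c x) = cscale MA (b * c) x"
    "cscale MA 1 x = x" "cadj MA (cadj MA x) = x" "cadj MA (cscale MA c x) = cscale MA (cnj c) (cadj MA x)"
    if "x \<in> carrier MA"
    using that unfolding MA_simps(1) by - (intro centraliser_eqI closed; simp_all add: eqs)+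
  show "0 \<le> cnorm MA x" "cnorm MA (cscale MA c x) = cmod c * cnorm MA x"
    "cnorm MA (cadj MA x \<otimes>\<^bsub>MA\<^esub> x) = (cnorm MA x)\<^sup>2" "cnorm MA (\<ominus>\<^bsub>MA\<^esub> x) = cnorm MA x"
    if x: "x \<in> carrier MA"
    using MA_minus[OF x] x opnorm_nonneg[OF centraliserD(1)]
    by (simp_all add: MA_simps(1,12) centraliser_norm_scale centraliser_norm_adj_mult)
  show "cnorm MA (x \<oplus>\<^bsub>MA\<^esub> y) \<le> cnorm MA x + cnorm MA y" "cnorm MA (x \<otimes>\<^bsub>MA\<^esub> y) \<le> cnorm MA x * cnorm MA y"
    if "x \<in> carrier MA" "y \<in> carrier MA"
    using that centraliser_add(2) centraliser_mult(2) by (simp_all add: MA_simps(1,12))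
  show "cnorm MA x = 0 \<longleftrightarrow> x = \<zero>\<^bsub>MA\<^esub>" if "x \<in> carrier MA"
  proof
    have xd: "x \<in> double_centralisers A"
      using that by (simp add: MA_simps(1))
    assume 0: "cnorm MA x = 0"
    show "x = \<zero>\<^bsub>MA\<^esub>"
    proof (rule centraliser_eqI[OF xd centraliser_zero])
      fix a assume a: "a \<in> carrier A"
      have "cnorm A (fst x a) \<le> 0" "cnorm A (snd x a) \<le> 0"
        using opnorm_bound[OF centraliserD(1)[OF xd] a] centraliser_snd_bound[OF xd a] 0
        by (simp_all add: MA_simps(12))
      then have "cnorm A (fst x a) = 0" "cnorm A (snd x a) = 0"
        using norm_nonneg[OF centraliser_ops(1)[OF xd a]] norm_nonneg[OF centraliser_ops(2)[OF xd a]] by simp_all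
      then show "fst x a = fst \<zero>\<^bsub>MA\<^esub> a" "snd x a = snd \<zero>\<^bsub>MA\<^esub> a"
        using a by (simp_all add: MA_simps norm_eq_0 centraliser_ops[OF xd])
    qed
  next
    assume "x = \<zero>\<^bsub>MA\<^esub>"
    then have "opnorm (fst x) \<le> 0"
      by (intro opnorm_le) (simp_all add: MA_simps)
    then show "cnorm MA x = 0"
      using that opnorm_nonneg[OF centraliserD(1)] by (simp add: MA_simps(1,12) antisym)
  qed
qed (rule MA_Cauchy_converges)

section \<open>The embedding of an algebra into its multipliers\<close>

definition embed_multiplier :: "'a \<Rightarrow> ('a \<Rightarrow> 'a) \<times> ('a \<Rightarrow> 'a)" where
  "embed_multiplier a = (\<lambda>x\<in>carrier A. a \<otimes> x, \<lambda>x\<in>carrier A. x \<otimes> a)"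

lemma embed_closed: "a \<in> carrier A \<Longrightarrow> embed_multiplier a \<in> double_centralisers A"
  unfolding embed_multiplier_def
  by (rule centraliserI[where K = "cnorm A a" and K' = "cnorm A a"])
    (auto simp: distrib_left distrib_right scale_mult_left scale_mult_right mult_assoc norm_mult
      intro: norm_mult order_trans[OF norm_mult])

lemma embed_apply:
  "x \<in> carrier A \<Longrightarrow> fst (embed_multiplier a) x = a \<otimes> x"
  "x \<in> carrier A \<Longrightarrow> snd (embed_multiplier a) x = x \<otimes> a"
  by (simp_all add: embed_multiplier_def)

lemma star_hom_embed: "star_hom A MA embed_multiplier"
proof -
  note closed = centraliser_mult(1) centraliser_add(1) centraliser_scale centraliser_adj(1) embed_closed
  note eqs = MA_simps embed_apply distrib_left distrib_right scale_mult_left scale_mult_right adj_mult mult_assoc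
  have "embed_multiplier (x \<oplus> y) = embed_multiplier x \<oplus>\<^bsub>MA\<^esub> embed_multiplier y"
    "embed_multiplier (x \<otimes> y) = embed_multiplier x \<otimes>\<^bsub>MA\<^esub> embed_multiplier y"
    if "x \<in> carrier A" "y \<in> carrier A" for x y
    using that by - (intro centraliser_eqI closed; simp_all add: eqs)+
  moreover have "embed_multiplier (cscale A c x) = cscale MA c (embed_multiplier x)"
    "embed_multiplier (cadj A x) = cadj MA (embed_multiplier x)" if "x \<in> carrier A" for x c
    using that by - (intro centraliser_eqI closed; simp_all add: eqs)+
  ultimately show ?thesis
    by (simp add: star_hom_def MA_simps(1) embed_closed)
qed

text \<open>The lower bound evaluates the multiplier at \<open>a\<^sup>*\<close>, where
  \<open>\<parallel>a a\<^sup>*\<parallel> = \<parallel>a\<parallel>\<^sup>2\<close>.\<close>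

lemma norm_embed:
  assumes a: "a \<in> carrier A" shows "cnorm MA (embed_multiplier a) = cnorm A a"
proof (rule antisym)
  show "cnorm MA (embed_multiplier a) \<le> cnorm A a"
    unfolding MA_simps(12) using a norm_nonneg[OF a] by (intro opnorm_le) (simp_all add: embed_apply norm_mult)
  have "cnorm A (a \<otimes> cadj A a) \<le> cnorm MA (embed_multiplier a) * cnorm A a"
    using opnorm_bound[OF centraliserD(1)[OF embed_closed[OF a]], of "cadj A a"] a
    by (simp add: MA_simps(12) embed_apply)
  then have "cnorm A a * cnorm A a \<le> cnorm MA (embed_multiplier a) * cnorm A a"
    using norm_adj_mult[of "cadj A a"] a by (simp add: power2_eq_square)
  moreover have "0 \<le> cnorm MA (embed_multiplier a)"
    using opnorm_nonneg[OF centraliserD(1)[OF embed_closed[OF a]]] by (simp add: MA_simps(12))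
  ultimately show "cnorm A a \<le> cnorm MA (embed_multiplier a)"
    using norm_nonneg[OF a] by (cases "cnorm A a = 0") (auto simp: mult_le_cancel_right)
qed

end

section \<open>Cuntz--Krieger families\<close>

locale ck_family = higher_rank_graph k \<Lambda> + C: cstar_algebra C
  for k :: nat and \<Lambda> :: "'l kgraph" and C :: "'c cstar" (structure) and s :: "'l \<Rightarrow> 'c" +
  assumes row_finite: "row_finite_no_sources k \<Lambda>" and ck: "cuntz_krieger_family k \<Lambda> C s"
begin

abbreviation E :: "'l \<Rightarrow> 'l \<Rightarrow> 'c" where "E l m \<equiv> s l \<otimes> cadj C (s m)"

lemma s_closed [simp, intro]: "l \<in> kmor \<Lambda> \<Longrightarrow> s l \<in> carrier C"
  using ck by (auto simp: cuntz_krieger_family_def)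

lemma rng_vertex [simp]: "l \<in> kmor \<Lambda> \<Longrightarrow> krng \<Lambda> l \<in> kvertices \<Lambda>"
  by (simp add: kvertices_eq_range)

lemma src_vertex [simp]: "l \<in> kmor \<Lambda> \<Longrightarrow> ksrc \<Lambda> l \<in> kvertices \<Lambda>"
  using rng_vertex[of "ksrc \<Lambda> l"] by (simp add: src_closed rng_src)

lemma vertex_mor [simp]: "v \<in> kvertices \<Lambda> \<Longrightarrow> v \<in> kmor \<Lambda>"
  by (simp add: kvertices_def)

lemma
  shows proj_idem: "v \<in> kvertices \<Lambda> \<Longrightarrow> s v \<otimes> s v = s v"
    and proj_adj: "v \<in> kvertices \<Lambda> \<Longrightarrow> cadj C (s v) = s v"
    and proj_orth: "\<lbrakk>v \<in> kvertices \<Lambda>; w \<in> kvertices \<Lambda>; v \<noteq> w\<rbrakk> \<Longrightarrow> s v \<otimes> s w = \<zero>"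
    and s_comp: "\<lbrakk>l \<in> kmor \<Lambda>; m \<in> kmor \<Lambda>; ksrc \<Lambda> l = krng \<Lambda> m\<rbrakk> \<Longrightarrow> s l \<otimes> s m = s (kcomp \<Lambda> l m)"
    and adj_s_s: "l \<in> kmor \<Lambda> \<Longrightarrow> cadj C (s l) \<otimes> s l = s (ksrc \<Lambda> l)"
    and proj_sum: "\<lbrakk>v \<in> kvertices \<Lambda>; n \<in> degrees k\<rbrakk> \<Longrightarrow> s v = finsum C (\<lambda>l. E l l) (kpaths_to \<Lambda> v n)"
  using ck by (auto simp: cuntz_krieger_family_def)

lemma finite_paths: "\<lbrakk>v \<in> kvertices \<Lambda>; n \<in> degrees k\<rbrakk> \<Longrightarrow> finite (kpaths_to \<Lambda> v n)"
  using row_finite by (simp add: row_finite_no_sources_def)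

lemma pathsD: "l \<in> kpaths_to \<Lambda> v n \<Longrightarrow> l \<in> kmor \<Lambda>" "l \<in> kpaths_to \<Lambda> v n \<Longrightarrow> krng \<Lambda> l = v"
  "l \<in> kpaths_to \<Lambda> v n \<Longrightarrow> kdeg \<Lambda> l = n"
  by (auto simp: kpaths_to_def)

lemma rng_s: "l \<in> kmor \<Lambda> \<Longrightarrow> s (krng \<Lambda> l) \<otimes> s l = s l"
  by (simp add: s_comp rng_closed src_rng comp_id_left)

lemma s_src: "l \<in> kmor \<Lambda> \<Longrightarrow> s l \<otimes> s (ksrc \<Lambda> l) = s l"
  by (simp add: s_comp src_closed rng_src comp_id_right)

lemma src_adj: "l \<in> kmor \<Lambda> \<Longrightarrow> s (ksrc \<Lambda> l) \<otimes> cadj C (s l) = cadj C (s l)"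
  by (metis C.adj_mult proj_adj s_closed s_src src_closed src_vertex)

lemma adj_rng: "l \<in> kmor \<Lambda> \<Longrightarrow> cadj C (s l) \<otimes> s (krng \<Lambda> l) = cadj C (s l)"
  by (metis C.adj_mult proj_adj s_closed rng_s rng_closed rng_vertex)

lemma E_closed [simp, intro]: "\<lbrakk>l \<in> kmor \<Lambda>; m \<in> kmor \<Lambda>\<rbrakk> \<Longrightarrow> E l m \<in> carrier C"
  by simp

lemma E_adj: "\<lbrakk>l \<in> kmor \<Lambda>; m \<in> kmor \<Lambda>\<rbrakk> \<Longrightarrow> cadj C (E l m) = E m l"
  by (simp add: C.adj_mult)

text \<open>The two source projections can be inserted between \<open>s l\<close> and the adjoint of
  \<open>s m\<close>; for different sources they are orthogonal.\<close>

lemma E_eq_zero: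
  assumes "l \<in> kmor \<Lambda>" "m \<in> kmor \<Lambda>" "ksrc \<Lambda> l \<noteq> ksrc \<Lambda> m"
  shows "E l m = \<zero>"
proof -
  have "E l m = (s l \<otimes> s (ksrc \<Lambda> l)) \<otimes> (s (ksrc \<Lambda> m) \<otimes> cadj C (s m))"
    using assms by (simp add: s_src src_adj)
  also have "\<dots> = s l \<otimes> ((s (ksrc \<Lambda> l) \<otimes> s (ksrc \<Lambda> m)) \<otimes> cadj C (s m))"
    using assms by (simp add: C.mult_assoc src_closed)
  finally show ?thesis
    using assms by (simp add: proj_orth)
qed

text \<open>The Cuntz-Krieger relations only say that the range projections of the paths of one
  degree sum to the vertex projection; their mutual orthogonality is a consequence of positivity,
  available as \<open>projections_orthogonal\<close>. For different ranges the vertex projections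
  already separate \<open>l\<close> and \<open>m\<close>.\<close>

lemma adj_s_orth:
  assumes l: "l \<in> kmor \<Lambda>" and m: "m \<in> kmor \<Lambda>" and d: "kdeg \<Lambda> l = kdeg \<Lambda> m" and ne: "l \<noteq> m"
  shows "cadj C (s l) \<otimes> s m = \<zero>"
proof (cases "krng \<Lambda> l = krng \<Lambda> m")
  case False
  have "cadj C (s l) \<otimes> s m = (cadj C (s l) \<otimes> s (krng \<Lambda> l)) \<otimes> (s (krng \<Lambda> m) \<otimes> s m)"
    using l m by (simp add: adj_rng rng_s)
  also have "\<dots> = cadj C (s l) \<otimes> ((s (krng \<Lambda> l) \<otimes> s (krng \<Lambda> m)) \<otimes> s m)"
    using l m by (simp add: C.mult_assoc rng_closed)
  finally show ?thesis
    using l m False by (simp add: proj_orth)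
next
  case True
  let ?F = "kpaths_to \<Lambda> (krng \<Lambda> l) (kdeg \<Lambda> l)"
  have F: "finite ?F" "l \<in> ?F" "m \<in> ?F"
    using l m d True finite_paths[OF rng_vertex[OF l] deg_closed[OF l]] by (auto simp: kpaths_to_def)
  have sum: "finsum C (\<lambda>l. E l l) ?F = s (krng \<Lambda> l)"
    using proj_sum[OF rng_vertex[OF l] deg_closed[OF l]] by simp
  have idem: "E j j \<otimes> E j j = E j j" if j: "j \<in> kmor \<Lambda>" for j
  proof -
    have "E j j \<otimes> E j j = s j \<otimes> ((cadj C (s j) \<otimes> s j) \<otimes> cadj C (s j))"
      using j by (simp add: C.mult_assoc)
    then show ?thesis
      using j by (simp add: adj_s_s src_adj)
  qed
  have "E l l \<otimes> E m m = \<zero>"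
  proof (rule C.projections_orthogonal[of ?F "\<lambda>j. E j j" m l])
    fix j assume j: "j \<in> ?F"
    note j' = pathsD[OF j]
    show "E j j \<in> carrier C" "cadj C (E j j) = E j j" "E j j \<otimes> E j j = E j j"
      using j' idem by (auto simp: E_adj)
    have "s (krng \<Lambda> l) \<otimes> E j j = (s (krng \<Lambda> j) \<otimes> s j) \<otimes> cadj C (s j)"
      using j' l by (simp add: C.mult_assoc rng_closed)
    then show "finsum C (\<lambda>l. E l l) ?F \<otimes> E j j = E j j"
      unfolding sum using rng_s[OF j'(1)] j'(2) by simp
  qed (use F ne in auto)
  \<comment> \<open>The adjoint of \<open>s l\<close> absorbs \<open>E l l\<close> from the right,
    and \<open>s m\<close> absorbs \<open>E m m\<close> from the left.\<close>
  moreover have "cadj C (s l) \<otimes> s m = cadj C (s l) \<otimes> ((E l l \<otimes> E m m) \<otimes> s m)"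
  proof -
    have "cadj C (s l) \<otimes> ((E l l \<otimes> E m m) \<otimes> s m) =
        (cadj C (s l) \<otimes> s l) \<otimes> (cadj C (s l) \<otimes> (s m \<otimes> (cadj C (s m) \<otimes> s m)))"
      using l m by (simp add: C.mult_assoc)
    also have "\<dots> = s (ksrc \<Lambda> l) \<otimes> (cadj C (s l) \<otimes> s m)"
      using l m by (simp add: adj_s_s s_src)
    also have "\<dots> = cadj C (s l) \<otimes> s m"
      using l m by (simp add: C.mult_assoc[symmetric] src_adj src_closed)
    finally show ?thesis ..
  qed
  ultimately show ?thesis
    using l m by simp
qed

text \<open>The source projection is inserted in the middle and replaced by the sum of the
  \<open>E a a\<close> over the paths of degree \<open>n\<close>.\<close>

lemma E_expand:
  assumes l: "l \<in> kmor \<Lambda>" and m: "m \<in> kmor \<Lambda>" and src: "ksrc \<Lambda> l = ksrc \<Lambda> m" and n: "n \<in> degrees k"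
  shows "E l m = finsum C (\<lambda>a. E (kcomp \<Lambda> l a) (kcomp \<Lambda> m a)) (kpaths_to \<Lambda> (ksrc \<Lambda> l) n)"
proof -
  let ?F = "kpaths_to \<Lambda> (ksrc \<Lambda> l) n"
  have F: "finite ?F"
    using finite_paths[OF src_vertex[OF l] n] .
  have c: "(\<lambda>a. E a a) \<in> ?F \<rightarrow> carrier C"
    using pathsD by blast
  have "E l m = s l \<otimes> (s (ksrc \<Lambda> l) \<otimes> cadj C (s m))"
    using l m src by (simp add: src_adj)
  also have "\<dots> = s l \<otimes> (finsum C (\<lambda>a. E a a) ?F \<otimes> cadj C (s m))"
    using proj_sum[OF src_vertex[OF l] n] by simp
  also have "\<dots> = finsum C (\<lambda>a. s l \<otimes> (E a a \<otimes> cadj C (s m))) ?F"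
  proof -
    have "finsum C (\<lambda>a. E a a) ?F \<otimes> cadj C (s m) = finsum C (\<lambda>a. E a a \<otimes> cadj C (s m)) ?F"
      using F c m by (intro C.finsum_mult_right) auto
    moreover have "s l \<otimes> finsum C (\<lambda>a. E a a \<otimes> cadj C (s m)) ?F = finsum C (\<lambda>a. s l \<otimes> (E a a \<otimes> cadj C (s m))) ?F"
      using F l m pathsD(1) by (intro C.finsum_mult_left) auto
    ultimately show ?thesis
      by simp
  qed
  also have "\<dots> = finsum C (\<lambda>a. E (kcomp \<Lambda> l a) (kcomp \<Lambda> m a)) ?F"
  proof (rule C.finsum_cong')
    show "(\<lambda>a. E (kcomp \<Lambda> l a) (kcomp \<Lambda> m a)) \<in> ?F \<rightarrow> carrier C"
      using l m src pathsD(1,2) comp_closed by (intro Pi_I E_closed) auto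
    fix a assume a: "a \<in> ?F"
    note a' = pathsD[OF a]
    have "s (kcomp \<Lambda> l a) = s l \<otimes> s a" "s (kcomp \<Lambda> m a) = s m \<otimes> s a"
      using l m a' src by (simp_all add: s_comp)
    then show "s l \<otimes> (E a a \<otimes> cadj C (s m)) = E (kcomp \<Lambda> l a) (kcomp \<Lambda> m a)"
      using l m a' by (simp add: C.adj_mult C.mult_assoc)
  qed simp
  finally show ?thesis .
qed

text \<open>These are the relations of matrix units, with the proviso that \<open>E l m\<close>
  vanishes for different sources.\<close>

lemma E_mult_same_degree:
  assumes l: "l \<in> kmor \<Lambda>" and m: "m \<in> kmor \<Lambda>" and u: "u \<in> kmor \<Lambda>" and w: "w \<in> kmor \<Lambda>"
    and d: "kdeg \<Lambda> m = kdeg \<Lambda> u"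
  shows "E l m \<otimes> E u w = (if m = u \<and> ksrc \<Lambda> l = ksrc \<Lambda> m then E l w else \<zero>)"
proof -
  have eq: "E l m \<otimes> E u w = s l \<otimes> ((cadj C (s m) \<otimes> s u) \<otimes> cadj C (s w))"
    using assms by (simp add: C.mult_assoc)
  show ?thesis
  proof (cases "m = u")
    case True
    show ?thesis
    proof (cases "ksrc \<Lambda> l = ksrc \<Lambda> m")
      case src: True
      have "E l m \<otimes> E u w = (s l \<otimes> s (ksrc \<Lambda> l)) \<otimes> cadj C (s w)"
        unfolding eq using True src assms by (simp add: adj_s_s C.mult_assoc src_closed)
      then show ?thesis
        using True src s_src[OF l] by simp
    qed (use E_eq_zero assms in simp)
  qed (use adj_s_orth[OF m u d] eq l w in simp)
qed

text \<open>Expanding both factors to the common degree \<open>d(m) \<or> d(u)\<close>.\<close>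

lemma E_mult:
  assumes l: "l \<in> kmor \<Lambda>" and m: "m \<in> kmor \<Lambda>" and u: "u \<in> kmor \<Lambda>" and w: "w \<in> kmor \<Lambda>"
    and S: "linear_subspace C S"
    and mem: "\<And>a b. \<lbrakk>a \<in> kmor \<Lambda>; b \<in> kmor \<Lambda>; ksrc \<Lambda> l = krng \<Lambda> a; ksrc \<Lambda> m = krng \<Lambda> a;
        ksrc \<Lambda> u = krng \<Lambda> b; ksrc \<Lambda> w = krng \<Lambda> b; kcomp \<Lambda> m a = kcomp \<Lambda> u b\<rbrakk>
      \<Longrightarrow> E (kcomp \<Lambda> l a) (kcomp \<Lambda> w b) \<in> S"
  shows "E l m \<otimes> E u w \<in> S"
proof (cases "ksrc \<Lambda> l = ksrc \<Lambda> m \<and> ksrc \<Lambda> u = ksrc \<Lambda> w")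
  case False
  then have "E l m \<otimes> E u w = \<zero>"
    using E_eq_zero assms by auto
  then show ?thesis
    using C.subspaceD(2)[OF S] by simp
next
  case True
  \<comment> \<open>The degrees missing up to the maximum; the subtraction of naturals is exact here
    because of \<open>max\<close>.\<close>
  define n1 where "n1 = (\<lambda>i. max (kdeg \<Lambda> m i) (kdeg \<Lambda> u i) - kdeg \<Lambda> m i)"
  define n2 where "n2 = (\<lambda>i. max (kdeg \<Lambda> m i) (kdeg \<Lambda> u i) - kdeg \<Lambda> u i)"
  have n: "n1 \<in> degrees k" "n2 \<in> degrees k"
    using deg_closed[OF m] deg_closed[OF u] by (auto simp: n1_def n2_def degrees_def)
  let ?F1 = "kpaths_to \<Lambda> (ksrc \<Lambda> l) n1" and ?F2 = "kpaths_to \<Lambda> (ksrc \<Lambda> u) n2"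
  have F: "finite ?F1" "finite ?F2"
    using finite_paths n l u by auto
  have "E (kcomp \<Lambda> l a) (kcomp \<Lambda> m a) \<otimes> E (kcomp \<Lambda> u b) (kcomp \<Lambda> w b) \<in> S"
    if a: "a \<in> ?F1" and b: "b \<in> ?F2" for a b
  proof -
    note a' = pathsD[OF a] and b' = pathsD[OF b]
    have cl: "kcomp \<Lambda> l a \<in> kmor \<Lambda>" "kcomp \<Lambda> m a \<in> kmor \<Lambda>" "kcomp \<Lambda> u b \<in> kmor \<Lambda>" "kcomp \<Lambda> w b \<in> kmor \<Lambda>"
      using a' b' assms(1-4) True by (auto intro!: comp_closed)
    have "kdeg \<Lambda> (kcomp \<Lambda> m a) = kdeg \<Lambda> (kcomp \<Lambda> u b)"
      using a' b' m u True by (simp add: deg_comp n1_def n2_def)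
    then have eq: "E (kcomp \<Lambda> l a) (kcomp \<Lambda> m a) \<otimes> E (kcomp \<Lambda> u b) (kcomp \<Lambda> w b)
        = (if kcomp \<Lambda> m a = kcomp \<Lambda> u b \<and> ksrc \<Lambda> (kcomp \<Lambda> l a) = ksrc \<Lambda> (kcomp \<Lambda> m a) then
           E (kcomp \<Lambda> l a) (kcomp \<Lambda> w b) else \<zero>)"
      using cl by (intro E_mult_same_degree)
    have "E (kcomp \<Lambda> l a) (kcomp \<Lambda> w b) \<in> S" if "kcomp \<Lambda> m a = kcomp \<Lambda> u b"
      using a' b' True that by (intro mem) auto
    then show ?thesis
      unfolding eq using C.subspaceD(2)[OF S] by simp
  qed
  note S_mem = this
  have c1: "(\<lambda>a. E (kcomp \<Lambda> l a) (kcomp \<Lambda> m a)) \<in> ?F1 \<rightarrow> carrier C"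
    using l m True by (intro Pi_I E_closed comp_closed) (auto simp: kpaths_to_def)
  have c2: "(\<lambda>b. E (kcomp \<Lambda> u b) (kcomp \<Lambda> w b)) \<in> ?F2 \<rightarrow> carrier C"
    using u w True by (intro Pi_I E_closed comp_closed) (auto simp: kpaths_to_def)
  have "E l m = finsum C (\<lambda>a. E (kcomp \<Lambda> l a) (kcomp \<Lambda> m a)) ?F1"
    "E u w = finsum C (\<lambda>b. E (kcomp \<Lambda> u b) (kcomp \<Lambda> w b)) ?F2"
    using True by (intro E_expand l m u w n; simp)+
  then have "E l m \<otimes> E u w = finsum C (\<lambda>a. E (kcomp \<Lambda> l a) (kcomp \<Lambda> m a)) ?F1
      \<otimes> finsum C (\<lambda>b. E (kcomp \<Lambda> u b) (kcomp \<Lambda> w b)) ?F2"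
    by simp
  also have "\<dots> = finsum C (\<lambda>a. E (kcomp \<Lambda> l a) (kcomp \<Lambda> m a)
      \<otimes> finsum C (\<lambda>b. E (kcomp \<Lambda> u b) (kcomp \<Lambda> w b)) ?F2) ?F1"
    using F c1 c2 by (intro C.finsum_mult_right) auto
  also have "\<dots> \<in> S"
  proof (rule C.finsum_in_subspace[OF S F(1)], rule Pi_I)
    fix a assume a: "a \<in> ?F1"
    then have "E (kcomp \<Lambda> l a) (kcomp \<Lambda> m a) \<in> carrier C"
      using c1 by blast
    then have "E (kcomp \<Lambda> l a) (kcomp \<Lambda> m a) \<otimes> finsum C (\<lambda>b. E (kcomp \<Lambda> u b) (kcomp \<Lambda> w b)) ?F2
      = finsum C (\<lambda>b. E (kcomp \<Lambda> l a) (kcomp \<Lambda> m a) \<otimes> E (kcomp \<Lambda> u b) (kcomp \<Lambda> w b)) ?F2"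
      using F c2 by (intro C.finsum_mult_left)
    also have "\<dots> \<in> S"
      using F(2) S_mem[OF a] by (intro C.finsum_in_subspace[OF S]) auto
    finally show "E (kcomp \<Lambda> l a) (kcomp \<Lambda> m a) \<otimes> finsum C (\<lambda>b. E (kcomp \<Lambda> u b) (kcomp \<Lambda> w b)) ?F2 \<in> S" .
  qed
  finally show ?thesis .
qed

end

section \<open>The graded algebra and its bundle representations\<close>

locale graded_ck_family = ck_family k \<Lambda> C s + G: group G
  for k :: nat and \<Lambda> :: "'l kgraph" and C :: "'c cstar" (structure) and s :: "'l \<Rightarrow> 'c"
    and G :: "'g monoid" +
  fixes \<eta> :: "'l \<Rightarrow> 'g"
  assumes functor_\<eta>: "functor_to_group \<Lambda> G \<eta>"
begin

definition gr :: "'l \<Rightarrow> 'l \<Rightarrow> 'g" where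
  "gr l m = \<eta> l \<otimes>\<^bsub>G\<^esub> inv\<^bsub>G\<^esub> (\<eta> m)"

definition deg :: "'l \<Rightarrow> 'l \<Rightarrow> nat \<Rightarrow> int" where
  "deg l m = (\<lambda>i. int (kdeg \<Lambda> l i) - int (kdeg \<Lambda> m i))"

text \<open>Two gradings at once: \<open>g\<close> is the fibre of the bundle, and \<open>n\<close>
  is the character by which the torus acts. Products respect both.\<close>

definition homog :: "'g \<Rightarrow> (nat \<Rightarrow> int) \<Rightarrow> 'c set" where
  "homog g n = {E l m | l m. l \<in> kmor \<Lambda> \<and> m \<in> kmor \<Lambda> \<and> gr l m = g \<and> deg l m = n}"

definition gens :: "'g \<Rightarrow> 'c set" where
  "gens g = {E l m | l m. l \<in> kmor \<Lambda> \<and> m \<in> kmor \<Lambda> \<and> gr l m = g}"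

abbreviation Fib :: "'g \<Rightarrow> 'c set" where
  "Fib g \<equiv> closed_span C (gens g)"

lemma \<eta>_closed [simp, intro]: "l \<in> kmor \<Lambda> \<Longrightarrow> \<eta> l \<in> carrier G"
  and \<eta>_comp: "\<lbrakk>l \<in> kmor \<Lambda>; m \<in> kmor \<Lambda>; ksrc \<Lambda> l = krng \<Lambda> m\<rbrakk> \<Longrightarrow> \<eta> (kcomp \<Lambda> l m) = \<eta> l \<otimes>\<^bsub>G\<^esub> \<eta> m"
  using functor_\<eta> by (auto simp: functor_to_group_def)

lemma gr_closed [simp, intro]: "\<lbrakk>l \<in> kmor \<Lambda>; m \<in> kmor \<Lambda>\<rbrakk> \<Longrightarrow> gr l m \<in> carrier G"
  by (simp add: gr_def)

lemma gr_self: "l \<in> kmor \<Lambda> \<Longrightarrow> gr l l = \<one>\<^bsub>G\<^esub>"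
  by (simp add: gr_def)

lemma gr_inv: "\<lbrakk>l \<in> kmor \<Lambda>; m \<in> kmor \<Lambda>\<rbrakk> \<Longrightarrow> inv\<^bsub>G\<^esub> (gr l m) = gr m l"
  by (simp add: gr_def G.inv_mult_group)

lemma gr_mult: "\<lbrakk>l \<in> kmor \<Lambda>; m \<in> kmor \<Lambda>; w \<in> kmor \<Lambda>\<rbrakk> \<Longrightarrow> gr l m \<otimes>\<^bsub>G\<^esub> gr m w = gr l w"
  by (simp add: gr_def G.m_assoc) (simp add: G.m_assoc[symmetric])

lemma gr_comp:
  assumes "l \<in> kmor \<Lambda>" "m \<in> kmor \<Lambda>" "a \<in> kmor \<Lambda>" "ksrc \<Lambda> l = krng \<Lambda> a" "ksrc \<Lambda> m = krng \<Lambda> a"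
  shows "gr (kcomp \<Lambda> l a) (kcomp \<Lambda> m a) = gr l m"
  using assms by (simp add: gr_def \<eta>_comp G.inv_mult_group G.m_assoc) (simp add: G.m_assoc[symmetric])

lemma gens_closed: "gens g \<subseteq> carrier C"
  by (auto simp: gens_def)

lemma homog_subset_gens: "homog g n \<subseteq> gens g"
  by (auto simp: homog_def gens_def)

lemma homog_closed: "homog g n \<subseteq> carrier C"
  using homog_subset_gens gens_closed by blast

text \<open>Prolonging both paths of a pair by the same \<open>a\<close> changes neither grade,
  because the contributions of \<open>a\<close> cancel. Along \<open>m a = u b\<close> the grades of
  the two factors therefore compose.\<close>

lemma E_mult_homog:
  assumes l: "l \<in> kmor \<Lambda>" and m: "m \<in> kmor \<Lambda>" and u: "u \<in> kmor \<Lambda>" and w: "w \<in> kmor \<Lambda>"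
  shows "E l m \<otimes> E u w \<in> linear_span C (homog (gr l m \<otimes>\<^bsub>G\<^esub> gr u w) (\<lambda>i. deg l m i + deg u w i))"
proof (rule E_mult[OF l m u w C.linear_span_subspace[OF homog_closed]])
  fix a b assume ab: "a \<in> kmor \<Lambda>" "b \<in> kmor \<Lambda>" "ksrc \<Lambda> l = krng \<Lambda> a" "ksrc \<Lambda> m = krng \<Lambda> a"
    "ksrc \<Lambda> u = krng \<Lambda> b" "ksrc \<Lambda> w = krng \<Lambda> b" "kcomp \<Lambda> m a = kcomp \<Lambda> u b"
  have c: "kcomp \<Lambda> l a \<in> kmor \<Lambda>" "kcomp \<Lambda> m a \<in> kmor \<Lambda>" "kcomp \<Lambda> w b \<in> kmor \<Lambda>"
    using comp_closed[OF l ab(1,3)] comp_closed[OF m ab(1,4)] comp_closed[OF w ab(2,6)] .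
  have "gr (kcomp \<Lambda> l a) (kcomp \<Lambda> w b) = gr (kcomp \<Lambda> l a) (kcomp \<Lambda> m a) \<otimes>\<^bsub>G\<^esub> gr (kcomp \<Lambda> u b) (kcomp \<Lambda> w b)"
    using gr_mult[OF c] ab(7) by simp
  also have "\<dots> = gr l m \<otimes>\<^bsub>G\<^esub> gr u w"
    using gr_comp[OF l m ab(1,3,4)] gr_comp[OF u w ab(2,5,6)] by simp
  finally have 1: "gr (kcomp \<Lambda> l a) (kcomp \<Lambda> w b) = gr l m \<otimes>\<^bsub>G\<^esub> gr u w" .
  have "deg (kcomp \<Lambda> l a) (kcomp \<Lambda> w b) i = deg l m i + deg u w i" for i
  proof -
    have "kdeg \<Lambda> m i + kdeg \<Lambda> a i = kdeg \<Lambda> u i + kdeg \<Lambda> b i"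
      using fun_cong[OF deg_comp[OF m ab(1,4)], of i] fun_cong[OF deg_comp[OF u ab(2,5)], of i] ab(7) by simp
    then show ?thesis
      using ab l w by (simp add: deg_def deg_comp)
  qed
  then have "E (kcomp \<Lambda> l a) (kcomp \<Lambda> w b) \<in> homog (gr l m \<otimes>\<^bsub>G\<^esub> gr u w) (\<lambda>i. deg l m i + deg u w i)"
    using 1 c unfolding homog_def by blast
  then show "E (kcomp \<Lambda> l a) (kcomp \<Lambda> w b) \<in> linear_span C (homog (gr l m \<otimes>\<^bsub>G\<^esub> gr u w) (\<lambda>i. deg l m i + deg u w i))"
    using C.subset_linear_span by blast
qed

lemma gens_mult:
  assumes "x \<in> gens g" "y \<in> gens h" shows "x \<otimes> y \<in> linear_span C (gens (g \<otimes>\<^bsub>G\<^esub> h))"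
proof -
  obtain l m u w where *: "l \<in> kmor \<Lambda>" "m \<in> kmor \<Lambda>" "u \<in> kmor \<Lambda>" "w \<in> kmor \<Lambda>"
    "gr l m = g" "gr u w = h" "x = E l m" "y = E u w"
    using assms by (auto simp: gens_def)
  then show ?thesis
    using E_mult_homog[OF *(1-4)] C.linear_span_mono[OF homog_subset_gens] by blast
qed

lemma Fib_subspace: "linear_subspace C (Fib g)"
  using C.closed_span_subspace[OF gens_closed] .

lemma Fib_closed: "Fib g \<subseteq> carrier C"
  using C.closed_span_subset_carrier .

lemma E_gens: "\<lbrakk>l \<in> kmor \<Lambda>; m \<in> kmor \<Lambda>\<rbrakk> \<Longrightarrow> E l m \<in> gens (gr l m)"
  unfolding gens_def by blast

lemma E_Fib: "\<lbrakk>l \<in> kmor \<Lambda>; m \<in> kmor \<Lambda>\<rbrakk> \<Longrightarrow> E l m \<in> Fib (gr l m)"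
  using E_gens by (rule subsetD[OF C.subset_closed_span[OF gens_closed]])

lemma Fib_mult: "\<lbrakk>x \<in> Fib g; y \<in> Fib h\<rbrakk> \<Longrightarrow> x \<otimes> y \<in> Fib (g \<otimes>\<^bsub>G\<^esub> h)"
  by (rule C.closed_span_mult[OF gens_closed gens_closed Fib_subspace C.closed_span_closed
        subsetD[OF C.linear_span_subset_closed_span[OF gens_closed] gens_mult]])

lemma Fib_adj: "x \<in> Fib g \<Longrightarrow> cadj C x \<in> Fib (inv\<^bsub>G\<^esub> g)"
proof (rule C.closed_span_adj[OF gens_closed Fib_subspace C.closed_span_closed])
  fix x assume "x \<in> gens g"
  then obtain l m where "l \<in> kmor \<Lambda>" "m \<in> kmor \<Lambda>" "gr l m = g" "x = E l m"
    by (auto simp: gens_def)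
  then show "cadj C x \<in> Fib (inv\<^bsub>G\<^esub> g)"
    using E_Fib[of m l] by (auto simp: E_adj gr_inv)
qed

lemma Fib_one_subalgebra: "cstar_subalgebra C (Fib \<one>\<^bsub>G\<^esub>)"
  unfolding cstar_subalgebra_def using Fib_subspace C.closed_span_closed Fib_mult[of _ "\<one>\<^bsub>G\<^esub>" _ "\<one>\<^bsub>G\<^esub>"] Fib_adj[of _ "\<one>\<^bsub>G\<^esub>"]
  by auto

lemma bundle_simps:
  "fib (kgraph_bundle \<Lambda> G \<eta> C s) g = Fib g"
  "fadd (kgraph_bundle \<Lambda> G \<eta> C s) g = add C"
  "fscale (kgraph_bundle \<Lambda> G \<eta> C s) g = cscale C"
  "fmult (kgraph_bundle \<Lambda> G \<eta> C s) g h = mult C"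
  "fadj (kgraph_bundle \<Lambda> G \<eta> C s) g = cadj C"
  by (simp_all add: kgraph_bundle_def gens_def gr_def)

end

text \<open>Interpreted both for the universal representation in \<open>D\<close> and for the given
  one in the multiplier algebra, so that the two families of elements \<open>T\<close> can be
  compared.\<close>

locale twisted_rep = graded_ck_family k \<Lambda> C s G \<eta> + M: cstar_algebra M
  for k :: nat and \<Lambda> :: "'l kgraph" and C :: "'c cstar" (structure) and s :: "'l \<Rightarrow> 'c"
    and G :: "'g monoid" and \<eta> :: "'l \<Rightarrow> 'g" and M :: "'m cstar" +
  fixes \<sigma> :: "'g \<Rightarrow> 'g \<Rightarrow> complex" and \<pi> :: "'g \<Rightarrow> 'c \<Rightarrow> 'm"
  assumes cocycle: "two_cocycle G \<sigma>"
    and maps: "bundle_maps G (deformed_bundle G \<sigma> (kgraph_bundle \<Lambda> G \<eta> C s)) M \<pi>"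
begin

lemma \<sigma>_unimodular: "\<lbrakk>g \<in> carrier G; h \<in> carrier G\<rbrakk> \<Longrightarrow> cmod (\<sigma> g h) = 1"
  and \<sigma>_one: "g \<in> carrier G \<Longrightarrow> \<sigma> \<one>\<^bsub>G\<^esub> g = 1" "g \<in> carrier G \<Longrightarrow> \<sigma> g \<one>\<^bsub>G\<^esub> = 1"
  using cocycle by (auto simp: two_cocycle_def)

text \<open>The cocycle identity at \<open>g\<close>, its inverse and \<open>g\<close>, where both
  inner products are the unit.\<close>

lemma \<sigma>_inv: "g \<in> carrier G \<Longrightarrow> \<sigma> (inv\<^bsub>G\<^esub> g) g = \<sigma> g (inv\<^bsub>G\<^esub> g)"
proof -
  assume g: "g \<in> carrier G"
  have "\<sigma> g (inv\<^bsub>G\<^esub> g) * \<sigma> (g \<otimes>\<^bsub>G\<^esub> inv\<^bsub>G\<^esub> g) g = \<sigma> g (inv\<^bsub>G\<^esub> g \<otimes>\<^bsub>G\<^esub> g) * \<sigma> (inv\<^bsub>G\<^esub> g) g"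
    using cocycle g unfolding two_cocycle_def by (meson G.inv_closed)
  then show ?thesis
    using g by (simp add: \<sigma>_one)
qed

lemma \<pi>_closed: "\<lbrakk>g \<in> carrier G; b \<in> Fib g\<rbrakk> \<Longrightarrow> \<pi> g b \<in> carrier M"
  and \<pi>_add: "\<lbrakk>g \<in> carrier G; b \<in> Fib g; c \<in> Fib g\<rbrakk> \<Longrightarrow> \<pi> g (b \<oplus> c) = \<pi> g b \<oplus>\<^bsub>M\<^esub> \<pi> g c"
  and \<pi>_scale: "\<lbrakk>g \<in> carrier G; b \<in> Fib g\<rbrakk> \<Longrightarrow> \<pi> g (cscale C w b) = cscale M w (\<pi> g b)"
  and \<pi>_mult': "\<lbrakk>g \<in> carrier G; h \<in> carrier G; b \<in> Fib g; c \<in> Fib h\<rbrakk>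
      \<Longrightarrow> \<pi> (g \<otimes>\<^bsub>G\<^esub> h) (cscale C (\<sigma> g h) (b \<otimes> c)) = \<pi> g b \<otimes>\<^bsub>M\<^esub> \<pi> h c"
  and \<pi>_adj': "\<lbrakk>g \<in> carrier G; b \<in> Fib g\<rbrakk>
      \<Longrightarrow> cadj M (\<pi> g b) = \<pi> (inv\<^bsub>G\<^esub> g) (cscale C (cnj (\<sigma> g (inv\<^bsub>G\<^esub> g))) (cadj C b))"
  using maps by (auto simp: bundle_maps_def deformed_bundle_def bundle_simps Pi_iff)

lemma \<pi>_mult: "\<lbrakk>g \<in> carrier G; h \<in> carrier G; b \<in> Fib g; c \<in> Fib h\<rbrakk>
    \<Longrightarrow> \<pi> g b \<otimes>\<^bsub>M\<^esub> \<pi> h c = cscale M (\<sigma> g h) (\<pi> (g \<otimes>\<^bsub>G\<^esub> h) (b \<otimes> c))"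
  using \<pi>_mult' Fib_mult by (simp add: \<pi>_scale)

lemma \<pi>_adj: "\<lbrakk>g \<in> carrier G; b \<in> Fib g\<rbrakk>
    \<Longrightarrow> cadj M (\<pi> g b) = cscale M (cnj (\<sigma> g (inv\<^bsub>G\<^esub> g))) (\<pi> (inv\<^bsub>G\<^esub> g) (cadj C b))"
  using \<pi>_adj' Fib_adj by (simp add: \<pi>_scale)

lemma Fib_zero: "\<zero> \<in> Fib g"
  using C.subspaceD(2)[OF Fib_subspace] .

lemma \<pi>_zero: "g \<in> carrier G \<Longrightarrow> \<pi> g \<zero> = \<zero>\<^bsub>M\<^esub>"
  using \<pi>_scale[OF _ Fib_zero, of g 0] \<pi>_closed[OF _ Fib_zero] by simp

lemma \<pi>_diff: "\<lbrakk>g \<in> carrier G; b \<in> Fib g; c \<in> Fib g\<rbrakk> \<Longrightarrow> \<pi> g (b \<ominus> c) = \<pi> g b \<ominus>\<^bsub>M\<^esub> \<pi> g c"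
  using C.subspaceD(4)[OF Fib_subspace, of c g] Fib_closed[of g] \<pi>_closed[of g c]
  by (simp add: C.diff_as_scale M.diff_as_scale \<pi>_add \<pi>_scale subset_iff)

lemma \<pi>_finsum:
  assumes g: "g \<in> carrier G" and "finite F" "f \<in> F \<rightarrow> Fib g"
  shows "\<pi> g (finsum C f F) = finsum M (\<lambda>i. \<pi> g (f i)) F"
  using assms(2,3)
proof (induction F rule: finite_induct)
  case (insert i F)
  have "f \<in> F \<rightarrow> carrier C" "f i \<in> carrier C" "finsum C f F \<in> Fib g"
    using insert subsetD[OF Fib_closed] C.finsum_in_subspace[OF Fib_subspace] by (auto simp: Pi_iff)
  then show ?case
    using insert g \<pi>_closed by (simp add: \<pi>_add Pi_iff)
qed (use g \<pi>_zero in simp)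

text \<open>The adjoint brings \<open>cnj (\<sigma> g (inv g))\<close>, the product
  \<open>\<sigma> (inv g) g\<close>; these are conjugate numbers of modulus one and cancel. So the
  deformation does not affect \<open>b\<^sup>* b\<close>, and norms on all fibres are controlled by
  the unit fibre.\<close>

lemma \<pi>_adj_mult:
  assumes g: "g \<in> carrier G" and b: "b \<in> Fib g"
  shows "cadj M (\<pi> g b) \<otimes>\<^bsub>M\<^esub> \<pi> g b = \<pi> \<one>\<^bsub>G\<^esub> (cadj C b \<otimes> b)"
proof -
  let ?z = "\<sigma> g (inv\<^bsub>G\<^esub> g)"
  have bb: "cadj C b \<otimes> b \<in> Fib \<one>\<^bsub>G\<^esub>"
    using Fib_mult[OF Fib_adj[OF b] b] g by simp
  have "cnj ?z * ?z = 1"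
    using \<sigma>_unimodular[of g "inv\<^bsub>G\<^esub> g"] g by (simp add: complex_norm_square[symmetric] mult.commute)
  then show ?thesis
    using g b Fib_adj[OF b] bb \<pi>_closed[OF _ bb] \<pi>_closed[OF _ Fib_adj[OF b]]
    by (simp add: \<pi>_adj \<pi>_mult M.scale_mult_left \<pi>_closed \<sigma>_inv)
qed

text \<open>Over the unit of \<open>G\<close> the cocycle is 1, so \<open>\<pi>\<close> is there a
  homomorphism of C*-algebras, hence contractive.\<close>

lemma norm_\<pi>_one:
  assumes b: "b \<in> Fib \<one>\<^bsub>G\<^esub>" shows "cnorm M (\<pi> \<one>\<^bsub>G\<^esub> b) \<le> cnorm C b"
proof -
  let ?F = "Fib \<one>\<^bsub>G\<^esub>" and ?N = "cstar_image C (Fib \<one>\<^bsub>G\<^esub>) (\<lambda>x. x)"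
  have inj: "inj_on (\<lambda>x. x) ?F"
    by (simp add: inj_on_def)
  note simps = cstar_image_simps[OF inj, where M = C]
  have "star_hom ?N M (\<pi> \<one>\<^bsub>G\<^esub>)"
    using \<pi>_mult[of "\<one>\<^bsub>G\<^esub>" "\<one>\<^bsub>G\<^esub>"] \<pi>_adj[of "\<one>\<^bsub>G\<^esub>"] Fib_mult[of _ "\<one>\<^bsub>G\<^esub>" _ "\<one>\<^bsub>G\<^esub>"] Fib_adj[of _ "\<one>\<^bsub>G\<^esub>"]
    by (simp add: star_hom_def simps \<pi>_closed \<pi>_add \<pi>_scale \<sigma>_one)
  then interpret h: cstar_hom ?N M "\<pi> \<one>\<^bsub>G\<^esub>"
    using C.cstar_algebra_image[OF Fib_one_subalgebra inj] M.cstar_algebra_axioms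
    by (simp add: cstar_hom_def cstar_hom_axioms_def)
  show ?thesis
    using h.contractive[of b] b by (simp add: simps)
qed

lemma norm_\<pi>:
  assumes g: "g \<in> carrier G" and b: "b \<in> Fib g" shows "cnorm M (\<pi> g b) \<le> cnorm C b"
proof -
  have bc: "b \<in> carrier C"
    using b Fib_closed by blast
  have "cadj C b \<otimes> b \<in> Fib \<one>\<^bsub>G\<^esub>"
    using Fib_mult[OF Fib_adj[OF b] b] g by simp
  then have "(cnorm M (\<pi> g b))\<^sup>2 \<le> (cnorm C b)\<^sup>2"
    using norm_\<pi>_one M.norm_adj_mult[OF \<pi>_closed[OF g b]] C.norm_adj_mult[OF bc] \<pi>_adj_mult[OF g b] by metis
  then show ?thesis
    using C.norm_nonneg[OF bc] power2_le_imp_le by blast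
qed

section \<open>Twisted matrix units\<close>

definition T :: "'l \<Rightarrow> 'l \<Rightarrow> 'm" where
  "T l m = \<pi> (gr l m) (E l m)"

text \<open>Only the gauge degree is recorded, over all fibres together. Products and adjoints
  introduce cocycle values, but only as scalars, so the linear spans stay graded.\<close>

definition Thom :: "(nat \<Rightarrow> int) \<Rightarrow> 'm set" where
  "Thom n = {T l m | l m. l \<in> kmor \<Lambda> \<and> m \<in> kmor \<Lambda> \<and> deg l m = n}"

definition Tall :: "'m set" where
  "Tall = {T l m | l m. l \<in> kmor \<Lambda> \<and> m \<in> kmor \<Lambda>}"

lemma T_closed [simp, intro]: "\<lbrakk>l \<in> kmor \<Lambda>; m \<in> kmor \<Lambda>\<rbrakk> \<Longrightarrow> T l m \<in> carrier M"
  unfolding T_def by (intro \<pi>_closed gr_closed E_Fib)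

lemma Thom_closed: "Thom n \<subseteq> carrier M" and Tall_closed: "Tall \<subseteq> carrier M" and Thom_subset: "Thom n \<subseteq> Tall"
  by (auto simp: Thom_def Tall_def)

lemma \<pi>_span_in:
  assumes g: "g \<in> carrier G" and X: "X \<subseteq> gens g" and S: "linear_subspace M S"
    and mem: "\<And>x. x \<in> X \<Longrightarrow> \<pi> g x \<in> S" and x: "x \<in> linear_span C X"
  shows "\<pi> g x \<in> S"
proof -
  have Xc: "X \<subseteq> carrier C"
    using X gens_closed by blast
  have Fib: "y \<in> Fib g" if "y \<in> linear_span C X" for y
    using that C.linear_span_mono[OF X] C.linear_span_subset_closed_span[OF gens_closed] by blast
  show ?thesis
    using x Xc
  proof (induction rule: C.linear_span_induct)
    case (base x) then show ?case using mem by blast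
  next
    case zero then show ?case using M.subspaceD(2)[OF S] g by (simp add: \<pi>_zero)
  next
    case (add x y) then show ?case using M.subspaceD(3)[OF S] g Fib by (simp add: \<pi>_add)
  next
    case (scale c x) then show ?case using M.subspaceD(4)[OF S] g Fib by (simp add: \<pi>_scale)
  qed
qed

lemma \<pi>_homog: "\<lbrakk>g \<in> carrier G; x \<in> linear_span C (homog g n)\<rbrakk> \<Longrightarrow> \<pi> g x \<in> linear_span M (Thom n)"
proof (rule \<pi>_span_in[OF _ homog_subset_gens M.linear_span_subspace[OF Thom_closed]])
  fix x assume "x \<in> homog g n"
  then have "\<pi> g x \<in> Thom n"
    by (auto simp: homog_def Thom_def T_def)
  then show "\<pi> g x \<in> linear_span M (Thom n)"
    using M.subset_linear_span by blast
qed

text \<open>A fibre is a closed span and \<open>\<pi> g\<close> is contractive, so approximation by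
  finite combinations is preserved.\<close>

lemma \<pi>_Fib: 
  assumes g: "g \<in> carrier G" and x: "x \<in> Fib g" shows "\<pi> g x \<in> closed_span M Tall"
proof -
  have xc: "x \<in> carrier C"
    using x Fib_closed by blast
  have "\<exists>y\<in>closed_span M Tall. cnorm M (\<pi> g x \<ominus>\<^bsub>M\<^esub> y) < e" if "e > 0" for e
  proof -
    obtain y where y: "y \<in> linear_span C (gens g)" "cnorm C (x \<ominus> y) < e"
      using C.closed_span_approx[OF x gens_closed \<open>e > 0\<close>] by blast
    have yF: "y \<in> Fib g"
      using y C.linear_span_subset_closed_span[OF gens_closed] by blast
    have "\<pi> g y \<in> closed_span M Tall"
    proof (rule \<pi>_span_in[OF g subset_refl M.closed_span_subspace[OF Tall_closed] _ y(1)])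
      fix x assume "x \<in> gens g"
      then have "\<pi> g x \<in> Tall"
        by (auto simp: gens_def Tall_def T_def)
      then show "\<pi> g x \<in> closed_span M Tall"
        using M.subset_closed_span[OF Tall_closed] by blast
    qed
    moreover have "cnorm M (\<pi> g x \<ominus>\<^bsub>M\<^esub> \<pi> g y) < e"
      using norm_\<pi>[OF g, of "x \<ominus> y"] C.subspaceD(5)[OF Fib_subspace x yF] y(2) g x yF by (simp add: \<pi>_diff)
    ultimately show ?thesis
      by blast
  qed
  then show ?thesis
    using M.closed_span_closed[of Tall] \<pi>_closed[OF g x] unfolding M.closedin_iff by blast
qed

lemma T_mult_\<pi>:
  "\<lbrakk>l \<in> kmor \<Lambda>; m \<in> kmor \<Lambda>; u \<in> kmor \<Lambda>; w \<in> kmor \<Lambda>\<rbrakk> \<Longrightarrow> T l m \<otimes>\<^bsub>M\<^esub> T u w =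
    cscale M (\<sigma> (gr l m) (gr u w)) (\<pi> (gr l m \<otimes>\<^bsub>G\<^esub> gr u w) (E l m \<otimes> E u w))"
  unfolding T_def by (intro \<pi>_mult gr_closed E_Fib)

lemma T_mult:
  assumes "l \<in> kmor \<Lambda>" "m \<in> kmor \<Lambda>" "u \<in> kmor \<Lambda>" "w \<in> kmor \<Lambda>"
  shows "T l m \<otimes>\<^bsub>M\<^esub> T u w \<in> linear_span M (Thom (\<lambda>i. deg l m i + deg u w i))"
  unfolding T_mult_\<pi>[OF assms]
  using assms by (intro M.subspaceD(4)[OF M.linear_span_subspace[OF Thom_closed]] \<pi>_homog E_mult_homog) auto

lemma T_adj: "\<lbrakk>l \<in> kmor \<Lambda>; m \<in> kmor \<Lambda>\<rbrakk> \<Longrightarrow> cadj M (T l m) = cscale M (cnj (\<sigma> (gr l m) (gr m l))) (T m l)"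
  unfolding T_def using \<pi>_adj[OF gr_closed E_Fib, of l m] by (simp add: gr_inv E_adj)

lemma Thom_mult:
  assumes "x \<in> linear_span M (Thom p)" "y \<in> linear_span M (Thom q)"
  shows "x \<otimes>\<^bsub>M\<^esub> y \<in> linear_span M (Thom (\<lambda>i. p i + q i))"
proof (rule M.linear_span_mult[OF Thom_closed Thom_closed M.linear_span_subspace[OF Thom_closed] _ assms])
  fix x y assume "x \<in> Thom p" "y \<in> Thom q"
  then show "x \<otimes>\<^bsub>M\<^esub> y \<in> linear_span M (Thom (\<lambda>i. p i + q i))"
    using T_mult by (auto simp: Thom_def)
qed

lemma Thom_adj:
  assumes "x \<in> linear_span M (Thom p)" shows "cadj M x \<in> linear_span M (Thom (\<lambda>i. - p i))"
proof (rule M.linear_span_adj[OF Thom_closed M.linear_span_subspace[OF Thom_closed] _ assms])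
  fix x assume "x \<in> Thom p"
  then obtain l m where lm: "l \<in> kmor \<Lambda>" "m \<in> kmor \<Lambda>" "deg l m = p" "x = T l m"
    by (auto simp: Thom_def)
  then have "deg m l = (\<lambda>i. - p i)"
    by (auto simp: deg_def)
  then have "T m l \<in> linear_span M (Thom (\<lambda>i. - p i))"
    using lm M.subset_linear_span by (fastforce simp: Thom_def)
  then show "cadj M x \<in> linear_span M (Thom (\<lambda>i. - p i))"
    using lm M.subspaceD(4)[OF M.linear_span_subspace[OF Thom_closed]] by (simp add: T_adj)
qed

text \<open>Together with \<open>\<pi>_Fib\<close> this describes the C*-algebra generated by the
  representation as a closed span. That yields the density of finite combinations in
  \<open>D\<close> and the description of elements by sequences.\<close>

lemma closed_span_Tall_subalgebra: "cstar_subalgebra M (closed_span M Tall)"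
  unfolding cstar_subalgebra_def
proof (intro conjI ballI)
  show sub: "linear_subspace M (closed_span M Tall)" and clo: "closedin (ctopology M) (closed_span M Tall)"
    using M.closed_span_subspace[OF Tall_closed] M.closed_span_closed by auto
  have le: "linear_span M (Thom n) \<subseteq> closed_span M Tall" for n
    using M.linear_span_mono[OF Thom_subset] M.linear_span_subset_closed_span[OF Tall_closed] by blast
  show "x \<otimes>\<^bsub>M\<^esub> y \<in> closed_span M Tall" if "x \<in> closed_span M Tall" "y \<in> closed_span M Tall" for x y
  proof (rule M.closed_span_mult[OF Tall_closed Tall_closed sub clo _ that])
    show "x \<otimes>\<^bsub>M\<^esub> y \<in> closed_span M Tall" if "x \<in> Tall" "y \<in> Tall" for x y
      using that subsetD[OF le T_mult] by (auto simp: Tall_def)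
  qed
  show "cadj M x \<in> closed_span M Tall" if "x \<in> closed_span M Tall" for x
  proof (rule M.closed_span_adj[OF Tall_closed sub clo _ that])
    fix x assume "x \<in> Tall"
    then obtain l m where "l \<in> kmor \<Lambda>" "m \<in> kmor \<Lambda>" "x = T l m"
      by (auto simp: Tall_def)
    moreover from this have "T m l \<in> closed_span M Tall"
      using M.subset_closed_span[OF Tall_closed] by (auto simp: Tall_def)
    ultimately show "cadj M x \<in> closed_span M Tall"
      using M.subspaceD(4)[OF sub] by (simp add: T_adj)
  qed
qed

lemma T_eq_zero: "\<lbrakk>l \<in> kmor \<Lambda>; m \<in> kmor \<Lambda>; ksrc \<Lambda> l \<noteq> ksrc \<Lambda> m\<rbrakk> \<Longrightarrow> T l m = \<zero>\<^bsub>M\<^esub>"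
  by (simp add: T_def E_eq_zero \<pi>_zero)

lemma T_mult_same_degree:
  assumes "l \<in> kmor \<Lambda>" "m \<in> kmor \<Lambda>" "u \<in> kmor \<Lambda>" "w \<in> kmor \<Lambda>" "kdeg \<Lambda> m = kdeg \<Lambda> u"
  shows "T l m \<otimes>\<^bsub>M\<^esub> T u w =
    (if m = u \<and> ksrc \<Lambda> l = ksrc \<Lambda> m then cscale M (\<sigma> (gr l m) (gr m w)) (T l w) else \<zero>\<^bsub>M\<^esub>)"
  using assms unfolding T_mult_\<pi>[OF assms(1-4)] E_mult_same_degree[OF assms]
  by (auto simp: T_def gr_mult \<pi>_zero)

lemma T_expand:
  assumes l: "l \<in> kmor \<Lambda>" and m: "m \<in> kmor \<Lambda>" and src: "ksrc \<Lambda> l = ksrc \<Lambda> m" and n: "n \<in> degrees k"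
  shows "T l m = finsum M (\<lambda>a. T (kcomp \<Lambda> l a) (kcomp \<Lambda> m a)) (kpaths_to \<Lambda> (ksrc \<Lambda> l) n)"
proof -
  let ?F = "kpaths_to \<Lambda> (ksrc \<Lambda> l) n"
  have a: "gr (kcomp \<Lambda> l a) (kcomp \<Lambda> m a) = gr l m \<and> kcomp \<Lambda> l a \<in> kmor \<Lambda> \<and> kcomp \<Lambda> m a \<in> kmor \<Lambda>"
    if "a \<in> ?F" for a
    using that l m src by (auto simp: kpaths_to_def gr_comp intro!: comp_closed)
  have F: "E (kcomp \<Lambda> l a) (kcomp \<Lambda> m a) \<in> Fib (gr l m)" if "a \<in> ?F" for a
    using a[OF that] E_Fib[of "kcomp \<Lambda> l a" "kcomp \<Lambda> m a"] by simp
  have "T l m = finsum M (\<lambda>a. \<pi> (gr l m) (E (kcomp \<Lambda> l a) (kcomp \<Lambda> m a))) ?F"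
    unfolding T_def E_expand[OF assms] using l m F finite_paths[OF src_vertex[OF l] n]
    by (intro \<pi>_finsum) auto
  also have "\<dots> = finsum M (\<lambda>a. T (kcomp \<Lambda> l a) (kcomp \<Lambda> m a)) ?F"
    using a F l m by (intro M.finsum_cong') (auto simp: T_def[of "kcomp \<Lambda> l _"] intro!: \<pi>_closed)
  finally show ?thesis .
qed

lemma \<pi>_vertex: "v \<in> kvertices \<Lambda> \<Longrightarrow> T v v = \<pi> \<one>\<^bsub>G\<^esub> (s v)"
  by (simp add: T_def gr_self proj_adj proj_idem)

text \<open>With \<open>v\<close> the common source, the product of \<open>T v l\<close>,
  \<open>T l m\<close> and \<open>T m v\<close> is a unimodular multiple of the vertex projection
  \<open>T v v\<close>, which a zero factor would kill.\<close>

lemma T_nonzero: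
  assumes nz: "\<And>v. v \<in> kvertices \<Lambda> \<Longrightarrow> \<pi> \<one>\<^bsub>G\<^esub> (s v) \<noteq> \<zero>\<^bsub>M\<^esub>"
    and l: "l \<in> kmor \<Lambda>" and m: "m \<in> kmor \<Lambda>" and src: "ksrc \<Lambda> l = ksrc \<Lambda> m"
  shows "T l m \<noteq> \<zero>\<^bsub>M\<^esub>"
proof
  assume 0: "T l m = \<zero>\<^bsub>M\<^esub>"
  define v where "v = ksrc \<Lambda> l"
  have v: "v \<in> kvertices \<Lambda>" "v \<in> kmor \<Lambda>" "ksrc \<Lambda> v = v"
    using l by (simp_all add: v_def src_closed src_src)
  have "T v l \<otimes>\<^bsub>M\<^esub> T l m = cscale M (\<sigma> (gr v l) (gr l m)) (T v m)"
    using T_mult_same_degree[OF v(2) l l m] v by (simp add: v_def)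
  then have "cscale M (\<sigma> (gr v l) (gr l m)) (T v m) = \<zero>\<^bsub>M\<^esub>"
    using 0 v l by simp
  then have "T v m = \<zero>\<^bsub>M\<^esub>"
    using M.norm_scale[of "T v m" "\<sigma> (gr v l) (gr l m)"] M.norm_eq_0[of "T v m"] v l m \<sigma>_unimodular by simp
  moreover have "T v m \<otimes>\<^bsub>M\<^esub> T m v = cscale M (\<sigma> (gr v m) (gr m v)) (T v v)"
    using T_mult_same_degree[OF v(2) m m v(2)] v src by (simp add: v_def)
  ultimately have "cscale M (\<sigma> (gr v m) (gr m v)) (T v v) = \<zero>\<^bsub>M\<^esub>"
    using v m by simp
  then have "T v v = \<zero>\<^bsub>M\<^esub>"
    using M.norm_scale[of "T v v" "\<sigma> (gr v m) (gr m v)"] M.norm_eq_0[of "T v v"] v l m \<sigma>_unimodular by simp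
  then show False
    using nz[OF v(1)] v by (simp add: \<pi>_vertex)
qed

lemma norm_T_self: "l \<in> kmor \<Lambda> \<Longrightarrow> cnorm M (T l l) \<le> 1"
proof (rule M.norm_proj_le_1)
  assume l: "l \<in> kmor \<Lambda>"
  then show "cadj M (T l l) = T l l"
    by (simp add: T_adj gr_self \<sigma>_one)
  show "T l l \<otimes>\<^bsub>M\<^esub> T l l = T l l"
    using T_mult_same_degree[OF l l l l] l by (simp add: gr_self \<sigma>_one)
qed simp

text \<open>Compressing \<open>y\<close> by the projections \<open>T l l\<close> and
  \<open>T m m\<close>, of norm at most one, leaves the single term with index
  \<open>(l, m)\<close>.\<close>

lemma coefficient_bound:
  assumes F: "finite F" "F \<subseteq> kmor \<Lambda>" "\<And>l. l \<in> F \<Longrightarrow> kdeg \<Lambda> l = n" and l: "l \<in> F" and m: "m \<in> F"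
    and y: "y = finsum M (\<lambda>p. cscale M (c p) (T (fst p) (snd p))) (F \<times> F)"
  shows "cmod (c (l, m)) * cnorm M (T l m) \<le> cnorm M y"
proof -
  have lm: "l \<in> kmor \<Lambda>" "m \<in> kmor \<Lambda>"
    using F l m by auto
  have car: "(\<lambda>p. cscale M (c p) (T (fst p) (snd p))) \<in> F \<times> F \<rightarrow> carrier M"
    using F(2) by (auto simp: subset_iff)
  have yc: "y \<in> carrier M"
    unfolding y using car by (rule M.finsum_closed)
  have comp: "T l l \<otimes>\<^bsub>M\<^esub> (cscale M (c p) (T (fst p) (snd p)) \<otimes>\<^bsub>M\<^esub> T m m) = (if p = (l, m) then cscale M (c (l, m)) (T l m) else \<zero>\<^bsub>M\<^esub>)"
    if p: "p \<in> F \<times> F" for p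
  proof -
    obtain a b where p': "p = (a, b)" "a \<in> F" "b \<in> F"
      using p by auto
    have ab: "a \<in> kmor \<Lambda>" "b \<in> kmor \<Lambda>" "kdeg \<Lambda> b = kdeg \<Lambda> m" "kdeg \<Lambda> l = kdeg \<Lambda> a"
      using p' F l m by auto
    \<comment> \<open>No condition on the sources remains: if they differ, \<open>T a b\<close> is
      zero and both sides agree.\<close>
    have 1: "T a b \<otimes>\<^bsub>M\<^esub> T m m = (if b = m then T a b else \<zero>\<^bsub>M\<^esub>)"
      using T_mult_same_degree[OF ab(1,2) lm(2) lm(2) ab(3)] ab lm T_eq_zero[OF ab(1,2)]
      by (auto simp: gr_self \<sigma>_one)
    have 2: "T l l \<otimes>\<^bsub>M\<^esub> T a b = (if a = l then T a b else \<zero>\<^bsub>M\<^esub>)"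
      using T_mult_same_degree[OF lm(1) lm(1) ab(1,2,4)] ab lm by (auto simp: gr_self \<sigma>_one)
    have 3: "T l l \<otimes>\<^bsub>M\<^esub> (T a b \<otimes>\<^bsub>M\<^esub> T m m) = (if a = l \<and> b = m then T l m else \<zero>\<^bsub>M\<^esub>)"
    proof (cases "b = m")
      case True
      then show ?thesis
        unfolding 1 using 2 by auto
    next
      case False
      then show ?thesis
        unfolding 1 using lm by simp
    qed
    show ?thesis
      using ab lm 3 by (simp add: p' M.scale_mult_left M.scale_mult_right)
  qed
  have "T l l \<otimes>\<^bsub>M\<^esub> (y \<otimes>\<^bsub>M\<^esub> T m m)
      = finsum M (\<lambda>p. T l l \<otimes>\<^bsub>M\<^esub> (cscale M (c p) (T (fst p) (snd p)) \<otimes>\<^bsub>M\<^esub> T m m)) (F \<times> F)"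
  proof -
    have "y \<otimes>\<^bsub>M\<^esub> T m m = finsum M (\<lambda>p. cscale M (c p) (T (fst p) (snd p)) \<otimes>\<^bsub>M\<^esub> T m m) (F \<times> F)"
      unfolding y using F(1) car lm by (intro M.finsum_mult_right) auto
    moreover have "(\<lambda>p. cscale M (c p) (T (fst p) (snd p)) \<otimes>\<^bsub>M\<^esub> T m m) \<in> F \<times> F \<rightarrow> carrier M"
      using car lm by (auto simp: Pi_iff)
    ultimately show ?thesis
      using F(1) lm by (simp add: M.finsum_mult_left)
  qed
  also have "\<dots> = T l l \<otimes>\<^bsub>M\<^esub> (cscale M (c (l, m)) (T (fst (l, m)) (snd (l, m))) \<otimes>\<^bsub>M\<^esub> T m m)"
    using F(1) l m lm comp by (intro M.finsum_single) auto
  also have "\<dots> = cscale M (c (l, m)) (T l m)"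
    using comp[of "(l, m)"] l m by simp
  finally have "cmod (c (l, m)) * cnorm M (T l m) = cnorm M (T l l \<otimes>\<^bsub>M\<^esub> (y \<otimes>\<^bsub>M\<^esub> T m m))"
    using lm by (simp add: M.norm_scale)
  also have "\<dots> \<le> cnorm M (T l l) * cnorm M (y \<otimes>\<^bsub>M\<^esub> T m m)"
    using lm yc by (intro M.norm_mult) auto
  also have "\<dots> \<le> 1 * (cnorm M y * 1)"
  proof (rule mult_mono)
    show "cnorm M (y \<otimes>\<^bsub>M\<^esub> T m m) \<le> cnorm M y * 1"
      using M.norm_mult[OF yc, of "T m m"] norm_T_self[OF lm(2)] M.norm_nonneg[OF yc] lm
        mult_left_mono[of "cnorm M (T m m)" 1 "cnorm M y"] by simp
  qed (use norm_T_self lm M.norm_nonneg yc in auto)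
  finally show ?thesis
    by simp
qed

end

section \<open>Homomorphisms between bundle representations\<close>

locale intertwined_reps =
  I: twisted_rep k \<Lambda> C s G \<eta> D \<sigma> \<iota> + R: twisted_rep k \<Lambda> C s G \<eta> M \<sigma> \<rho> + h: cstar_hom D M \<phi>
  for k :: nat and \<Lambda> :: "'l kgraph" and C :: "'c cstar" and s :: "'l \<Rightarrow> 'c"
    and G :: "'g monoid" and \<eta> :: "'l \<Rightarrow> 'g" and \<sigma> :: "'g \<Rightarrow> 'g \<Rightarrow> complex"
    and D :: "'d cstar" and \<iota> :: "'g \<Rightarrow> 'c \<Rightarrow> 'd" and M :: "'m cstar" and \<rho> :: "'g \<Rightarrow> 'c \<Rightarrow> 'm"
    and \<phi> :: "'d \<Rightarrow> 'm" +
  assumes intertwines: "\<lbrakk>g \<in> carrier G; b \<in> I.Fib g\<rbrakk> \<Longrightarrow> \<phi> (\<iota> g b) = \<rho> g b"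
    and nonzero: "v \<in> kvertices \<Lambda> \<Longrightarrow> \<rho> \<one>\<^bsub>G\<^esub> (s v) \<noteq> \<zero>\<^bsub>M\<^esub>"
begin

lemma \<phi>_T: "\<lbrakk>l \<in> kmor \<Lambda>; m \<in> kmor \<Lambda>\<rbrakk> \<Longrightarrow> \<phi> (I.T l m) = R.T l m"
  unfolding I.T_def R.T_def by (intro intertwines I.gr_closed I.E_Fib)

text \<open>For a finite set of paths of one degree this is a finite-dimensional *-algebra, a
  twisted form of a direct sum of matrix algebras, one for each source vertex.\<close>

definition V :: "'l set \<Rightarrow> 'd set" where
  "V F = linear_span D ((\<lambda>p. I.T (fst p) (snd p)) ` (F \<times> F))"

definition extend :: "'l set \<Rightarrow> (nat \<Rightarrow> nat) \<Rightarrow> 'l set" where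
  "extend F n = (\<Union>l\<in>F. kcomp \<Lambda> l ` kpaths_to \<Lambda> (ksrc \<Lambda> l) n)"

lemma in_extend: "\<lbrakk>l \<in> F; a \<in> kpaths_to \<Lambda> (ksrc \<Lambda> l) n\<rbrakk> \<Longrightarrow> kcomp \<Lambda> l a \<in> extend F n"
  by (auto simp: extend_def)

lemma V_gens_closed: "F \<subseteq> kmor \<Lambda> \<Longrightarrow> (\<lambda>p. I.T (fst p) (snd p)) ` (F \<times> F) \<subseteq> carrier D"
  by (auto simp: subset_iff)

lemma V_subspace: "F \<subseteq> kmor \<Lambda> \<Longrightarrow> linear_subspace D (V F)"
  unfolding V_def by (intro I.M.linear_span_subspace V_gens_closed)

lemma T_in_V: "\<lbrakk>l \<in> F; m \<in> F\<rbrakk> \<Longrightarrow> I.T l m \<in> V F"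
  unfolding V_def by (intro subsetD[OF I.M.subset_linear_span]) force

lemma V_mono: "F \<subseteq> F' \<Longrightarrow> V F \<subseteq> V F'"
  unfolding V_def by (intro I.M.linear_span_mono image_mono Sigma_mono) auto

lemma extend_mor: "F \<subseteq> kmor \<Lambda> \<Longrightarrow> extend F n \<subseteq> kmor \<Lambda>"
  by (auto simp: extend_def kpaths_to_def intro!: I.comp_closed)

lemma extend_finite: "\<lbrakk>finite F; F \<subseteq> kmor \<Lambda>; n \<in> degrees k\<rbrakk> \<Longrightarrow> finite (extend F n)"
  unfolding extend_def by (intro finite_UN_I finite_imageI I.finite_paths) auto

lemma extend_deg:
  "\<lbrakk>F \<subseteq> kmor \<Lambda>; \<And>l. l \<in> F \<Longrightarrow> kdeg \<Lambda> l = p; l \<in> extend F n\<rbrakk> \<Longrightarrow> kdeg \<Lambda> l = (\<lambda>i. p i + n i)"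
  by (auto simp: extend_def kpaths_to_def I.deg_comp subset_iff)

text \<open>Each \<open>T l m\<close> with equal sources is the sum of its prolongations, and the
  others are zero.\<close>

lemma V_extend:
  assumes F: "F \<subseteq> kmor \<Lambda>" and n: "n \<in> degrees k"
  shows "V F \<subseteq> V (extend F n)"
proof -
  have "I.T l m \<in> V (extend F n)" if lm: "l \<in> F" "m \<in> F" for l m
  proof (cases "ksrc \<Lambda> l = ksrc \<Lambda> m")
    case True
    have mor: "l \<in> kmor \<Lambda>" "m \<in> kmor \<Lambda>"
      using lm F by auto
    have "finsum D (\<lambda>a. I.T (kcomp \<Lambda> l a) (kcomp \<Lambda> m a)) (kpaths_to \<Lambda> (ksrc \<Lambda> l) n) \<in> V (extend F n)"
      using lm mor True n
      by (intro I.M.finsum_in_subspace[OF V_subspace[OF extend_mor[OF F]]] I.finite_paths Pi_I T_in_V in_extend) auto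
    then show ?thesis
      using I.T_expand[OF mor True n] by simp
  next
    case False
    then have "I.T l m = \<zero>\<^bsub>D\<^esub>"
      using lm F by (intro I.T_eq_zero) auto
    then show ?thesis
      using I.M.subspaceD(2)[OF V_subspace[OF extend_mor[OF F]]] by simp
  qed
  then show ?thesis
    unfolding V_def[of F] by (intro I.M.linear_span_minimal V_subspace extend_mor F) auto
qed

text \<open>A pair of gauge degree 0 consists of two paths of equal degree, so it lies in some
  \<open>V F\<close>. Two such pieces, of degrees \<open>p\<close> and \<open>q\<close>, meet after
  prolongation to the coordinatewise maximum; this directedness handles sums.\<close>

lemma core_in_V:
  assumes "y \<in> linear_span D (I.Thom (\<lambda>i. 0))"
  shows "\<exists>n F. n \<in> degrees k \<and> finite F \<and> F \<subseteq> kmor \<Lambda> \<and> (\<forall>l\<in>F. kdeg \<Lambda> l = n) \<and> y \<in> V F"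
  using assms I.Thom_closed
proof (induction rule: I.M.linear_span_induct)
  case (base x)
  then obtain l m where lm: "l \<in> kmor \<Lambda>" "m \<in> kmor \<Lambda>" "I.deg l m = (\<lambda>i. 0)" "x = I.T l m"
    by (auto simp: I.Thom_def)
  then have "kdeg \<Lambda> l = kdeg \<Lambda> m"
    by (auto simp: I.deg_def fun_eq_iff)
  then show ?case
    using lm I.deg_closed[OF lm(2)] by (intro exI[of _ "kdeg \<Lambda> m"] exI[of _ "{l, m}"]) (simp add: T_in_V)
next
  case zero
  have "(\<lambda>i. 0) \<in> degrees k"
    by (simp add: degrees_def)
  then show ?case
    using I.M.subspaceD(2)[OF V_subspace[of "{}"]] by (intro exI[of _ "\<lambda>i. 0"] exI[of _ "{}"]) simp
next
  case (add x y)
  obtain p F where F': "p \<in> degrees k" "finite F" "F \<subseteq> kmor \<Lambda>" "\<forall>l\<in>F. kdeg \<Lambda> l = p" "x \<in> V F"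
    using add.IH(1) by blast
  obtain q H where H': "q \<in> degrees k" "finite H" "H \<subseteq> kmor \<Lambda>" "\<forall>l\<in>H. kdeg \<Lambda> l = q" "y \<in> V H"
    using add.IH(2) by blast
  note F = F'(1-3) F'(4)[rule_format] F'(5) and H = H'(1-3) H'(4)[rule_format] H'(5)
  define p' q' where "p' = (\<lambda>i. max (p i) (q i) - p i)" and "q' = (\<lambda>i. max (p i) (q i) - q i)"
  have d: "p' \<in> degrees k" "q' \<in> degrees k" "(\<lambda>i. max (p i) (q i)) \<in> degrees k"
    "(\<lambda>i. p i + p' i) = (\<lambda>i. max (p i) (q i))" "(\<lambda>i. q i + q' i) = (\<lambda>i. max (p i) (q i))"
    using F(1) H(1) by (auto simp: p'_def q'_def degrees_def)
  define K where "K = extend F p' \<union> extend H q'"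
  have K: "finite K" "K \<subseteq> kmor \<Lambda>"
    using extend_finite[OF F(2,3) d(1)] extend_finite[OF H(2,3) d(2)] extend_mor[OF F(3)] extend_mor[OF H(3)]
    by (auto simp: K_def)
  have "kdeg \<Lambda> l = (\<lambda>i. max (p i) (q i))" if "l \<in> K" for l
    using that extend_deg[OF F(3,4)] extend_deg[OF H(3,4)] d(4,5) by (metis K_def UnE)
  moreover have "x \<in> V K" "y \<in> V K"
    using subsetD[OF V_mono subsetD[OF V_extend[OF F(3) d(1)] F(5)]]
      subsetD[OF V_mono subsetD[OF V_extend[OF H(3) d(2)] H(5)]] by (simp_all add: K_def)
  ultimately show ?case
    using K d(3) I.M.subspaceD(3)[OF V_subspace[OF K(2)]]
    by (intro exI[of _ "\<lambda>i. max (p i) (q i)"] exI[of _ K]) simp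
next
  case (scale c x)
  then obtain p F where F: "p \<in> degrees k" "finite F" "F \<subseteq> kmor \<Lambda>" "\<forall>l\<in>F. kdeg \<Lambda> l = p" "x \<in> V F"
    by blast
  then show ?case
    using I.M.subspaceD(4)[OF V_subspace[OF F(3)]] by (intro exI[of _ p] exI[of _ F]) simp
qed

text \<open>The coefficients of \<open>y\<close> are controlled by \<open>\<phi> y\<close>, since
  the compression can be carried out in \<open>M\<close>; nonzero vertex projections make the
  divisors positive.\<close>

lemma V_bounded_below:
  assumes F: "finite F" "F \<subseteq> kmor \<Lambda>" "\<And>l. l \<in> F \<Longrightarrow> kdeg \<Lambda> l = n"
  obtains K where "\<And>y. y \<in> V F \<Longrightarrow> cnorm D y \<le> K * cnorm M (\<phi> y)"
proof
  \<comment> \<open>For different sources both norms are zero, and the quotient is 0 by the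
    convention on division.\<close>
  let ?K = "\<Sum>p\<in>F \<times> F. cnorm D (I.T (fst p) (snd p)) / cnorm M (R.T (fst p) (snd p))"
  fix y assume y: "y \<in> V F"
  have mor: "fst p \<in> kmor \<Lambda>" "snd p \<in> kmor \<Lambda>" if "p \<in> F \<times> F" for p
    using that F(2) by auto
  have fin: "finite (F \<times> F)"
    using F by simp
  have TD: "(\<lambda>p. I.T (fst p) (snd p)) \<in> F \<times> F \<rightarrow> carrier D"
    using mor by blast
  obtain c where c: "y = finsum D (\<lambda>p. cscale D (c p) (I.T (fst p) (snd p))) (F \<times> F)"
    using I.M.in_linear_span_finite_image[OF fin TD] y unfolding V_def by blast
  have cD: "(\<lambda>p. cscale D (c p) (I.T (fst p) (snd p))) \<in> F \<times> F \<rightarrow> carrier D"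
    using TD by (auto simp: Pi_iff)
  have "\<phi> y = finsum M (\<lambda>p. \<phi> (cscale D (c p) (I.T (fst p) (snd p)))) (F \<times> F)"
    unfolding c using fin cD by (rule h.hom_finsum)
  also have "\<dots> = finsum M (\<lambda>p. cscale M (c p) (R.T (fst p) (snd p))) (F \<times> F)"
    using mor by (intro R.M.finsum_cong') (auto simp: h.hom_scale \<phi>_T Pi_iff)
  finally have \<phi>y: "\<phi> y = finsum M (\<lambda>p. cscale M (c p) (R.T (fst p) (snd p))) (F \<times> F)" .
  have yc: "y \<in> carrier D"
    unfolding c using cD by (rule I.M.finsum_closed)
  have summand: "cnorm D (cscale D (c p) (I.T (fst p) (snd p)))
      \<le> cnorm D (I.T (fst p) (snd p)) / cnorm M (R.T (fst p) (snd p)) * cnorm M (\<phi> y)" if p: "p \<in> F \<times> F" for p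
  proof -
    obtain l m where lm: "p = (l, m)" "l \<in> F" "m \<in> F" "l \<in> kmor \<Lambda>" "m \<in> kmor \<Lambda>"
      using p F(2) by auto
    show ?thesis
    proof (cases "ksrc \<Lambda> l = ksrc \<Lambda> m")
      case True
      have "cnorm M (R.T l m) \<noteq> 0"
        using R.T_nonzero[OF nonzero lm(4,5) True] lm by (simp add: R.M.norm_eq_0)
      then have pos: "cnorm M (R.T l m) > 0"
        using R.M.norm_nonneg[of "R.T l m"] lm by simp
      have "cmod (c (l, m)) * cnorm M (R.T l m) \<le> cnorm M (\<phi> y)"
        using R.coefficient_bound[OF F lm(2,3) \<phi>y] .
      then have "cmod (c (l, m)) \<le> cnorm M (\<phi> y) / cnorm M (R.T l m)"
        using pos by (simp add: pos_le_divide_eq)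
      then have "cmod (c (l, m)) * cnorm D (I.T l m) \<le> cnorm M (\<phi> y) / cnorm M (R.T l m) * cnorm D (I.T l m)"
        using I.M.norm_nonneg[of "I.T l m"] lm by (intro mult_right_mono) auto
      then show ?thesis
        using lm by (simp add: I.M.norm_scale mult.commute)
    next
      case False
      then show ?thesis
        using I.T_eq_zero[OF lm(4,5)] lm by simp
    qed
  qed
  have "cnorm D y \<le> (\<Sum>p\<in>F \<times> F. cnorm D (cscale D (c p) (I.T (fst p) (snd p))))"
    unfolding c using fin cD by (rule I.M.norm_finsum)
  also have "\<dots> \<le> (\<Sum>p\<in>F \<times> F. cnorm D (I.T (fst p) (snd p)) / cnorm M (R.T (fst p) (snd p)) * cnorm M (\<phi> y))"
    by (intro sum_mono summand)
  finally show "cnorm D y \<le> ?K * cnorm M (\<phi> y)"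
    by (simp add: sum_distrib_right)
qed

lemma V_isometric:
  assumes F: "finite F" "F \<subseteq> kmor \<Lambda>" "\<And>l. l \<in> F \<Longrightarrow> kdeg \<Lambda> l = n" and y: "y \<in> V F"
  shows "cnorm D y \<le> cnorm M (\<phi> y)"
proof -
  note sub = V_subspace[OF F(2)]
  obtain K where K: "\<And>y. y \<in> V F \<Longrightarrow> cnorm D y \<le> K * cnorm M (\<phi> y)"
    using V_bounded_below[OF F] by blast
  show ?thesis
  proof (rule h.isometric_if_bounded_below[OF _ _ _ K y])
    show "V F \<subseteq> carrier D"
      using I.M.subspaceD(1)[OF sub] .
    show "x \<otimes>\<^bsub>D\<^esub> y \<in> V F" if x: "x \<in> V F" and y: "y \<in> V F" for x y
    proof (rule I.M.linear_span_mult[OF V_gens_closed[OF F(2)] V_gens_closed[OF F(2)] sub _ x[unfolded V_def] y[unfolded V_def]])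
      fix a b assume "a \<in> (\<lambda>p. I.T (fst p) (snd p)) ` (F \<times> F)" "b \<in> (\<lambda>p. I.T (fst p) (snd p)) ` (F \<times> F)"
      then obtain l m u w where *: "l \<in> F" "m \<in> F" "u \<in> F" "w \<in> F" "a = I.T l m" "b = I.T u w"
        by auto
      then have "a \<otimes>\<^bsub>D\<^esub> b = (if m = u \<and> ksrc \<Lambda> l = ksrc \<Lambda> m then cscale D (\<sigma> (I.gr l m) (I.gr m w)) (I.T l w) else \<zero>\<^bsub>D\<^esub>)"
        using F(2,3) I.T_mult_same_degree[of l m u w] by (simp add: subset_iff)
      then show "a \<otimes>\<^bsub>D\<^esub> b \<in> V F"
        using I.M.subspaceD(2,4)[OF sub] T_in_V * by simp
    qed
    show "cadj D x \<in> V F" if x: "x \<in> V F" for x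
    proof (rule I.M.linear_span_adj[OF V_gens_closed[OF F(2)] sub _ x[unfolded V_def]])
      fix a assume "a \<in> (\<lambda>p. I.T (fst p) (snd p)) ` (F \<times> F)"
      then obtain l m where "l \<in> F" "m \<in> F" "a = I.T l m"
        by auto
      then show "cadj D a \<in> V F"
        using F(2) I.M.subspaceD(4)[OF sub] T_in_V by (simp add: I.T_adj subset_iff)
    qed
  qed
qed

lemma homogeneous_isometric:
  assumes y: "y \<in> linear_span D (I.Thom n)"
  shows "cnorm D y \<le> cnorm M (\<phi> y)"
proof -
  have yc: "y \<in> carrier D"
    using y I.M.linear_span_subset_carrier[OF I.Thom_closed] by blast
  have core: "cadj D y \<otimes>\<^bsub>D\<^esub> y \<in> linear_span D (I.Thom (\<lambda>i. 0))"
    using I.Thom_mult[OF I.Thom_adj[OF y] y] by simp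
  obtain p F where F: "finite F" "F \<subseteq> kmor \<Lambda>" "\<forall>l\<in>F. kdeg \<Lambda> l = p" "cadj D y \<otimes>\<^bsub>D\<^esub> y \<in> V F"
    using core_in_V[OF core] by blast
  have "cnorm D (cadj D y \<otimes>\<^bsub>D\<^esub> y) \<le> cnorm M (\<phi> (cadj D y \<otimes>\<^bsub>D\<^esub> y))"
    using F by (intro V_isometric[of F p]) auto
  then have "(cnorm D y)\<^sup>2 \<le> (cnorm M (\<phi> y))\<^sup>2"
    using yc by (simp add: I.M.norm_adj_mult h.hom_mult h.hom_adj R.M.norm_adj_mult)
  then show ?thesis
    by (rule power2_le_imp_le) (simp add: R.M.norm_nonneg yc)
qed

end

section \<open>Averaging over roots of unity\<close>

definition torus_char :: "nat \<Rightarrow> (nat \<Rightarrow> complex) \<Rightarrow> (nat \<Rightarrow> int) \<Rightarrow> complex" where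
  "torus_char k z n = (\<Prod>i<k. z i powi n i)"

text \<open>Extensional functions, so that each of the \<open>N ^ k\<close> points is counted
  once.\<close>

definition root_indices :: "nat \<Rightarrow> nat \<Rightarrow> (nat \<Rightarrow> nat) set" where
  "root_indices k N = PiE {..<k} (\<lambda>_. {..<N})"

definition root_of_unity :: "nat \<Rightarrow> nat \<Rightarrow> complex" where
  "root_of_unity N a = cis (2 * pi * real a / real N)"

definition root_point :: "nat \<Rightarrow> nat \<Rightarrow> (nat \<Rightarrow> nat) \<Rightarrow> nat \<Rightarrow> complex" where
  "root_point k N a = (\<lambda>i. if i < k then root_of_unity N (a i) else 1)"

lemma finite_root_indices [simp]: "finite (root_indices k N)"
  by (simp add: root_indices_def finite_PiE)

lemma card_root_indices: "card (root_indices k N) = N ^ k"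
  by (simp add: root_indices_def card_PiE)

lemma root_of_unity_norm [simp]: "cmod (root_of_unity N a) = 1"
  by (simp add: root_of_unity_def)

lemma root_point_torus [simp]: "root_point k N a \<in> torus k"
  by (simp add: root_point_def torus_def)

lemma torus_char_norm: "z \<in> torus k \<Longrightarrow> cmod (torus_char k z n) = 1"
  by (simp add: torus_char_def torus_def prod_norm[symmetric] norm_power_int)

lemma torus_char_add:
  "z \<in> torus k \<Longrightarrow> torus_char k z m * torus_char k z n = torus_char k z (\<lambda>i. m i + n i)"
proof -
  assume "z \<in> torus k"
  then have "z i \<noteq> 0" if "i < k" for i
    using that unfolding torus_def by force
  then show ?thesis
    by (simp add: torus_char_def prod.distrib[symmetric] power_int_add)
qed

text \<open>A geometric series whose ratio is a root of unity; the bound on \<open>n\<close>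
  excludes the nonzero multiples of \<open>N\<close>, for which the ratio would be 1.\<close>

lemma sum_root_powers:
  assumes "\<bar>n\<bar> < int N"
  shows "(\<Sum>a<N. root_of_unity N a powi n) = (if n = 0 then of_nat N else 0)"
proof (cases "n = 0")
  case False
  define w where "w = cis (2 * pi * of_int n / real N)"
  have N: "N > 0"
    using assms by linarith
  have "w \<noteq> 1"
  proof
    assume "w = 1"
    then obtain j :: int where "2 * pi * of_int n / real N = of_int j * (2 * pi)"
      unfolding w_def cis_eq_1_iff by blast
    then have "of_int n = of_int j * real N"
      using N by (simp add: field_simps)
    then have "n = j * int N"
      by (metis of_int_eq_iff of_int_mult of_int_of_nat_eq)
    then have "int N dvd n"
      by simp
    then show False
      using False assms zdvd_imp_le[of "int N" "\<bar>n\<bar>"] by simp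
  qed
  have "(\<Sum>a<N. root_of_unity N a powi n) = (\<Sum>a<N. w ^ a)"
    by (intro sum.cong) (auto simp: root_of_unity_def cis_power_int w_def Complex.DeMoivre mult_ac)
  also have "\<dots> = (w ^ N - 1) / (w - 1)"
    using \<open>w \<noteq> 1\<close> by (rule geometric_sum)
  also have "w ^ N = 1"
    using N cis_multiple_2pi[of "of_int n"] by (simp add: w_def Complex.DeMoivre)
  finally show ?thesis
    using False by simp
qed (simp add: root_of_unity_def)

lemma sum_root_indices_prod:
  fixes f :: "nat \<Rightarrow> nat \<Rightarrow> 'a::comm_semiring_1"
  shows "(\<Sum>a\<in>root_indices k N. \<Prod>i<k. f i (a i)) = (\<Prod>i<k. \<Sum>y<N. f i y)"
  unfolding root_indices_def by (rule prod_sum_PiE[symmetric]) auto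

text \<open>Orthogonality of the characters of a finite group: the sum factorises over the
  coordinates.\<close>

lemma sum_torus_char:
  assumes "\<And>i. i < k \<Longrightarrow> \<bar>n i\<bar> < int N"
  shows "(\<Sum>a\<in>root_indices k N. torus_char k (root_point k N a) n) = (if \<forall>i<k. n i = 0 then of_nat (N ^ k) else 0)"
proof -
  have "(\<Sum>a\<in>root_indices k N. torus_char k (root_point k N a) n)
      = (\<Sum>a\<in>root_indices k N. \<Prod>i<k. root_of_unity N (a i) powi n i)"
    by (simp add: torus_char_def root_point_def)
  also have "\<dots> = (\<Prod>i<k. \<Sum>y<N. root_of_unity N y powi n i)"
    by (rule sum_root_indices_prod)
  also have "\<dots> = (\<Prod>i<k. if n i = 0 then of_nat N else 0)"
    using assms by (intro prod.cong) (auto simp: sum_root_powers)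
  also have "\<dots> = (if \<forall>i<k. n i = 0 then of_nat (N ^ k) else 0)"
    by auto
  finally show ?thesis .
qed

text \<open>The Fejer kernel, written as a square so that nonnegativity is evident; on the unit
  circle it is the sum of \<open>(1 - \<bar>j\<bar> / m) w\<^sup>j\<close> over
  \<open>\<bar>j\<bar> < m\<close>.\<close>

definition fejer :: "nat \<Rightarrow> complex \<Rightarrow> real" where
  "fejer m w = (cmod (\<Sum>j<m. w ^ j))\<^sup>2 / real m"

lemma fejer_nonneg: "0 \<le> fejer m w"
  by (simp add: fejer_def)

text \<open>On the unit circle \<open>cnj w\<close> is the inverse of \<open>w\<close>. Equal
  exponents are not collected, so all coefficients are \<open>1 / m\<close>.\<close>

lemma fejer_eq_sum:
  assumes "cmod w = 1"
  shows "complex_of_real (fejer m w) = (\<Sum>p\<in>{..<m} \<times> {..<m}. 1 / of_nat m * w powi (int (fst p) - int (snd p)))"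
proof -
  have w: "w \<noteq> 0" "cnj w = inverse w"
  proof -
    show "w \<noteq> 0"
      using assms by force
    have "w * cnj w = 1"
      using complex_norm_square[of w] assms by simp
    then show "cnj w = inverse w"
      by (metis inverse_unique)
  qed
  let ?S = "\<Sum>j<m. w ^ j"
  have "complex_of_real (fejer m w) = ?S * cnj ?S / of_nat m"
    using complex_norm_square[of ?S] by (simp add: fejer_def del: cnj_sum)
  also have "cnj ?S = (\<Sum>j<m. w powi (- int j))"
    by (simp add: w power_int_minus power_inverse)
  also have "?S * (\<Sum>j<m. w powi (- int j)) = (\<Sum>i<m. \<Sum>j<m. w powi (int i) * w powi (- int j))"
    by (simp add: sum_product)
  also have "\<dots> = (\<Sum>p\<in>{..<m} \<times> {..<m}. w powi (int (fst p) - int (snd p)))"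
    unfolding sum.cartesian_product using w by (intro sum.cong) (auto simp: power_int_diff power_int_minus field_simps)
  finally show ?thesis
    by (simp add: sum_distrib_left sum_divide_distrib)
qed

text \<open>For \<open>m \<le> N\<close> all exponents are smaller than \<open>N\<close> in modulus,
  so summing over the roots keeps only the \<open>m\<close> diagonal pairs, each with coefficient
  \<open>1 / m\<close>.\<close>

lemma sum_fejer:
  assumes m: "m > 0" and N: "m \<le> N"
  shows "(\<Sum>y<N. fejer m (root_of_unity N y)) = real N"
proof -
  have "complex_of_real (\<Sum>y<N. fejer m (root_of_unity N y))
      = (\<Sum>y<N. \<Sum>p\<in>{..<m} \<times> {..<m}. 1 / of_nat m * root_of_unity N y powi (int (fst p) - int (snd p)))"
    by (simp add: fejer_eq_sum)
  also have "\<dots> = (\<Sum>p\<in>{..<m} \<times> {..<m}. \<Sum>y<N. 1 / of_nat m * root_of_unity N y powi (int (fst p) - int (snd p)))"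
    by (rule sum.swap)
  also have "\<dots> = (\<Sum>p\<in>{..<m} \<times> {..<m}. 1 / of_nat m * (if int (fst p) - int (snd p) = 0 then of_nat N else 0))"
    unfolding sum_distrib_left[symmetric] using N by (intro sum.cong refl arg_cong2[where f = "(*)"] sum_root_powers) auto
  also have "\<dots> = (\<Sum>i<m. \<Sum>j<m. 1 / of_nat m * (if i = j then of_nat N else 0))"
    unfolding sum.cartesian_product by (intro sum.cong) auto
  also have "\<dots> = of_nat N"
  proof -
    have "(\<Sum>j<m. 1 / of_nat m * (if i = j then of_nat N else 0)) = (of_nat N / of_nat m :: complex)" if "i < m" for i
      unfolding sum_distrib_left[symmetric] using that by simp
    then show ?thesis
      using m by simp
  qed
  finally have "complex_of_real (\<Sum>y<N. fejer m (root_of_unity N y)) = complex_of_real (real N)"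
    by simp
  then show ?thesis
    by (simp only: of_real_eq_iff)
qed

text \<open>The geometric sum is at most \<open>2 / \<delta>\<close> in modulus; its square gives
  the 4, and the division by \<open>m\<close> makes the kernel concentrate at 1.\<close>

lemma fejer_far:
  assumes "cmod w = 1" "\<delta> \<le> cmod (1 - w)" "\<delta> > 0" "m > 0"
  shows "fejer m w \<le> 4 / (real m * \<delta>\<^sup>2)"
proof -
  let ?S = "\<Sum>j<m. w ^ j"
  have "?S * (1 - w) = 1 - w ^ m"
    by (simp add: sum_gp_strict)
  then have "cmod ?S * cmod (1 - w) \<le> 2"
    using norm_triangle_ineq4[of 1 "w ^ m"] assms(1) by (simp add: norm_mult[symmetric] norm_power)
  moreover have "cmod ?S * \<delta> \<le> cmod ?S * cmod (1 - w)"
    using assms by (intro mult_left_mono) auto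
  ultimately have "(cmod ?S * \<delta>)\<^sup>2 \<le> 2\<^sup>2"
    using assms by (intro power_mono) auto
  then have "(cmod ?S)\<^sup>2 \<le> 4 / \<delta>\<^sup>2"
    using assms by (simp add: power_mult_distrib pos_le_divide_eq)
  then have "(cmod ?S)\<^sup>2 / real m \<le> 4 / \<delta>\<^sup>2 / real m"
    by (intro divide_right_mono) auto
  then show ?thesis
    by (simp add: fejer_def mult.commute)
qed

text \<open>The discrete form of the Fejer kernel of the torus; for \<open>0 < m \<le> N\<close> it
  is a probability distribution on the points with \<open>N\<close>-th roots of unity as
  coordinates.\<close>

definition weight :: "nat \<Rightarrow> nat \<Rightarrow> nat \<Rightarrow> (nat \<Rightarrow> nat) \<Rightarrow> real" where
  "weight k m N a = (\<Prod>i<k. fejer m (root_of_unity N (a i))) / real (N ^ k)"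

lemma weight_nonneg: "0 \<le> weight k m N a"
  by (simp add: weight_def fejer_nonneg prod_nonneg)

lemma sum_weight:
  assumes "m > 0" "m \<le> N" shows "(\<Sum>a\<in>root_indices k N. weight k m N a) = 1"
  using assms by (simp add: weight_def sum_divide_distrib[symmetric] sum_root_indices_prod[of "\<lambda>_ y. fejer m (root_of_unity N y)"] sum_fejer)

text \<open>The factor of the coordinate \<open>i\<close> is bounded by \<open>fejer_far\<close>;
  the remaining sum factorises, and each other coordinate has mean one. The bound does not involve
  \<open>N\<close>, which is chosen last.\<close>

lemma sum_weight_far:
  assumes m: "m > 0" "m \<le> N" and \<delta>: "\<delta> > 0" and i: "i < k"
  shows "(\<Sum>a\<in>root_indices k N. if \<delta> \<le> cmod (1 - root_point k N a i) then weight k m N a else 0) \<le> 4 / (real m * \<delta>\<^sup>2)"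
proof -
  let ?c = "4 / (real m * \<delta>\<^sup>2)"
  define g where "g j y = (if j = i then ?c else fejer m (root_of_unity N y))" for j y
  have N: "N > 0"
    using m by simp
  have "(if \<delta> \<le> cmod (1 - root_point k N a i) then weight k m N a else 0) \<le> (\<Prod>j<k. g j (a j)) / real (N ^ k)" for a
  proof (cases "\<delta> \<le> cmod (1 - root_point k N a i)")
    case True
    have "(\<Prod>j<k. fejer m (root_of_unity N (a j))) \<le> (\<Prod>j<k. g j (a j))"
      using True i m \<delta> by (intro prod_mono) (auto simp: g_def fejer_nonneg root_point_def intro!: fejer_far)
    then show ?thesis
      using True by (simp add: weight_def divide_right_mono)
  next
    case False
    have "0 \<le> (\<Prod>j<k. g j (a j))"
      using \<delta> by (intro prod_nonneg) (auto simp: g_def fejer_nonneg)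
    then show ?thesis
      using False by simp
  qed
  then have "(\<Sum>a\<in>root_indices k N. if \<delta> \<le> cmod (1 - root_point k N a i) then weight k m N a else 0)
      \<le> (\<Sum>a\<in>root_indices k N. (\<Prod>j<k. g j (a j)) / real (N ^ k))"
    by (intro sum_mono)
  also have "\<dots> = (\<Prod>j<k. \<Sum>y<N. g j y) / real (N ^ k)"
    by (simp add: sum_divide_distrib[symmetric] sum_root_indices_prod)
  also have "(\<Prod>j<k. \<Sum>y<N. g j y) = (\<Prod>j<k. real N * (if j = i then ?c else 1))"
    using m by (intro prod.cong) (auto simp: g_def sum_fejer)
  also have "\<dots> = real (N ^ k) * ?c"
    using i by (simp add: prod.distrib prod.delta)
  also have "\<dots> / real (N ^ k) = ?c"
    using N by simp
  finally show ?thesis .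
qed

text \<open>One pair of exponents for each coordinate, as in the uncollected expansion of the
  kernel; several pairs give the same frequency.\<close>

definition fejer_freqs :: "nat \<Rightarrow> nat \<Rightarrow> (nat \<Rightarrow> nat \<times> nat) set" where
  "fejer_freqs k m = PiE {..<k} (\<lambda>_. {..<m} \<times> {..<m})"

definition freq :: "nat \<Rightarrow> (nat \<Rightarrow> nat \<times> nat) \<Rightarrow> nat \<Rightarrow> int" where
  "freq k q = (\<lambda>i. if i < k then int (fst (q i)) - int (snd (q i)) else 0)"

lemma finite_fejer_freqs [simp]: "finite (fejer_freqs k m)"
  by (simp add: fejer_freqs_def finite_PiE)

lemma card_fejer_freqs: "card (fejer_freqs k m) = (m ^ k) * (m ^ k)"
  by (simp add: fejer_freqs_def card_PiE power_mult_distrib)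

lemma weight_eq_sum:
  "complex_of_real (weight k m N a)
    = (\<Sum>q\<in>fejer_freqs k m. 1 / of_nat (m ^ k) * (torus_char k (root_point k N a) (freq k q) / of_nat (N ^ k)))"
proof -
  have "complex_of_real (\<Prod>i<k. fejer m (root_of_unity N (a i)))
      = (\<Prod>i<k. \<Sum>p\<in>{..<m} \<times> {..<m}. 1 / of_nat m * root_of_unity N (a i) powi (int (fst p) - int (snd p)))"
    by (simp add: fejer_eq_sum)
  also have "\<dots> = (\<Sum>q\<in>fejer_freqs k m. \<Prod>i<k. 1 / of_nat m * root_of_unity N (a i) powi (int (fst (q i)) - int (snd (q i))))"
    unfolding fejer_freqs_def by (rule prod_sum_PiE) auto
  also have "\<dots> = (\<Sum>q\<in>fejer_freqs k m. 1 / of_nat (m ^ k) * torus_char k (root_point k N a) (freq k q))"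
    by (simp add: prod.distrib torus_char_def root_point_def freq_def power_divide prod_dividef)
  finally show ?thesis
    by (simp add: weight_def sum_divide_distrib)
qed

section \<open>Faithfulness\<close>

text \<open>All coordinates from \<open>k\<close> on are 1 on the torus, so only finitely many radii
  matter.\<close>

lemma torus_neighbourhood:
  assumes "open U" "(\<lambda>i. 1) \<in> (U :: (nat \<Rightarrow> complex) set)"
  shows "\<exists>\<delta>>0. \<forall>z\<in>torus k. (\<forall>i<k. cmod (1 - z i) < \<delta>) \<longrightarrow> z \<in> U"
proof -
  have "openin (product_topology (\<lambda>i. euclidean) UNIV) U"
    using assms(1) unfolding open_fun_def .
  from product_topology_open_contains_basis[OF this assms(2)]
  obtain X where "(\<lambda>i. 1) \<in> PiE UNIV X \<and> (\<forall>i. openin euclidean (X i)) \<and> finite {i. X i \<noteq> topspace euclidean} \<and> PiE UNIV X \<subseteq> U"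
    ..
  then have X: "(\<lambda>i. 1) \<in> PiE UNIV X" "\<And>i. open (X i)" "PiE UNIV X \<subseteq> U"
    by simp_all
  have "\<exists>e>0. ball 1 e \<subseteq> X i" for i
  proof -
    have "1 \<in> X i"
      using X(1) by (simp add: PiE_iff)
    then show ?thesis
      using X(2)[of i] unfolding open_contains_ball by blast
  qed
  then obtain e where e: "\<And>i. e i > 0" "\<And>i. ball 1 (e i) \<subseteq> X i"
    by metis
  \<comment> \<open>The inserted 1 keeps the set nonempty for \<open>k = 0\<close>.\<close>
  define \<delta> where "\<delta> = Min (insert 1 (e ` {..<k}))"
  have "\<delta> > 0"
    using e(1) by (simp add: \<delta>_def)
  moreover have "z \<in> U" if z: "z \<in> torus k" "\<forall>i<k. cmod (1 - z i) < \<delta>" for z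
  proof -
    have "z i \<in> X i" for i
    proof (cases "i < k")
      case True
      then have "\<delta> \<le> e i"
        by (simp add: \<delta>_def)
      then have "z i \<in> ball 1 (e i)"
        using z(2)[rule_format, OF True] by (simp add: dist_norm)
      then show ?thesis
        using e(2) by blast
    next
      case False
      then have "z i = 1"
        using z(1) by (simp add: torus_def)
      then show ?thesis
        using X(1) by auto
    qed
    then show ?thesis
      using X(3) by auto
  qed
  ultimately show ?thesis
    by blast
qed

lemma one_torus: "(\<lambda>i. 1) \<in> torus k"
  by (simp add: torus_def)

lemma (in cstar_algebra) continuous_torus_action_near_one:
  assumes act: "continuous_torus_action k A \<beta>" and x: "x \<in> carrier A" and e: "e > 0"
  shows "\<exists>\<delta>>0. \<forall>z\<in>torus k. (\<forall>i<k. cmod (1 - z i) < \<delta>) \<longrightarrow> cnorm A (x \<ominus> \<beta> z x) < e"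
proof -
  interpret m: Metric_space "carrier A" "cdist A"
    by (rule Metric_space_cdist)
  have cont: "continuous_map (top_of_set (torus k)) m.mtopology (\<lambda>z. \<beta> z x)"
    and tact: "torus_action k A \<beta>"
    using act x by (simp_all add: continuous_torus_action_def ctopology_def)
  have aut: "star_automorphism A (\<beta> (\<lambda>i. 1))"
    and comp: "\<forall>z\<in>torus k. \<forall>w\<in>torus k. \<forall>x\<in>carrier A. \<beta> (\<lambda>i. z i * w i) x = \<beta> z (\<beta> w x)"
    using tact one_torus unfolding torus_action_def by blast+
  \<comment> \<open>An idempotent injective map is the identity, so the unit of the torus acts
    trivially.\<close>
  have idem: "\<beta> (\<lambda>i. 1) x = \<beta> (\<lambda>i. 1) (\<beta> (\<lambda>i. 1) x)"
    using comp[rule_format, OF one_torus one_torus x] by simp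
  have bij: "bij_betw (\<beta> (\<lambda>i. 1)) (carrier A) (carrier A)"
    using aut by (simp add: star_automorphism_def)
  then have "\<beta> (\<lambda>i. 1) x \<in> carrier A"
    using x by (auto simp: bij_betw_def)
  then have one: "\<beta> (\<lambda>i. 1) x = x"
    using inj_onD[OF bij_betw_imp_inj_on[OF bij] idem[symmetric]] x by simp
  have "openin (top_of_set (torus k)) {z \<in> torus k. \<beta> z x \<in> m.mball x e}"
    using openin_continuous_map_preimage[OF cont, of "m.mball x e"] by simp
  then obtain U where U: "open U" "{z \<in> torus k. \<beta> z x \<in> m.mball x e} = torus k \<inter> U"
    unfolding openin_open by blast
  have "x \<in> m.mball x e"
    using x e by simp
  then have "(\<lambda>i. 1) \<in> {z \<in> torus k. \<beta> z x \<in> m.mball x e}"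
    by (simp add: one one_torus del: m.in_mball)
  then have "(\<lambda>i. 1) \<in> U"
    unfolding U(2) by simp
  then obtain \<delta> where \<delta>: "\<delta> > 0" "\<forall>z\<in>torus k. (\<forall>i<k. cmod (1 - z i) < \<delta>) \<longrightarrow> z \<in> U"
    using torus_neighbourhood[OF U(1), of k] by blast
  have "cnorm A (x \<ominus> \<beta> z x) < e" if z: "z \<in> torus k" "\<forall>i<k. cmod (1 - z i) < \<delta>" for z
  proof -
    have "z \<in> {z \<in> torus k. \<beta> z x \<in> m.mball x e}"
      unfolding U(2) using \<delta>(2) z by simp
    then show ?thesis
      by (auto simp: cdist_def)
  qed
  then show ?thesis
    using \<delta>(1) by blast
qed

text \<open>Equivariance is asked for the elements \<open>T l m\<close> only; linearity extends it
  to their span, where the averages are estimated.\<close>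

locale gauge_equivariant = intertwined_reps k \<Lambda> C s G \<eta> \<sigma> D \<iota> M \<rho> \<phi>
  for k :: nat and \<Lambda> :: "'l kgraph" and C :: "'c cstar" and s :: "'l \<Rightarrow> 'c"
    and G :: "'g monoid" and \<eta> :: "'l \<Rightarrow> 'g" and \<sigma> :: "'g \<Rightarrow> 'g \<Rightarrow> complex"
    and D :: "'d cstar" and \<iota> :: "'g \<Rightarrow> 'c \<Rightarrow> 'd" and M :: "'m cstar" and \<rho> :: "'g \<Rightarrow> 'c \<Rightarrow> 'm"
    and \<phi> :: "'d \<Rightarrow> 'm" +
  fixes \<beta> :: "(nat \<Rightarrow> complex) \<Rightarrow> 'd \<Rightarrow> 'd" and \<alpha> :: "(nat \<Rightarrow> complex) \<Rightarrow> 'm \<Rightarrow> 'm"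
  assumes \<beta>_action: "continuous_torus_action k D \<beta>"
    and \<beta>_T: "\<lbrakk>z \<in> torus k; l \<in> kmor \<Lambda>; m \<in> kmor \<Lambda>\<rbrakk>
        \<Longrightarrow> \<beta> z (I.T l m) = cscale D (torus_char k z (I.deg l m)) (I.T l m)"
    and \<alpha>_hom: "z \<in> torus k \<Longrightarrow> star_hom M M (\<alpha> z)"
    and equivariant_T: "\<lbrakk>z \<in> torus k; l \<in> kmor \<Lambda>; m \<in> kmor \<Lambda>\<rbrakk> \<Longrightarrow> \<phi> (\<beta> z (I.T l m)) = \<alpha> z (R.T l m)"
    and dense: "closed_span D I.Tall = carrier D"
begin

lemma \<beta>_cstar_hom: "z \<in> torus k \<Longrightarrow> cstar_hom D D (\<beta> z)"
  using \<beta>_action I.M.cstar_algebra_axioms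
  by (simp add: cstar_hom_def cstar_hom_axioms_def continuous_torus_action_def torus_action_def star_automorphism_def)

lemma \<alpha>_cstar_hom: "z \<in> torus k \<Longrightarrow> cstar_hom M M (\<alpha> z)"
  using \<alpha>_hom R.M.cstar_algebra_axioms by (simp add: cstar_hom_def cstar_hom_axioms_def)

lemmas \<beta>_closed = cstar_hom.hom_closed[OF \<beta>_cstar_hom]
lemmas \<beta>_add = cstar_hom.hom_add[OF \<beta>_cstar_hom]
lemmas \<beta>_scale = cstar_hom.hom_scale[OF \<beta>_cstar_hom]
lemmas \<beta>_zero = cstar_hom.hom_zero[OF \<beta>_cstar_hom]
lemmas \<beta>_contractive = cstar_hom.contractive[OF \<beta>_cstar_hom]
lemmas \<beta>_diff = cstar_hom.hom_diff[OF \<beta>_cstar_hom]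

lemma span_closed: "y \<in> linear_span D I.Tall \<Longrightarrow> y \<in> carrier D"
  using I.M.linear_span_subset_carrier[OF I.Tall_closed] by blast

lemma equivariant:
  assumes z: "z \<in> torus k" and y: "y \<in> linear_span D I.Tall"
  shows "\<phi> (\<beta> z y) = \<alpha> z (\<phi> y)"
proof -
  interpret a: cstar_hom M M "\<alpha> z"
    using \<alpha>_cstar_hom[OF z] .
  show ?thesis
    using y I.Tall_closed
  proof (induction rule: I.M.linear_span_induct)
    case (base x)
    then show ?case
      using equivariant_T[OF z] \<phi>_T by (auto simp: I.Tall_def)
  next
    case zero
    show ?case
      using z by (simp add: \<beta>_zero)
  next
    case (add x y)
    then show ?case
      using z span_closed by (simp add: \<beta>_add \<beta>_closed h.hom_add a.hom_add)
  next
    case (scale c x)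
    then show ?case
      using z span_closed by (simp add: \<beta>_scale \<beta>_closed h.hom_scale a.hom_scale)
  qed
qed

text \<open>A discrete Fourier coefficient of \<open>z \<mapsto> \<beta> z y\<close>. The character
  enters uninverted, so the component of degree \<open>- n\<close> survives.\<close>

definition average :: "(nat \<Rightarrow> int) \<Rightarrow> nat \<Rightarrow> 'd \<Rightarrow> 'd" where
  "average n N y = finsum D (\<lambda>a. cscale D (torus_char k (root_point k N a) n / of_nat (N ^ k)) (\<beta> (root_point k N a) y)) (root_indices k N)"

lemma average_closed: "y \<in> carrier D \<Longrightarrow> average n N y \<in> carrier D"
  unfolding average_def by (intro I.M.finsum_closed Pi_I I.M.scale_closed \<beta>_closed) auto

lemma average_zero: "average n N \<zero>\<^bsub>D\<^esub> = \<zero>\<^bsub>D\<^esub>"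
  unfolding average_def by (intro I.M.add.finprod_one_eqI) (simp add: \<beta>_zero)

lemma average_add:
  "\<lbrakk>x \<in> carrier D; y \<in> carrier D\<rbrakk> \<Longrightarrow> average n N (x \<oplus>\<^bsub>D\<^esub> y) = average n N x \<oplus>\<^bsub>D\<^esub> average n N y"
  unfolding average_def by (subst I.M.finsum_addf[symmetric]) (simp_all add: \<beta>_closed \<beta>_add I.M.scale_add Pi_iff)

lemma average_scale:
  "x \<in> carrier D \<Longrightarrow> average n N (cscale D c x) = cscale D c (average n N x)"
  unfolding average_def by (subst I.M.finsum_scale) (simp_all add: \<beta>_closed \<beta>_scale Pi_iff mult.commute)

lemma average_T:
  assumes lm: "l \<in> kmor \<Lambda>" "m \<in> kmor \<Lambda>" and N: "\<And>i. i < k \<Longrightarrow> \<bar>n i + I.deg l m i\<bar> < int N" "N > 0"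
  shows "average n N (I.T l m) = (if \<forall>i<k. n i + I.deg l m i = 0 then I.T l m else \<zero>\<^bsub>D\<^esub>)"
proof -
  have "average n N (I.T l m)
      = finsum D (\<lambda>a. cscale D (torus_char k (root_point k N a) (\<lambda>i. n i + I.deg l m i) / of_nat (N ^ k)) (I.T l m)) (root_indices k N)"
    unfolding average_def using lm
    by (intro I.M.finsum_cong') (auto simp: \<beta>_T torus_char_add[symmetric])
  also have "\<dots> = cscale D (\<Sum>a\<in>root_indices k N. torus_char k (root_point k N a) (\<lambda>i. n i + I.deg l m i) / of_nat (N ^ k)) (I.T l m)"
    using lm by (intro I.M.finsum_scale_sum) auto
  finally have eq: "average n N (I.T l m) = \<dots>" .
  have "(\<Sum>a\<in>root_indices k N. torus_char k (root_point k N a) (\<lambda>i. n i + I.deg l m i) / of_nat (N ^ k))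
      = (if \<forall>i<k. n i + I.deg l m i = 0 then 1 else 0)"
    using N(2) by (simp only: sum_divide_distrib[symmetric] sum_torus_char[OF N(1)]) simp
  then show ?thesis
    unfolding eq using lm by (simp only:) auto
qed

text \<open>For large \<open>N\<close> no degree occurring in \<open>y\<close> other than
  \<open>- n\<close> is congruent to it modulo \<open>N\<close>. The threshold depends on
  \<open>y\<close>, and \<open>eventually\<close> merges the thresholds of the summands.\<close>

lemma average_homogeneous:
  assumes n: "\<forall>i\<ge>k. n i = 0" and y: "y \<in> linear_span D I.Tall"
  shows "eventually (\<lambda>N. average n N y \<in> linear_span D (I.Thom (\<lambda>i. - n i))) sequentially"
  using y I.Tall_closed
proof (induction rule: I.M.linear_span_induct)
  case (base x)
  then obtain l m where lm: "l \<in> kmor \<Lambda>" "m \<in> kmor \<Lambda>" "x = I.T l m"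
    by (auto simp: I.Tall_def)
  have sub: "linear_subspace D (linear_span D (I.Thom (\<lambda>i. - n i)))"
    using I.M.linear_span_subspace[OF I.Thom_closed] .
  \<comment> \<open>The sum dominates each coordinate; the additional 1 gives strictness, and a
    positive \<open>N\<close> also when \<open>k = 0\<close>.\<close>
  define N0 where "N0 = nat (\<Sum>i<k. \<bar>n i + I.deg l m i\<bar>) + 1"
  have N0: "\<bar>n i + I.deg l m i\<bar> < int N0" if "i < k" for i
    using member_le_sum[of i "{..<k}" "\<lambda>i. \<bar>n i + I.deg l m i\<bar>"] that by (simp add: N0_def)
  have "average n N x \<in> linear_span D (I.Thom (\<lambda>i. - n i))" if N: "N \<ge> N0" for N
  proof -
    have "average n N x = (if \<forall>i<k. n i + I.deg l m i = 0 then I.T l m else \<zero>\<^bsub>D\<^esub>)"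
      unfolding lm(3)
    proof (rule average_T[OF lm(1,2)])
      show "\<bar>n i + I.deg l m i\<bar> < int N" if "i < k" for i
        using N0[OF that] N by linarith
      show "N > 0"
        using N by (simp add: N0_def)
    qed
    moreover have "I.T l m \<in> linear_span D (I.Thom (\<lambda>i. - n i))" if "\<forall>i<k. n i + I.deg l m i = 0"
    proof -
      \<comment> \<open>From index \<open>k\<close> on both sides are 0, by the hypothesis on
        \<open>n\<close> and by the form of degrees.\<close>
      have "I.deg l m i = - n i" for i
        using that n I.deg_closed[OF lm(1)] I.deg_closed[OF lm(2)]
        by (cases "i < k") (auto simp: I.deg_def degrees_def)
      then have "I.T l m \<in> I.Thom (\<lambda>i. - n i)"
        using lm by (auto simp: I.Thom_def)
      then show ?thesis
        using I.M.subset_linear_span by blast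
    qed
    ultimately show ?thesis
      using I.M.subspaceD(2)[OF sub] by simp
  qed
  then show ?case
    unfolding eventually_sequentially by blast
next
  case zero
  then show ?case
    using I.M.subspaceD(2)[OF I.M.linear_span_subspace[OF I.Thom_closed]] by (simp add: average_zero)
next
  case (add x y)
  show ?case
    using add.IH
  proof eventually_elim
    case (elim N)
    then show ?case
      using add.hyps span_closed I.M.subspaceD(3)[OF I.M.linear_span_subspace[OF I.Thom_closed]]
      by (simp add: average_add)
  qed
next
  case (scale c x)
  show ?case
    using scale.IH
  proof eventually_elim
    case (elim N)
    then show ?case
      using scale.hyps span_closed I.M.subspaceD(4)[OF I.M.linear_span_subspace[OF I.Thom_closed]]
      by (simp add: average_scale)
  qed
qed

text \<open>Equivariance turns \<open>\<phi>\<close> of the average into an average of the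
  contractions \<open>\<alpha> z\<close> applied to \<open>\<phi> y\<close>, with coefficients whose
  moduli sum to one. For large \<open>N\<close> the average is homogeneous, so \<open>\<phi>\<close>
  is isometric on it and the bound moves back to \<open>D\<close>.\<close>

lemma norm_average:
  assumes n: "\<forall>i\<ge>k. n i = 0" and y: "y \<in> linear_span D I.Tall"
  shows "eventually (\<lambda>N. cnorm D (average n N y) \<le> cnorm M (\<phi> y)) sequentially"
  using average_homogeneous[OF n y] eventually_gt_at_top[of 0]
proof eventually_elim
  case (elim N)
  let ?z = "root_point k N"
  let ?t = "\<lambda>a. torus_char k (?z a) n / of_nat (N ^ k)"
  have yc: "y \<in> carrier D"
    using y span_closed by blast
  have \<alpha>\<phi>y: "\<alpha> (?z a) (\<phi> y) \<in> carrier M" for a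
    using yc by (intro cstar_hom.hom_closed[OF \<alpha>_cstar_hom]) simp_all
  have t: "cmod (?t a) = 1 / real (N ^ k)" for a
    by (simp add: norm_divide torus_char_norm norm_power)
  have "\<phi> (average n N y) = finsum M (\<lambda>a. \<phi> (cscale D (?t a) (\<beta> (?z a) y))) (root_indices k N)"
    unfolding average_def using yc by (intro h.hom_finsum) (simp_all add: \<beta>_closed)
  also have "\<dots> = finsum M (\<lambda>a. cscale M (?t a) (\<alpha> (?z a) (\<phi> y))) (root_indices k N)"
  proof (rule R.M.finsum_cong')
    show "(\<lambda>a. cscale M (?t a) (\<alpha> (?z a) (\<phi> y))) \<in> root_indices k N \<rightarrow> carrier M"
      using \<alpha>\<phi>y by simp
    show "\<phi> (cscale D (?t a) (\<beta> (?z a) y)) = cscale M (?t a) (\<alpha> (?z a) (\<phi> y))" for a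
      using y yc by (simp add: \<beta>_closed h.hom_scale equivariant)
  qed simp
  finally have eq: "\<phi> (average n N y) = finsum M (\<lambda>a. cscale M (?t a) (\<alpha> (?z a) (\<phi> y))) (root_indices k N)" .
  have "cnorm M (\<phi> (average n N y)) \<le> (\<Sum>a\<in>root_indices k N. cnorm M (cscale M (?t a) (\<alpha> (?z a) (\<phi> y))))"
    unfolding eq using \<alpha>\<phi>y by (intro R.M.norm_finsum) simp_all
  also have "\<dots> \<le> (\<Sum>a\<in>root_indices k N. 1 / real (N ^ k) * cnorm M (\<phi> y))"
  proof (rule sum_mono)
    fix a
    have "cnorm M (cscale M (?t a) (\<alpha> (?z a) (\<phi> y))) = 1 / real (N ^ k) * cnorm M (\<alpha> (?z a) (\<phi> y))"
      using \<alpha>\<phi>y[of a] t by (simp only: R.M.norm_scale)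
    also have "\<dots> \<le> 1 / real (N ^ k) * cnorm M (\<phi> y)"
      by (intro mult_left_mono cstar_hom.contractive[OF \<alpha>_cstar_hom]) (simp_all add: yc)
    finally show "cnorm M (cscale M (?t a) (\<alpha> (?z a) (\<phi> y))) \<le> 1 / real (N ^ k) * cnorm M (\<phi> y)" .
  qed
  also have "\<dots> = cnorm M (\<phi> y)"
    using elim(2) by (simp add: card_root_indices)
  finally show ?case
    using homogeneous_isometric[OF elim(1)] by simp
qed

definition smoothing :: "nat \<Rightarrow> nat \<Rightarrow> 'd \<Rightarrow> 'd" where
  "smoothing m N y = finsum D (\<lambda>a. cscale D (of_real (weight k m N a)) (\<beta> (root_point k N a) y)) (root_indices k N)"

lemma smoothing_closed: "y \<in> carrier D \<Longrightarrow> smoothing m N y \<in> carrier D"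
  unfolding smoothing_def by (intro I.M.finsum_closed Pi_I I.M.scale_closed \<beta>_closed) auto

text \<open>Inserting the expansion of the weights and exchanging the two finite sums writes the
  Fejer mean in terms of Fourier coefficients.\<close>

lemma smoothing_eq_averages:
  assumes y: "y \<in> carrier D"
  shows "smoothing m N y = finsum D (\<lambda>q. cscale D (1 / of_nat (m ^ k)) (average (freq k q) N y)) (fejer_freqs k m)"
proof -
  let ?c = "\<lambda>q a. torus_char k (root_point k N a) (freq k q) / of_nat (N ^ k)"
  let ?b = "\<lambda>a. \<beta> (root_point k N a) y"
  have b: "?b a \<in> carrier D" for a
    using y by (simp add: \<beta>_closed)
  have "smoothing m N y = finsum D (\<lambda>a. finsum D (\<lambda>q. cscale D (1 / of_nat (m ^ k) * ?c q a) (?b a)) (fejer_freqs k m)) (root_indices k N)"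
    unfolding smoothing_def weight_eq_sum using b
    by (intro I.M.finsum_cong') (simp_all add: I.M.finsum_scale_sum)
  also have "\<dots> = finsum D (\<lambda>q. finsum D (\<lambda>a. cscale D (1 / of_nat (m ^ k) * ?c q a) (?b a)) (root_indices k N)) (fejer_freqs k m)"
    using b by (intro I.M.finsum_swap) auto
  also have "\<dots> = finsum D (\<lambda>q. cscale D (1 / of_nat (m ^ k)) (average (freq k q) N y)) (fejer_freqs k m)"
  proof (rule I.M.finsum_cong')
    show "(\<lambda>q. cscale D (1 / of_nat (m ^ k)) (average (freq k q) N y)) \<in> fejer_freqs k m \<rightarrow> carrier D"
      using y average_closed by auto
    show "finsum D (\<lambda>a. cscale D (1 / of_nat (m ^ k) * ?c q a) (?b a)) (root_indices k N)
        = cscale D (1 / of_nat (m ^ k)) (average (freq k q) N y)" for q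
      unfolding average_def using b by (subst I.M.finsum_scale) (simp_all add: Pi_iff)
  qed simp
  finally show ?thesis .
qed

text \<open>There are \<open>m ^ (2 k)\<close> frequencies with coefficients
  \<open>1 / m ^ k\<close>. The crude factor \<open>m ^ k\<close> that results is independent of
  \<open>y\<close> and \<open>N\<close>.\<close>

lemma norm_smoothing:
  assumes y: "y \<in> carrier D" and m: "m > 0"
    and K: "\<And>q. q \<in> fejer_freqs k m \<Longrightarrow> cnorm D (average (freq k q) N y) \<le> K"
  shows "cnorm D (smoothing m N y) \<le> real (m ^ k) * K"
proof -
  have "cnorm D (smoothing m N y) \<le> (\<Sum>q\<in>fejer_freqs k m. cnorm D (cscale D (1 / of_nat (m ^ k)) (average (freq k q) N y)))"
    unfolding smoothing_eq_averages[OF y] using y average_closed by (intro I.M.norm_finsum) auto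
  also have "\<dots> \<le> (\<Sum>q\<in>fejer_freqs k m. 1 / real (m ^ k) * K)"
  proof (rule sum_mono)
    fix q assume q: "q \<in> fejer_freqs k m"
    have "cnorm D (cscale D (1 / of_nat (m ^ k)) (average (freq k q) N y)) = 1 / real (m ^ k) * cnorm D (average (freq k q) N y)"
      using average_closed[OF y] by (simp add: I.M.norm_scale norm_divide norm_power)
    then show "cnorm D (cscale D (1 / of_nat (m ^ k)) (average (freq k q) N y)) \<le> 1 / real (m ^ k) * K"
      using mult_left_mono[OF K[OF q], of "1 / real (m ^ k)"] by simp
  qed
  also have "\<dots> = real (m ^ k) * K"
    using m by (simp add: card_fejer_freqs)
  finally show ?thesis .
qed

text \<open>The weights have total mass one, so the difference is the mean of
  \<open>y - \<beta> z y\<close>. A point is near 1 in all coordinates and contributes at most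
  \<open>\<epsilon>\<close>, or it is far in some coordinate and contributes at most
  \<open>B\<close>; the far mass is summed over the \<open>k\<close> coordinates.\<close>

lemma norm_diff_smoothing:
  assumes y: "y \<in> carrier D" and m: "m > 0" "m \<le> N" and \<delta>: "\<delta> > 0" and B: "2 * cnorm D y \<le> B" and \<epsilon>: "\<epsilon> \<ge> 0"
    and near: "\<forall>z\<in>torus k. (\<forall>i<k. cmod (1 - z i) < \<delta>) \<longrightarrow> cnorm D (y \<ominus>\<^bsub>D\<^esub> \<beta> z y) \<le> \<epsilon>"
  shows "cnorm D (y \<ominus>\<^bsub>D\<^esub> smoothing m N y) \<le> \<epsilon> + real k * (B * (4 / (real m * \<delta>\<^sup>2)))"
proof -
  let ?A = "root_indices k N" and ?z = "root_point k N" and ?w = "weight k m N"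
  let ?far = "\<lambda>a i. \<delta> \<le> cmod (1 - ?z a i)"
  have b: "\<beta> (?z a) y \<in> carrier D" for a
    using y by (simp add: \<beta>_closed)
  have B0: "B \<ge> 0"
    using B I.M.norm_nonneg[OF y] by linarith
  have bound: "cnorm D (y \<ominus>\<^bsub>D\<^esub> \<beta> (?z a) y) \<le> \<epsilon> + (\<Sum>i<k. if ?far a i then B else 0)" for a
  proof (cases "\<forall>i<k. cmod (1 - ?z a i) < \<delta>")
    case True
    then have "cnorm D (y \<ominus>\<^bsub>D\<^esub> \<beta> (?z a) y) \<le> \<epsilon>"
      using near by simp
    moreover have "0 \<le> (\<Sum>i<k. if ?far a i then B else 0)"
      using B0 by (intro sum_nonneg) auto
    ultimately show ?thesis
      by linarith
  next
    case False
    then obtain i where i: "i < k" "?far a i"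
      by (auto simp: not_less)
    have "B \<le> (\<Sum>i<k. if ?far a i then B else 0)"
      using member_le_sum[of i "{..<k}" "\<lambda>i. if ?far a i then B else 0"] i B0 by simp
    moreover have "cnorm D (y \<ominus>\<^bsub>D\<^esub> \<beta> (?z a) y) \<le> B"
      using I.M.norm_triangle_diff[OF y b[of a]] \<beta>_contractive[OF root_point_torus y, of N a] B by linarith
    ultimately show ?thesis
      using \<epsilon> by linarith
  qed
  have "y = finsum D (\<lambda>a. cscale D (of_real (?w a)) y) ?A"
    using y sum_weight[OF m, of k] by (simp add: I.M.finsum_scale_sum flip: of_real_sum)
  then have "y \<ominus>\<^bsub>D\<^esub> smoothing m N y
      = finsum D (\<lambda>a. cscale D (of_real (?w a)) y) ?A \<ominus>\<^bsub>D\<^esub> finsum D (\<lambda>a. cscale D (of_real (?w a)) (\<beta> (?z a) y)) ?A"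
    by (simp add: smoothing_def)
  also have "\<dots> = finsum D (\<lambda>a. cscale D (of_real (?w a)) y \<ominus>\<^bsub>D\<^esub> cscale D (of_real (?w a)) (\<beta> (?z a) y)) ?A"
    using y b by (intro I.M.finsum_diff) auto
  also have "\<dots> = finsum D (\<lambda>a. cscale D (of_real (?w a)) (y \<ominus>\<^bsub>D\<^esub> \<beta> (?z a) y)) ?A"
    using y b by (simp add: I.M.scale_diff)
  finally have eq: "y \<ominus>\<^bsub>D\<^esub> smoothing m N y = finsum D (\<lambda>a. cscale D (of_real (?w a)) (y \<ominus>\<^bsub>D\<^esub> \<beta> (?z a) y)) ?A" .
  have "cnorm D (y \<ominus>\<^bsub>D\<^esub> smoothing m N y) \<le> (\<Sum>a\<in>?A. cnorm D (cscale D (of_real (?w a)) (y \<ominus>\<^bsub>D\<^esub> \<beta> (?z a) y)))"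
    unfolding eq using y b by (intro I.M.norm_finsum) simp_all
  also have "\<dots> \<le> (\<Sum>a\<in>?A. ?w a * (\<epsilon> + (\<Sum>i<k. if ?far a i then B else 0)))"
    using y b bound weight_nonneg by (intro sum_mono) (simp add: I.M.norm_scale mult_left_mono)
  also have "\<dots> = \<epsilon> * (\<Sum>a\<in>?A. ?w a) + (\<Sum>i<k. B * (\<Sum>a\<in>?A. if ?far a i then ?w a else 0))"
  proof -
    have "(\<Sum>a\<in>?A. ?w a * (\<Sum>i<k. if ?far a i then B else 0)) = (\<Sum>a\<in>?A. \<Sum>i<k. B * (if ?far a i then ?w a else 0))"
      unfolding sum_distrib_left by (intro sum.cong) auto
    also have "\<dots> = (\<Sum>i<k. \<Sum>a\<in>?A. B * (if ?far a i then ?w a else 0))"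
      by (rule sum.swap)
    finally have "(\<Sum>a\<in>?A. ?w a * (\<Sum>i<k. if ?far a i then B else 0)) = (\<Sum>i<k. B * (\<Sum>a\<in>?A. if ?far a i then ?w a else 0))"
      by (simp only: sum_distrib_left)
    then show ?thesis
      by (simp only: distrib_left sum.distrib) (simp add: sum_distrib_left mult.commute)
  qed
  also have "\<dots> \<le> \<epsilon> * 1 + (\<Sum>i<k. B * (4 / (real m * \<delta>\<^sup>2)))"
    using sum_weight[OF m, of k] sum_weight_far[OF m \<delta>] B0 \<epsilon>
    by (intro add_mono sum_mono mult_left_mono) auto
  finally show ?thesis
    by simp
qed

section \<open>Triviality of the kernel\<close>

lemma kernel_trivial:
  assumes x: "x \<in> carrier D" and \<phi>x: "\<phi> x = \<zero>\<^bsub>M\<^esub>"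
  shows "x = \<zero>\<^bsub>D\<^esub>"
proof (rule I.M.eq_zeroI[OF x])
  fix e :: real assume e: "e > 0"
  \<comment> \<open>Six portions: one for \<open>x - y\<close>, one for the Fejer mean of
    \<open>y\<close>, and four for the distance of \<open>y\<close> to its mean, namely three from
    the points near the unit and one from the far points.\<close>
  define \<epsilon> where "\<epsilon> = e / 6"
  have \<epsilon>: "\<epsilon> > 0"
    using e by (simp add: \<epsilon>_def)
  obtain \<delta> where \<delta>: "\<delta> > 0" "\<forall>z\<in>torus k. (\<forall>i<k. cmod (1 - z i) < \<delta>) \<longrightarrow> cnorm D (x \<ominus>\<^bsub>D\<^esub> \<beta> z x) < \<epsilon>"
    using I.M.continuous_torus_action_near_one[OF \<beta>_action x \<epsilon>] by blast
  \<comment> \<open>This bounds \<open>2 \<parallel>y\<parallel>\<close> for every \<open>y\<close>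
    within distance 1 of \<open>x\<close>, so \<open>m\<close> can be fixed before \<open>y\<close>
    is chosen.\<close>
  define B where "B = 2 * cnorm D x + 2"
  have B: "B > 0"
    using I.M.norm_nonneg[OF x] by (simp add: B_def)
  obtain m :: nat where m: "m > 0" "real k * (B * (4 / (real m * \<delta>\<^sup>2))) \<le> \<epsilon>"
  proof -
    obtain n :: nat where n: "real k * B * 4 / (\<delta>\<^sup>2 * \<epsilon>) < real n"
      using reals_Archimedean2 by blast
    have "real k * B * 4 \<le> real (Suc n) * (\<delta>\<^sup>2 * \<epsilon>)"
    proof -
      have "real k * B * 4 \<le> real n * (\<delta>\<^sup>2 * \<epsilon>)"
        using n \<delta>(1) \<epsilon> by (simp add: pos_divide_less_eq less_imp_le)
      also have "\<dots> \<le> real (Suc n) * (\<delta>\<^sup>2 * \<epsilon>)"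
        using \<epsilon> by (intro mult_right_mono) auto
      finally show ?thesis .
    qed
    then have "real k * B * 4 / (real (Suc n) * \<delta>\<^sup>2) \<le> \<epsilon>"
      using \<delta>(1) by (simp add: pos_divide_le_eq mult_ac)
    then have "real k * (B * (4 / (real (Suc n) * \<delta>\<^sup>2))) \<le> \<epsilon>"
      by (simp add: mult_ac)
    then show ?thesis
      using that[of "Suc n"] by blast
  qed
  \<comment> \<open>The last bound compensates the factor \<open>m ^ k\<close> of the Fejer mean;
    the others keep \<open>y\<close> within 1 and within \<open>\<epsilon>\<close> of
    \<open>x\<close>.\<close>
  define \<gamma> where "\<gamma> = min 1 (min \<epsilon> (\<epsilon> / real (m ^ k)))"
  have \<gamma>: "\<gamma> > 0" "\<gamma> \<le> 1" "\<gamma> \<le> \<epsilon>" "\<gamma> \<le> \<epsilon> / real (m ^ k)"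
    using \<epsilon> m(1) by (auto simp: \<gamma>_def)
  obtain y where y: "y \<in> linear_span D I.Tall" "cnorm D (x \<ominus>\<^bsub>D\<^esub> y) < \<gamma>"
    using I.M.closed_span_approx[OF _ I.Tall_closed \<gamma>(1), of x] x dense by blast
  have yc: "y \<in> carrier D"
    using y(1) span_closed by blast
  have "\<phi> (y \<ominus>\<^bsub>D\<^esub> x) = \<phi> y"
    using yc x \<phi>x by (simp add: h.hom_diff)
  then have \<phi>y: "cnorm M (\<phi> y) \<le> \<epsilon> / real (m ^ k)"
    using h.contractive[of "y \<ominus>\<^bsub>D\<^esub> x"] yc x y(2) \<gamma>(4) I.M.norm_minus_commute[OF yc x] by simp
  have "eventually (\<lambda>N. \<forall>q\<in>fejer_freqs k m. cnorm D (average (freq k q) N y) \<le> cnorm M (\<phi> y)) sequentially"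
    by (intro eventually_ball_finite ballI norm_average y) (simp_all add: freq_def)
  then obtain N0 where N0: "\<And>N. N \<ge> N0 \<Longrightarrow> \<forall>q\<in>fejer_freqs k m. cnorm D (average (freq k q) N y) \<le> cnorm M (\<phi> y)"
    unfolding eventually_sequentially by blast
  \<comment> \<open>Large enough for the averages of \<open>y\<close>, and at least \<open>m\<close>
    so that the weights have mass one.\<close>
  define N where "N = max N0 m"
  have "cnorm D (smoothing m N y) \<le> real (m ^ k) * (\<epsilon> / real (m ^ k))"
    using N0[of N] \<phi>y by (intro norm_smoothing[OF yc m(1)]) (force simp: N_def)
  then have Y: "cnorm D (smoothing m N y) \<le> \<epsilon>"
    using m(1) by simp
  have xy: "cnorm D y \<le> cnorm D x + \<gamma>"
    using I.M.norm_le_add_diff[OF yc x] I.M.norm_minus_commute[OF yc x] y(2) by simp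
  \<comment> \<open>The neighbourhood given by \<open>\<delta>\<close> belongs to \<open>x\<close>;
    passing to \<open>y\<close> and to \<open>\<beta> z y\<close> costs at most
    \<open>\<gamma> \<le> \<epsilon>\<close> each.\<close>
  have "cnorm D (y \<ominus>\<^bsub>D\<^esub> \<beta> z y) \<le> 3 * \<epsilon>" if z: "z \<in> torus k" "\<forall>i<k. cmod (1 - z i) < \<delta>" for z
  proof -
    have c: "\<beta> z x \<in> carrier D" "\<beta> z y \<in> carrier D"
      using z x yc by (simp_all add: \<beta>_closed)
    have "cnorm D (\<beta> z x \<ominus>\<^bsub>D\<^esub> \<beta> z y) \<le> cnorm D (x \<ominus>\<^bsub>D\<^esub> y)"
      using \<beta>_contractive[OF z(1), of "x \<ominus>\<^bsub>D\<^esub> y"] z x yc by (simp add: \<beta>_diff)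
    moreover have "cnorm D (x \<ominus>\<^bsub>D\<^esub> \<beta> z x) < \<epsilon>"
      using \<delta>(2) z by blast
    moreover have "cnorm D (y \<ominus>\<^bsub>D\<^esub> \<beta> z y) \<le> cnorm D (y \<ominus>\<^bsub>D\<^esub> x) + cnorm D (x \<ominus>\<^bsub>D\<^esub> \<beta> z y)"
      "cnorm D (x \<ominus>\<^bsub>D\<^esub> \<beta> z y) \<le> cnorm D (x \<ominus>\<^bsub>D\<^esub> \<beta> z x) + cnorm D (\<beta> z x \<ominus>\<^bsub>D\<^esub> \<beta> z y)"
      using x yc c by (intro I.M.norm_diff_triangle; simp)+
    ultimately show ?thesis
      using y(2) \<gamma>(3) I.M.norm_minus_commute[OF yc x] by linarith
  qed
  then have "cnorm D (y \<ominus>\<^bsub>D\<^esub> smoothing m N y) \<le> 3 * \<epsilon> + real k * (B * (4 / (real m * \<delta>\<^sup>2)))"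
    using \<epsilon> xy \<gamma>(2) by (intro norm_diff_smoothing[OF yc m(1) _ \<delta>(1)]) (auto simp: N_def B_def)
  then have "cnorm D (y \<ominus>\<^bsub>D\<^esub> smoothing m N y) \<le> 4 * \<epsilon>"
    using m(2) by linarith
  moreover have "cnorm D y \<le> cnorm D (smoothing m N y) + cnorm D (y \<ominus>\<^bsub>D\<^esub> smoothing m N y)"
    using I.M.norm_le_add_diff[OF yc smoothing_closed[OF yc]] .
  moreover have "cnorm D x \<le> cnorm D y + cnorm D (x \<ominus>\<^bsub>D\<^esub> y)"
    using I.M.norm_le_add_diff[OF x yc] .
  ultimately show "cnorm D x \<le> e"
    using Y y(2) \<gamma>(3) unfolding \<epsilon>_def by linarith
qed

lemma inj: "inj_on \<phi> (carrier D)"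
proof (rule inj_onI)
  fix x y assume xy: "x \<in> carrier D" "y \<in> carrier D" "\<phi> x = \<phi> y"
  then have "x \<ominus>\<^bsub>D\<^esub> y = \<zero>\<^bsub>D\<^esub>"
    by (intro kernel_trivial) (simp_all add: h.hom_diff)
  then show "x = y"
    using xy by (simp add: I.M.diff_eq_zero_iff)
qed

end

section \<open>Integrating multiplier representations\<close>

context cstar_hom
begin

lemma isometric_inj:
  assumes iso: "\<And>x. x \<in> carrier A \<Longrightarrow> cnorm B (f x) = cnorm A x"
  shows "inj_on f (carrier A)"
proof (rule inj_onI)
  fix x y assume xy: "x \<in> carrier A" "y \<in> carrier A" "f x = f y"
  then have "f (x \<ominus>\<^bsub>A\<^esub> y) = \<zero>\<^bsub>B\<^esub>"
    by (simp add: hom_diff)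
  then have "cnorm A (x \<ominus>\<^bsub>A\<^esub> y) = 0"
    using iso[of "x \<ominus>\<^bsub>A\<^esub> y"] xy by simp
  then show "x = y"
    using xy by (simp add: A.norm_eq_0 A.diff_eq_zero_iff)
qed

text \<open>The preimages of a convergent sequence in the range form a Cauchy sequence, whose limit
  is mapped to the given limit.\<close>

lemma isometric_range_closed:
  assumes iso: "\<And>x. x \<in> carrier A \<Longrightarrow> cnorm B (f x) = cnorm A x"
  shows "closedin (ctopology B) (f ` carrier A)"
proof -
  have sub: "f ` carrier A \<subseteq> carrier B"
    by auto
  have "x \<in> f ` carrier A" if x: "x \<in> ctopology B closure_of (f ` carrier A)" for x
  proof -
    obtain u where u: "\<And>n. u n \<in> f ` carrier A" "B.clim u x"
      using B.in_closure_clim[OF sub x] by blast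
    have "\<exists>a. a \<in> carrier A \<and> u n = f a" for n
      using u(1)[of n] by blast
    then obtain a where a: "\<And>n. a n \<in> carrier A" "\<And>n. u n = f (a n)"
      by metis
    note uc = B.climD[OF u(2)]
    have "\<exists>N. \<forall>m\<ge>N. \<forall>n\<ge>N. cnorm A (a m \<ominus>\<^bsub>A\<^esub> a n) < e" if e: "e > 0" for e
    proof -
      have "eventually (\<lambda>n. cnorm B (u n \<ominus>\<^bsub>B\<^esub> x) < e / 2) sequentially"
        using order_tendstoD(2)[OF uc(3), of "e / 2"] e by simp
      then obtain N where N: "\<And>n. n \<ge> N \<Longrightarrow> cnorm B (u n \<ominus>\<^bsub>B\<^esub> x) < e / 2"
        unfolding eventually_sequentially by blast
      have "cnorm A (a m \<ominus>\<^bsub>A\<^esub> a n) < e" if mn: "m \<ge> N" "n \<ge> N" for m n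
      proof -
        have "cnorm A (a m \<ominus>\<^bsub>A\<^esub> a n) = cnorm B (u m \<ominus>\<^bsub>B\<^esub> u n)"
          using iso[of "a m \<ominus>\<^bsub>A\<^esub> a n"] a by (simp add: hom_diff)
        also have "\<dots> \<le> cnorm B (u m \<ominus>\<^bsub>B\<^esub> x) + cnorm B (x \<ominus>\<^bsub>B\<^esub> u n)"
          using uc by (intro B.norm_diff_triangle) auto
        also have "cnorm B (x \<ominus>\<^bsub>B\<^esub> u n) = cnorm B (u n \<ominus>\<^bsub>B\<^esub> x)"
          using uc by (intro B.norm_minus_commute) auto
        finally show ?thesis
          using N[OF mn(1)] N[OF mn(2)] by simp
      qed
      then show ?thesis
        by blast
    qed
    then obtain y where y: "y \<in> carrier A" "(\<lambda>n. cnorm A (a n \<ominus>\<^bsub>A\<^esub> y)) \<longlonglongrightarrow> 0"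
      using A.Cauchy_converges[of a] a(1) by blast
    then have "A.clim a y"
      using a(1) by (simp add: A.clim_def)
    then have "B.clim (\<lambda>n. f (a n)) (f y)"
      by (rule A.clim_lipschitz[OF B.cstar_algebra_axioms _ hom_closed lipschitz])
    then have "B.clim u (f y)"
      using a(2) by (simp add: B.clim_def)
    then have "x = f y"
      using B.clim_unique[OF u(2)] by blast
    then show ?thesis
      using y(1) by blast
  qed
  then have "ctopology B closure_of (f ` carrier A) = f ` carrier A"
    using B.subset_closure[OF sub] by blast
  then show ?thesis
    using B.closure_closed[of "f ` carrier A"] by simp
qed

text \<open>The elements that \<open>\<psi>\<close> sends into the range of \<open>f\<close> form a
  C*-subalgebra, closed because that range is closed, and it contains the generators. In the
  application \<open>f\<close> embeds an algebra in its multipliers, and \<open>\<psi>\<close> comes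
  from the universal property.\<close>

lemma factor_through:
  assumes iso: "\<And>x. x \<in> carrier A \<Longrightarrow> cnorm B (f x) = cnorm A x"
    and D: "cstar_algebra D" and \<psi>: "star_hom D B \<psi>" and gen: "cstar_generated D X = carrier D"
    and X: "\<And>x. x \<in> X \<Longrightarrow> \<psi> x \<in> f ` carrier A" and Xc: "X \<subseteq> carrier D"
  shows "star_hom D A (\<lambda>x. inv_into (carrier A) f (\<psi> x))" "\<And>x. x \<in> carrier D \<Longrightarrow> \<psi> x \<in> f ` carrier A"
proof -
  interpret D: cstar_algebra D
    by fact
  interpret p: cstar_hom D B \<psi>
    using \<psi> by unfold_locales
  let ?S = "{x \<in> carrier D. \<psi> x \<in> f ` carrier A}"
  have "cstar_subalgebra D ?S"
    unfolding cstar_subalgebra_def linear_subspace_def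
  proof (intro conjI ballI allI)
    have clo: "closedin (ctopology B) (f ` carrier A)"
      using iso by (rule isometric_range_closed)
    show "closedin (ctopology D) ?S"
      using B.cstar_algebra_axioms clo p.hom_closed p.lipschitz by (rule D.closed_preimage)
    have "\<psi> \<zero>\<^bsub>D\<^esub> = f \<zero>\<^bsub>A\<^esub>"
      by simp
    then show "\<zero>\<^bsub>D\<^esub> \<in> ?S"
      by (simp add: image_iff) (metis A.zero_closed hom_zero)
    fix x assume x: "x \<in> ?S"
    then obtain a where a: "a \<in> carrier A" "\<psi> x = f a" and xc: "x \<in> carrier D"
      by auto
    have "\<psi> (cscale D c x) = f (cscale A c a)" for c
      using a xc by (simp add: p.hom_scale hom_scale)
    then show "cscale D c x \<in> ?S" for c
      using a xc by blast
    have "\<psi> (cadj D x) = f (cadj A a)"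
      using a xc by (simp add: p.hom_adj hom_adj)
    then show "cadj D x \<in> ?S"
      using a xc by blast
    fix y assume y: "y \<in> ?S"
    then obtain b where b: "b \<in> carrier A" "\<psi> y = f b" and yc: "y \<in> carrier D"
      by auto
    have "\<psi> (x \<oplus>\<^bsub>D\<^esub> y) = f (a \<oplus>\<^bsub>A\<^esub> b)" "\<psi> (x \<otimes>\<^bsub>D\<^esub> y) = f (a \<otimes>\<^bsub>A\<^esub> b)"
      using a b xc yc by (simp_all add: p.hom_add hom_add p.hom_mult hom_mult)
    then show "x \<oplus>\<^bsub>D\<^esub> y \<in> ?S" "x \<otimes>\<^bsub>D\<^esub> y \<in> ?S"
      using a b xc yc by blast+
  qed auto
  moreover have "X \<subseteq> ?S"
    using X Xc by blast
  ultimately have "cstar_generated D X \<subseteq> ?S"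
    unfolding cstar_generated_def by blast
  then show im: "\<psi> x \<in> f ` carrier A" if "x \<in> carrier D" for x
    using gen that by blast
  have inj: "inj_on f (carrier A)"
    using iso by (rule isometric_inj)
  let ?g = "inv_into (carrier A) f"
  have g: "?g (\<psi> x) \<in> carrier A" "f (?g (\<psi> x)) = \<psi> x" if "x \<in> carrier D" for x
    using im[OF that] by (auto simp: inv_into_into f_inv_into_f)
  have eqI: "?g (\<psi> x) = a" if "x \<in> carrier D" "a \<in> carrier A" "\<psi> x = f a" for x a
    using that inj by simp
  show "star_hom D A (\<lambda>x. ?g (\<psi> x))"
    unfolding star_hom_def
  proof (intro conjI ballI allI)
    fix x y c assume x: "x \<in> carrier D"
    show "?g (\<psi> (cscale D c x)) = cscale A c (?g (\<psi> x))" "?g (\<psi> (cadj D x)) = cadj A (?g (\<psi> x))"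
      using x g[OF x] by (intro eqI; simp add: p.hom_scale hom_scale p.hom_adj hom_adj)+
    assume y: "y \<in> carrier D"
    show "?g (\<psi> (x \<oplus>\<^bsub>D\<^esub> y)) = ?g (\<psi> x) \<oplus>\<^bsub>A\<^esub> ?g (\<psi> y)" "?g (\<psi> (x \<otimes>\<^bsub>D\<^esub> y)) = ?g (\<psi> x) \<otimes>\<^bsub>A\<^esub> ?g (\<psi> y)"
      using x y g[OF x] g[OF y] by (intro eqI; simp add: p.hom_add hom_add p.hom_mult hom_mult)+
  qed (use g in auto)
qed

end

lemma star_hom_comp: "star_hom A B f \<Longrightarrow> star_hom B C g \<Longrightarrow> star_hom A C (\<lambda>x. g (f x))"
  by (simp add: star_hom_def Pi_iff)

text \<open>An element of the test type is a single sequence, so a sequence of lists is laid out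
  along \<open>prod_decode\<close>. The complex component marks whether a position belongs to the
  list, which makes the lengths recoverable; \<open>undefined\<close> fills the other
  positions.\<close>

definition encode_lists :: "(nat \<Rightarrow> 'x list) \<Rightarrow> 'x test" where
  "encode_lists F n = (let (i, j) = prod_decode n in if j < length (F i) then (F i ! j, 1) else (undefined, 0))"

lemma inj_encode_lists: "inj encode_lists"
proof (rule injI, rule ext)
  fix F H :: "nat \<Rightarrow> 'a list" and i
  assume eq: "encode_lists F = encode_lists H"
  have *: "(if j < length (F i) then (F i ! j, 1) else (undefined, 0 :: complex))
      = (if j < length (H i) then (H i ! j, 1) else (undefined, 0))" for j
    using fun_cong[OF eq, of "prod_encode (i, j)"] by (simp add: encode_lists_def)
  have iff: "j < length (F i) \<longleftrightarrow> j < length (H i)" for j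
    using *[of j] by (auto split: if_splits)
  then have len: "length (F i) = length (H i)"
    by (metis linorder_neq_iff)
  show "F i = H i"
    using len
  proof (rule nth_equalityI)
    show "F i ! j = H i ! j" if "j < length (F i)" for j
      using *[of j] that len by simp
  qed
qed

section \<open>The generated algebra inside the test type\<close>

context twisted_rep
begin

primrec list_sum :: "('g \<times> 'c) list \<Rightarrow> 'm" where
  "list_sum [] = \<zero>\<^bsub>M\<^esub>"
| "list_sum (p # ps) = \<pi> (fst p) (snd p) \<oplus>\<^bsub>M\<^esub> list_sum ps"

definition bundle_list :: "('g \<times> 'c) list \<Rightarrow> bool" where
  "bundle_list ps \<longleftrightarrow> (\<forall>p\<in>set ps. fst p \<in> carrier G \<and> snd p \<in> Fib (fst p))"

lemma list_sum_closed: "bundle_list ps \<Longrightarrow> list_sum ps \<in> carrier M"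
  by (induction ps) (auto simp: bundle_list_def \<pi>_closed)

lemma list_sum_append:
  "\<lbrakk>bundle_list ps; bundle_list qs\<rbrakk> \<Longrightarrow> list_sum (ps @ qs) = list_sum ps \<oplus>\<^bsub>M\<^esub> list_sum qs"
proof (induction ps)
  case Nil
  then show ?case
    using list_sum_closed by simp
next
  case (Cons p ps)
  then have "bundle_list ps" "\<pi> (fst p) (snd p) \<in> carrier M"
    by (auto simp: bundle_list_def \<pi>_closed)
  then show ?case
    using Cons list_sum_closed by (simp add: M.a_assoc)
qed

lemma list_sum_scale:
  "bundle_list ps \<Longrightarrow> list_sum (map (\<lambda>p. (fst p, cscale C c (snd p))) ps) = cscale M c (list_sum ps)"
proof (induction ps)
  case (Cons p ps)
  then have "bundle_list ps" "fst p \<in> carrier G" "snd p \<in> Fib (fst p)"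
    by (auto simp: bundle_list_def)
  then show ?case
    using Cons list_sum_closed by (simp add: M.scale_add \<pi>_scale \<pi>_closed)
qed simp

text \<open>Scalars are absorbed into the bundle elements, the fibres being subspaces, so a finite
  combination is coded without separate coefficients.\<close>

lemma span_list_sum:
  assumes "x \<in> linear_span M Tall"
  shows "\<exists>ps. bundle_list ps \<and> x = list_sum ps"
  using assms Tall_closed
proof (induction rule: M.linear_span_induct)
  case (base x)
  then obtain l m where lm: "l \<in> kmor \<Lambda>" "m \<in> kmor \<Lambda>" "x = T l m"
    by (auto simp: Tall_def)
  then show ?case
    using E_Fib[OF lm(1,2)] \<pi>_closed[OF _ E_Fib[OF lm(1,2)]]
    by (intro exI[of _ "[(gr l m, E l m)]"]) (simp add: bundle_list_def T_def)
next
  case zero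
  show ?case
    by (intro exI[of _ "[]"]) (simp add: bundle_list_def)
next
  case (add x y)
  obtain ps where ps: "bundle_list ps" "x = list_sum ps"
    using add.IH(1) by blast
  obtain qs where qs: "bundle_list qs" "y = list_sum qs"
    using add.IH(2) by blast
  have "bundle_list (ps @ qs)"
    using ps(1) qs(1) by (auto simp: bundle_list_def)
  then show ?case
    using ps qs list_sum_append[OF ps(1) qs(1)] by (intro exI[of _ "ps @ qs"]) simp
next
  case (scale c x)
  obtain ps where ps: "bundle_list ps" "x = list_sum ps"
    using scale.IH by blast
  have "bundle_list (map (\<lambda>p. (fst p, cscale C c (snd p))) ps)"
    using ps(1) C.subspaceD(4)[OF Fib_subspace] by (auto simp: bundle_list_def)
  then show ?case
    using ps list_sum_scale[OF ps(1)] by (intro exI[of _ "map (\<lambda>p. (fst p, cscale C c (snd p))) ps"]) simp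
qed

text \<open>An element of the generated C*-algebra is coded by a sequence of finite sums of bundle elements
  converging to it.\<close>

lemma embedding_into_test:
  obtains enc :: "'m \<Rightarrow> ('g \<times> 'c) test" where "inj_on enc (closed_span M Tall)"
proof -
  let ?S = "closed_span M Tall"
  have "\<exists>F. M.clim (\<lambda>n. list_sum (F n)) x" if x: "x \<in> ?S" for x
  proof -
    obtain u where u: "\<And>n. u n \<in> linear_span M Tall" "M.clim u x"
      using M.in_closure_clim[OF M.linear_span_subset_carrier[OF Tall_closed]] x unfolding closed_span_def by blast
    have "\<exists>ps. u n = list_sum ps" for n
      using span_list_sum[OF u(1)[of n]] by blast
    then obtain F where F: "\<And>n. u n = list_sum (F n)"
      by metis
    have "u = (\<lambda>n. list_sum (F n))"
      using F by blast
    then show ?thesis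
      using u(2) by auto
  qed
  then obtain code where code: "\<And>x. x \<in> ?S \<Longrightarrow> M.clim (\<lambda>n. list_sum (code x n)) x"
    by metis
  have "inj_on code ?S"
  proof (rule inj_onI)
    fix x y assume xy: "x \<in> ?S" "y \<in> ?S" "code x = code y"
    show "x = y"
      using M.clim_unique[OF code[OF xy(1)]] code[OF xy(2)] xy(3) by simp
  qed
  then have "inj_on (encode_lists \<circ> code) ?S"
    using inj_encode_lists by (intro comp_inj_on) (auto intro: inj_on_subset)
  then show ?thesis
    using that by blast
qed

lemma vertex_Fib: "v \<in> kvertices \<Lambda> \<Longrightarrow> s v \<in> Fib \<one>\<^bsub>G\<^esub>"
  using E_Fib[of v v] by (simp add: gr_self proj_adj proj_idem)

text \<open>A left unit for each \<open>T l m\<close> inside the unit fibre; from this follows the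
  nondegeneracy of the representation on the copied algebra.\<close>

lemma vertex_mult_T:
  assumes l: "l \<in> kmor \<Lambda>" and m: "m \<in> kmor \<Lambda>"
  shows "\<pi> \<one>\<^bsub>G\<^esub> (s (krng \<Lambda> l)) \<otimes>\<^bsub>M\<^esub> T l m = T l m"
proof -
  have "s (krng \<Lambda> l) \<otimes> E l m = E l m"
    using l m by (simp add: C.mult_assoc[symmetric] rng_s rng_closed)
  then show ?thesis
    unfolding T_def using \<pi>_mult[OF _ _ vertex_Fib[OF rng_vertex[OF l]] E_Fib[OF l m]] l m
      \<pi>_closed[OF _ E_Fib[OF l m]] by (simp add: \<sigma>_one)
qed

text \<open>The universal property speaks of algebras in the test type. There \<open>N\<close> is a
  copy of the closed span of the \<open>T l m\<close>, and \<open>\<pi>\<close> becomes a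
  representation by multipliers of \<open>N\<close>. The homomorphism obtained maps \<open>D\<close>
  to those multipliers, but it lands in the embedded copy of \<open>N\<close> and can be decoded
  into \<open>M\<close>.\<close>

lemma universal_integrates:
  assumes univ: "universal_bundle_rep G (deformed_bundle G \<sigma> (kgraph_bundle \<Lambda> G \<eta> C s)) D \<iota>"
  shows "\<exists>\<phi>. integrates G (deformed_bundle G \<sigma> (kgraph_bundle \<Lambda> G \<eta> C s)) D \<iota> M \<pi> \<phi>"
proof -
  let ?B = "deformed_bundle G \<sigma> (kgraph_bundle \<Lambda> G \<eta> C s)" and ?S = "closed_span M Tall"
  have fib: "fib ?B g = Fib g" for g
    by (simp add: deformed_bundle_def bundle_simps)
  obtain enc :: "'m \<Rightarrow> ('g \<times> 'c) test" where inj: "inj_on enc ?S"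
    using embedding_into_test by blast
  define N where "N = cstar_image M ?S enc"
  define dec where "dec = inv_into ?S enc"
  note Ssub = closed_span_Tall_subalgebra
  note S1 = M.subspaceD[OF M.subalgebraD(1)[OF Ssub]] and S2 = M.subalgebraD[OF Ssub]
  interpret N: cstar_algebra N
    unfolding N_def using Ssub inj by (rule M.cstar_algebra_image)
  note simps = cstar_image_simps[OF inj, where M = M, folded N_def]
  have dec_enc: "dec (enc x) = x" if "x \<in> ?S" for x
    using that inj by (simp add: dec_def)
  have "star_hom N M dec"
    unfolding star_hom_def simps using S1 S2 by (auto simp: simps dec_enc)
  then interpret dec: cstar_hom N M dec
    by unfold_locales
  have dec_iso: "cnorm M (dec x) = cnorm N x" if "x \<in> carrier N" for x
    using that by (auto simp: simps dec_enc)
  let ?MN = "multiplier_algebra N"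
  interpret MN: cstar_algebra ?MN
    by (rule N.cstar_algebra_multiplier)
  interpret emb: cstar_hom N ?MN N.embed_multiplier
    using N.star_hom_embed by unfold_locales
  define \<tau> where "\<tau> g b = N.embed_multiplier (enc (\<pi> g b))" for g b
  have encc: "enc x \<in> carrier N" if "x \<in> ?S" for x
    using that by (simp add: simps)
  have maps_\<tau>: "bundle_maps G ?B ?MN \<tau>"
    unfolding bundle_maps_def fib
  proof (intro conjI ballI allI)
    fix g assume g: "g \<in> carrier G"
    note p = \<pi>_Fib[OF g]
    show "\<tau> g \<in> Fib g \<rightarrow> carrier ?MN"
      using p encc by (simp add: \<tau>_def)
    fix b assume b: "b \<in> Fib g"
    have "\<pi> g (fscale ?B g w b) = cscale M w (\<pi> g b)" for w
      using maps g b unfolding bundle_maps_def fib by blast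
    then show "\<tau> g (fscale ?B g w b) = cscale ?MN w (\<tau> g b)" for w
      using p[OF b] encc by (simp add: \<tau>_def simps[symmetric] emb.hom_scale)
    have "cadj M (\<pi> g b) = \<pi> (inv\<^bsub>G\<^esub> g) (fadj ?B g b)"
      using maps g b unfolding bundle_maps_def fib by blast
    then show "cadj ?MN (\<tau> g b) = \<tau> (inv\<^bsub>G\<^esub> g) (fadj ?B g b)"
      using p[OF b] encc by (simp add: \<tau>_def simps emb.hom_adj[symmetric])
    show "\<tau> g (fadd ?B g b c) = \<tau> g b \<oplus>\<^bsub>?MN\<^esub> \<tau> g c" if c: "c \<in> Fib g" for c
    proof -
      have "\<pi> g (fadd ?B g b c) = \<pi> g b \<oplus>\<^bsub>M\<^esub> \<pi> g c"
        using maps g b c unfolding bundle_maps_def fib by blast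
      then show ?thesis
        using p[OF b] p[OF c] encc by (simp add: \<tau>_def simps emb.hom_add[symmetric])
    qed
    fix h c assume h: "h \<in> carrier G" and c: "c \<in> Fib h"
    have "\<pi> (g \<otimes>\<^bsub>G\<^esub> h) (fmult ?B g h b c) = \<pi> g b \<otimes>\<^bsub>M\<^esub> \<pi> h c"
      using maps g h b c unfolding bundle_maps_def fib by blast
    then show "\<tau> (g \<otimes>\<^bsub>G\<^esub> h) (fmult ?B g h b c) = \<tau> g b \<otimes>\<^bsub>?MN\<^esub> \<tau> h c"
      using p[OF b] \<pi>_Fib[OF h c] encc by (simp add: \<tau>_def simps emb.hom_mult[symmetric])
  qed
  let ?X = "{fst (\<tau> \<one>\<^bsub>G\<^esub> b) a | b a. b \<in> Fib \<one>\<^bsub>G\<^esub> \<and> a \<in> carrier N}"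
  have X_eq: "fst (\<tau> \<one>\<^bsub>G\<^esub> b) a = enc (\<pi> \<one>\<^bsub>G\<^esub> b) \<otimes>\<^bsub>N\<^esub> a" if "b \<in> Fib \<one>\<^bsub>G\<^esub>" "a \<in> carrier N" for a b
    using that by (simp add: \<tau>_def N.embed_apply)
  have Xc: "?X \<subseteq> carrier N"
  proof
    fix x assume "x \<in> ?X"
    then obtain b a where "b \<in> Fib \<one>\<^bsub>G\<^esub>" "a \<in> carrier N" "x = enc (\<pi> \<one>\<^bsub>G\<^esub> b) \<otimes>\<^bsub>N\<^esub> a"
      using X_eq by auto
    then show "x \<in> carrier N"
      using \<pi>_Fib[OF G.one_closed] encc by simp
  qed
  note Xsub = N.subspaceD[OF N.closed_span_subspace[OF Xc]]
  \<comment> \<open>Nondegeneracy on the generators: \<open>T l m\<close> is reproduced by the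
    projection at \<open>krng \<Lambda> l\<close>.\<close>
  have TX: "enc (T l m) \<in> closed_span N ?X" if lm: "l \<in> kmor \<Lambda>" "m \<in> kmor \<Lambda>" for l m
  proof -
    let ?v = "s (krng \<Lambda> l)"
    have v: "?v \<in> Fib \<one>\<^bsub>G\<^esub>"
      using vertex_Fib[OF rng_vertex[OF lm(1)]] .
    have t: "T l m \<in> ?S"
      using subsetD[OF M.subset_closed_span[OF Tall_closed], of "T l m"] lm by (auto simp: Tall_def)
    have "enc (\<pi> \<one>\<^bsub>G\<^esub> ?v) \<otimes>\<^bsub>N\<^esub> enc (T l m) = enc (T l m)"
      using t \<pi>_Fib[OF G.one_closed v] vertex_mult_T[OF lm] by (simp add: simps)
    then have "enc (T l m) = fst (\<tau> \<one>\<^bsub>G\<^esub> ?v) (enc (T l m))"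
      using X_eq[OF v encc[OF t]] by simp
    then have "enc (T l m) \<in> ?X"
      using v encc[OF t] by blast
    then show ?thesis
      using N.subset_closed_span[OF Xc] by blast
  qed
  have spanX: "enc u \<in> closed_span N ?X" if u: "u \<in> linear_span M Tall" for u
    using u Tall_closed
  proof (induction rule: M.linear_span_induct)
    case (base x)
    then show ?case
      using TX by (auto simp: Tall_def)
  next
    case zero
    then show ?case
      using Xsub(2) by (simp add: simps)
  next
    case (add x y)
    then have "x \<in> ?S" "y \<in> ?S"
      using M.linear_span_subset_closed_span[OF Tall_closed] by auto
    then show ?case
      using Xsub(3)[OF add.IH] by (simp add: simps)
  next
    case (scale c x)
    then have "x \<in> ?S"
      using M.linear_span_subset_closed_span[OF Tall_closed] by auto
    then show ?case
      using Xsub(4)[OF scale.IH, of c] by (simp add: simps)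
  qed
  have "carrier N \<subseteq> closed_span N ?X"
  proof
    fix n assume n: "n \<in> carrier N"
    then obtain x where x: "x \<in> ?S" "n = enc x"
      by (auto simp: simps)
    have "\<exists>y\<in>closed_span N ?X. cnorm N (n \<ominus>\<^bsub>N\<^esub> y) < e" if e: "e > 0" for e
    proof -
      obtain u where u: "u \<in> linear_span M Tall" "cnorm M (x \<ominus>\<^bsub>M\<^esub> u) < e"
        using M.closed_span_approx[OF x(1) Tall_closed e] by blast
      have uS: "u \<in> ?S"
        using u(1) M.linear_span_subset_closed_span[OF Tall_closed] by blast
      have "cnorm N (n \<ominus>\<^bsub>N\<^esub> enc u) = cnorm M (x \<ominus>\<^bsub>M\<^esub> u)"
        using dec_iso[of "n \<ominus>\<^bsub>N\<^esub> enc u"] encc[OF uS] n x uS by (simp add: dec.hom_diff dec_enc)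
      then show ?thesis
        using spanX[OF u(1)] u(2) by (intro bexI[of _ "enc u"]) simp_all
    qed
    then show "n \<in> closed_span N ?X"
      using N.closed_span_closed[of ?X] n unfolding N.closedin_iff by blast
  qed
  then have "closed_span N ?X = carrier N"
    using N.closed_span_subset_carrier by blast
  then have "bundle_multiplier_rep G ?B N \<tau>"
    using maps_\<tau> unfolding bundle_multiplier_rep_def fib by blast
  then obtain \<psi> where \<psi>: "integrates G ?B D \<iota> ?MN \<tau> \<psi>"
    using univ N.cstar_algebra_axioms unfolding universal_bundle_rep_def by blast
  have D: "cstar_algebra D" "cstar_generated D (\<Union>g\<in>carrier G. \<iota> g ` fib ?B g) = carrier D"
    and \<iota>: "bundle_maps G ?B D \<iota>"
    using univ unfolding universal_bundle_rep_def bundle_rep_def by blast+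
  have \<psi>1: "star_hom D ?MN \<psi>" and \<psi>2: "\<And>g b. g \<in> carrier G \<Longrightarrow> b \<in> Fib g \<Longrightarrow> \<psi> (\<iota> g b) = \<tau> g b"
    using \<psi> unfolding integrates_def fib by blast+
  have \<iota>c: "\<iota> g b \<in> carrier D" if "g \<in> carrier G" "b \<in> Fib g" for g b
    using \<iota> that unfolding bundle_maps_def fib by blast
  \<comment> \<open>The embedding of \<open>N\<close> in its multipliers is isometric, hence can be
    undone on the image of \<open>\<psi>\<close>.\<close>
  let ?\<chi> = "\<lambda>x. inv_into (carrier N) N.embed_multiplier (\<psi> x)"
  have "star_hom D N ?\<chi>"
  proof (rule emb.factor_through(1)[OF N.norm_embed D(1) \<psi>1 D(2)])
    fix x assume "x \<in> (\<Union>g\<in>carrier G. \<iota> g ` fib ?B g)"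
    then obtain g b where gb: "g \<in> carrier G" "b \<in> Fib g" "x = \<iota> g b"
      unfolding fib by blast
    then show "\<psi> x \<in> N.embed_multiplier ` carrier N"
      using \<psi>2[OF gb(1,2)] encc[OF \<pi>_Fib[OF gb(1,2)]] by (simp add: \<tau>_def)
  next
    show "(\<Union>g\<in>carrier G. \<iota> g ` fib ?B g) \<subseteq> carrier D"
      using \<iota>c unfolding fib by blast
  qed
  then have "star_hom D M (\<lambda>x. dec (?\<chi> x))"
    using dec.hom by (rule star_hom_comp)
  moreover have "dec (?\<chi> (\<iota> g b)) = \<pi> g b" if gb: "g \<in> carrier G" "b \<in> Fib g" for g b
  proof -
    have "?\<chi> (\<iota> g b) = enc (\<pi> g b)"
      using \<psi>2[OF gb] encc[OF \<pi>_Fib[OF gb]] inv_into_f_f[OF emb.isometric_inj[OF N.norm_embed]] by (simp add: \<tau>_def)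
    then show ?thesis
      using dec_enc[OF \<pi>_Fib[OF gb]] by simp
  qed
  ultimately have "integrates G ?B D \<iota> M \<pi> (\<lambda>x. dec (?\<chi> x))"
    unfolding integrates_def fib by blast
  then show ?thesis
    by blast
qed

end

section \<open>Faithfulness of the integrated form\<close>

theorem theorem5p1:
  fixes k :: nat
    and \<Lambda> :: "'l kgraph"
    and G :: "'g monoid"
    and \<eta> :: "'l \<Rightarrow> 'g"
    and C :: "'c cstar" and s :: "'l \<Rightarrow> 'c"
    and B :: "('g, 'c) fell_data"
    and \<sigma> :: "'g \<Rightarrow> 'g \<Rightarrow> complex"
    and D :: "'d cstar" and \<iota> :: "'g \<Rightarrow> 'c \<Rightarrow> 'd"
    and \<beta> :: "(nat \<Rightarrow> complex) \<Rightarrow> 'd \<Rightarrow> 'd"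
    and A :: "'a cstar"
    and \<rho> :: "'g \<Rightarrow> 'c \<Rightarrow> ('a \<Rightarrow> 'a) \<times> ('a \<Rightarrow> 'a)"
    and \<alpha> :: "(nat \<Rightarrow> complex) \<Rightarrow> ('a \<Rightarrow> 'a) \<times> ('a \<Rightarrow> 'a) \<Rightarrow> ('a \<Rightarrow> 'a) \<times> ('a \<Rightarrow> 'a)"
  assumes "higher_rank_graph k \<Lambda>"
    and "row_finite_no_sources k \<Lambda>"
    and "group G"
    and "functor_to_group \<Lambda> G \<eta>"
    and "universal_cuntz_krieger_family k \<Lambda> C s"
    and "B = kgraph_bundle \<Lambda> G \<eta> C s"
    and "two_cocycle G \<sigma>"
    and "universal_bundle_rep G (deformed_bundle G \<sigma> B) D \<iota>"
    and "gauge_action k \<Lambda> G \<eta> C s D \<iota> \<beta>"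
    and "cstar_algebra A"
    and "bundle_multiplier_rep G (deformed_bundle G \<sigma> B) A \<rho>"
    and "strictly_continuous_torus_action k A \<alpha>"
    and "\<forall>z\<in>torus k. \<forall>g\<in>carrier G. \<forall>b\<in>fib B g. \<rho> g (on_fibre B \<iota> (\<beta> z) g b) = \<alpha> z (\<rho> g b)"
    and "\<forall>v\<in>kvertices \<Lambda>. \<rho> \<one>\<^bsub>G\<^esub> (s v) \<noteq> \<zero>\<^bsub>multiplier_algebra A\<^esub>"
  shows "\<exists>\<phi>. integrates G (deformed_bundle G \<sigma> B) D \<iota> (multiplier_algebra A) \<rho> \<phi> \<and> inj_on \<phi> (carrier D)"
proof -
  let ?B = "kgraph_bundle \<Lambda> G \<eta> C s" and ?M = "multiplier_algebra A"
  note hyps = assms[unfolded assms(6)]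
  have C: "cstar_algebra C" "cuntz_krieger_family k \<Lambda> C s"
    using assms(5) unfolding universal_cuntz_krieger_family_def by blast+
  have M: "cstar_algebra ?M"
    using assms(10) by (rule cstar_algebra.cstar_algebra_multiplier)
  have D: "cstar_algebra D" "bundle_maps G (deformed_bundle G \<sigma> ?B) D \<iota>"
    "cstar_generated D (\<Union>g\<in>carrier G. \<iota> g ` fib (deformed_bundle G \<sigma> ?B) g) = carrier D"
    using hyps(8) unfolding universal_bundle_rep_def bundle_rep_def by blast+
  have \<rho>: "bundle_maps G (deformed_bundle G \<sigma> ?B) ?M \<rho>"
    using hyps(11) unfolding bundle_multiplier_rep_def by blast
  have graded: "graded_ck_family k \<Lambda> C s G \<eta>"
    unfolding graded_ck_family_def graded_ck_family_axioms_def ck_family_def ck_family_axioms_def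
    using assms(1-4) C by blast
  interpret I: twisted_rep k \<Lambda> C s G \<eta> D \<sigma> \<iota>
    unfolding twisted_rep_def twisted_rep_axioms_def using graded D(1,2) assms(7) by blast
  interpret R: twisted_rep k \<Lambda> C s G \<eta> ?M \<sigma> \<rho>
    unfolding twisted_rep_def twisted_rep_axioms_def using graded M assms(7) \<rho> by blast
  obtain \<phi> where \<phi>: "integrates G (deformed_bundle G \<sigma> ?B) D \<iota> ?M \<rho> \<phi>"
    using R.universal_integrates[OF hyps(8)] by blast
  have fib: "fib (deformed_bundle G \<sigma> ?B) g = I.Fib g" for g
    by (simp add: deformed_bundle_def I.bundle_simps)
  have \<phi>_hom: "star_hom D ?M \<phi>" and \<phi>_\<iota>: "\<And>g b. g \<in> carrier G \<Longrightarrow> b \<in> I.Fib g \<Longrightarrow> \<phi> (\<iota> g b) = \<rho> g b"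
    using \<phi> unfolding integrates_def fib by blast+
  interpret intertwined_reps k \<Lambda> C s G \<eta> \<sigma> D \<iota> ?M \<rho> \<phi>
    using \<phi>_hom \<phi>_\<iota> assms(14) by unfold_locales auto
  have act: "continuous_torus_action k D \<beta>" and \<beta>E: "\<And>z l m. z \<in> torus k \<Longrightarrow> l \<in> kmor \<Lambda> \<Longrightarrow> m \<in> kmor \<Lambda> \<Longrightarrow>
      \<beta> z (\<iota> (\<eta> l \<otimes>\<^bsub>G\<^esub> inv\<^bsub>G\<^esub> (\<eta> m)) (I.E l m)) =
        cscale D (gauge_character k \<Lambda> z l m) (\<iota> (\<eta> l \<otimes>\<^bsub>G\<^esub> inv\<^bsub>G\<^esub> (\<eta> m)) (I.E l m))"
    using assms(9) unfolding gauge_action_def by blast+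
  have \<beta>T: "\<beta> z (I.T l m) = cscale D (torus_char k z (I.deg l m)) (I.T l m)"
    if "z \<in> torus k" "l \<in> kmor \<Lambda>" "m \<in> kmor \<Lambda>" for z l m
    using \<beta>E[OF that] by (simp add: I.T_def I.gr_def I.deg_def torus_char_def gauge_character_def)
  have gauge: "gauge_equivariant k \<Lambda> C s G \<eta> \<sigma> D \<iota> ?M \<rho> \<phi> \<beta> \<alpha>"
  proof (intro gauge_equivariant.intro gauge_equivariant_axioms.intro)
    show "intertwined_reps k \<Lambda> C s G \<eta> \<sigma> D \<iota> ?M \<rho> \<phi>"
      by unfold_locales
    show "continuous_torus_action k D \<beta>"
      by fact
    show "star_hom ?M ?M (\<alpha> z)" if "z \<in> torus k" for z
      using assms(12) that
      unfolding strictly_continuous_torus_action_def torus_action_def star_automorphism_def by blast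
    show "closed_span D I.Tall = carrier D"
    proof
      \<comment> \<open>The closed span is a C*-subalgebra containing the images of the fibres, and
        these generate \<open>D\<close>.\<close>
      have "(\<Union>g\<in>carrier G. \<iota> g ` fib (deformed_bundle G \<sigma> ?B) g) \<subseteq> closed_span D I.Tall"
        unfolding fib using I.\<pi>_Fib by blast
      then have "cstar_generated D (\<Union>g\<in>carrier G. \<iota> g ` fib (deformed_bundle G \<sigma> ?B) g) \<subseteq> closed_span D I.Tall"
        unfolding cstar_generated_def using I.closed_span_Tall_subalgebra by blast
      then show "carrier D \<subseteq> closed_span D I.Tall"
        using D(3) by simp
    qed (rule I.M.closed_span_subset_carrier)
    fix z l m assume z: "z \<in> torus k" and lm: "l \<in> kmor \<Lambda>" "m \<in> kmor \<Lambda>"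
    show "\<beta> z (I.T l m) = cscale D (torus_char k z (I.deg l m)) (I.T l m)"
      using z lm by (rule \<beta>T)
    let ?g = "I.gr l m"
    let ?b = "on_fibre ?B \<iota> (\<beta> z) ?g (I.E l m)"
    have g: "?g \<in> carrier G" and E: "I.E l m \<in> I.Fib ?g"
      using lm I.E_Fib by auto
    \<comment> \<open>The inverse in \<open>on_fibre\<close> is meaningful on the image of the fibre
      only; on the generators the gauge action multiplies by a scalar and so does not leave that
      image.\<close>
    have "\<beta> z (\<iota> ?g (I.E l m)) = \<iota> ?g (cscale C (torus_char k z (I.deg l m)) (I.E l m))"
      using \<beta>T[OF z lm] I.\<pi>_scale[OF g E] by (simp add: I.T_def)
    moreover have "cscale C (torus_char k z (I.deg l m)) (I.E l m) \<in> I.Fib ?g"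
      using I.C.subspaceD(4)[OF I.Fib_subspace E] .
    ultimately have im: "\<beta> z (\<iota> ?g (I.E l m)) \<in> \<iota> ?g ` I.Fib ?g"
      by simp
    have b: "?b \<in> I.Fib ?g" "\<iota> ?g ?b = \<beta> z (\<iota> ?g (I.E l m))"
      using inv_into_into[OF im] f_inv_into_f[OF im] by (simp_all add: on_fibre_def I.bundle_simps)
    have "\<phi> (\<beta> z (I.T l m)) = \<rho> ?g ?b"
      using \<phi>_\<iota>[OF g b(1)] b(2) by (simp add: I.T_def)
    also have "\<dots> = \<alpha> z (\<rho> ?g (I.E l m))"
      using hyps(13) z g E unfolding I.bundle_simps by blast
    finally show "\<phi> (\<beta> z (I.T l m)) = \<alpha> z (R.T l m)"
      by (simp add: R.T_def)
  qed
  then have "inj_on \<phi> (carrier D)"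
    by (rule gauge_equivariant.inj)
  then show ?thesis
    using \<phi> unfolding assms(6) by blast
qed

end
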